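(* Let $P$ be a property that is either in $\mathcal{P}$ or the tautologically true property. If $P$ is a strongly undecidable, recursively axiomatizable, Boone-Higman property that is closed under subgroups, then there is no comeager isomorphism class in $\mathcal{G}_P$; that is, there is no comeager subset of $\mathcal{G}_P$ all of whose elements are pairwise isomorphic groups.
   Context: An enumerated group is a group whose underlying set is $\mathbf{N}=\{1,2,3,\ldots\}$. The set $\mathcal{G}$ of enumerated groups is identified, via (multiplication, inversion, identity), with a subset of $\mathbf{N}^{\mathbf{N}\times\mathbf{N}}\times\mathbf{N}^{\mathbf{N}}\times\mathbf{N}$ (product topology, $\mathbf{N}$ discrete) and given the subspace topology; it is a Polish space. For a property $P$ of groups, $\mathcal{G}_P\subset\mathcal{G}$ is the subspace of enumerated groups satisfying $P$ (so $\mathcal{G}_P=\mathcal{G}$ if $P$ is tautologically true). A subset of a space is comeager if it contains a countable intersection of dense open subsets of that space. $\mathcal{P}$ is the following set of properties of groups: amenability; having no subgroup isomorphic to the free group $\mathbf{F}_2$; left orderability (existence of a left-invariant total order); local indicability (every nontrivial finitely generated subgroup has an infinite cyclic quotient); biorderability (existence of a total order invariant under left and right translation); the unique product property (for all nonempty finite subsets $X,Y$ there is an element that can be written as $xy$ with $x\in X,y\in Y$ in exactly one way); torsion-freeness; soficity; not satisfying a law (for every nontrivial freely reduced word $w$ there is a tuple $\vec a$ in the group with $w(\vec a)\neq e$). For each $P\in\mathcal{P}$ the space $\mathcal{G}_P$ is Polish. $P$ is recursively axiomatizable if there is a recursive set $T$ of first-order sentences in the language of groups such that a group satisfies $P$ if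 and only if it is a model of $T$. $P$ is a Boone-Higman property if every (finitely generated) group $G$ that has a solvable word problem and satisfies $P$ embeds in a simple subgroup of a finitely presented group $H$ that also satisfies $P$. $P$ is strongly undecidable if there exist a finitely presented group $G$ and a finite subset $X\subset G$ such that: (i) there is a group $H$ satisfying $P$ and a surjective homomorphism $\phi:G\to H$ whose restriction to $X$ is injective; and (ii) if $H$ is a group satisfying $P$ for which there exists a surjective homomorphism $\phi:G\to H$ whose restriction to $X$ is injective, then $H$ has an unsolvable word problem. *)

theory Defs
  imports
    "HOL-Analysis.Analysis"
    "HOL-Algebra.Elementary_Groups"
    "HOL-Library.Nat_Bijection"
begin

section \<open>Recursive sets of natural numbers\<close>

text \<open>
  \<open>recursive_fn n f\<close>: the restriction of \<open>f\<close> to lists of length \<open>n\<close> is a (total) recursive function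
  of \<open>n\<close> arguments.  Minimization is only applied to regular functions, so that all functions
  obtained are total.  Values on lists of a different length are irrelevant.
\<close>

inductive recursive_fn :: "nat \<Rightarrow> (nat list \<Rightarrow> nat) \<Rightarrow> bool" where
  rec_zero: "recursive_fn n (\<lambda>xs. 0)"
| rec_suc: "recursive_fn 1 (\<lambda>xs. Suc (xs ! 0))"
| rec_proj: "i < n \<Longrightarrow> recursive_fn n (\<lambda>xs. xs ! i)"
| rec_comp: "recursive_fn (length fs) g \<Longrightarrow> (\<forall>f\<in>set fs. recursive_fn n f) \<Longrightarrow>
    recursive_fn n (\<lambda>xs. g (map (\<lambda>f. f xs) fs))"
| rec_prim: "recursive_fn n f \<Longrightarrow> recursive_fn (n + 2) g \<Longrightarrow>
    recursive_fn (n + 1) (\<lambda>xs. rec_nat (f (tl xs)) (\<lambda>k r. g (k # r # tl xs)) (hd xs))"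
| rec_min: "recursive_fn (n + 1) f \<Longrightarrow> (\<forall>xs. length xs = n \<longrightarrow> (\<exists>k. f (k # xs) = 0)) \<Longrightarrow>
    recursive_fn n (\<lambda>xs. LEAST k. f (k # xs) = 0)"

definition recursive_set :: "nat set \<Rightarrow> bool" where
  "recursive_set A \<longleftrightarrow> (\<exists>f. recursive_fn 1 f \<and> (\<forall>x. f [x] = (if x \<in> A then 1 else 0)))"


section \<open>Words and free groups\<close>

text \<open>The letter \<open>(i, False)\<close> is the generator \<open>x\<^sub>i\<close>, the letter \<open>(i, True)\<close> its inverse.\<close>

type_synonym letter = "nat \<times> bool"
type_synonym word = "letter list"

definition flip :: "letter \<Rightarrow> letter" where
  "flip x = (fst x, \<not> snd x)"

definition reduced :: "word \<Rightarrow> bool" where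
  "reduced w \<longleftrightarrow> successively (\<lambda>x y. y \<noteq> flip x) w"

text \<open>Multiplication of a reduced word by a letter from the left.\<close>

fun push :: "letter \<Rightarrow> word \<Rightarrow> word" where
  "push x [] = [x]"
| "push x (y # w) = (if y = flip x then w else x # y # w)"

definition words_over :: "nat \<Rightarrow> word set" where
  "words_over n = {w. fst ` set w \<subseteq> {..<n}}"

text \<open>The free group of rank \<open>n\<close>; \<open>foldr push u v\<close> is the reduced form of \<open>u @ v\<close>.\<close>

definition free_group :: "nat \<Rightarrow> word monoid" where
  "free_group n =
     \<lparr>carrier = {w \<in> words_over n. reduced w}, monoid.mult = foldr push, one = []\<rparr>"

fun word_eval :: "('a, 'b) monoid_scheme \<Rightarrow> (nat \<Rightarrow> 'a) \<Rightarrow> word \<Rightarrow> 'a" where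
  "word_eval G a [] = \<one>\<^bsub>G\<^esub>"
| "word_eval G a ((i, b) # w) = (if b then inv\<^bsub>G\<^esub> (a i) else a i) \<otimes>\<^bsub>G\<^esub> word_eval G a w"

definition word_code :: "word \<Rightarrow> nat" where
  "word_code w = list_encode (map (\<lambda>(i, b). 2 * i + of_bool b) w)"

lemma flip_flip [simp]: "flip (flip x) = x"
  by (simp add: flip_def)

lemma reduced_Cons: "reduced (x # w) \<longleftrightarrow> reduced w \<and> (w = [] \<or> hd w \<noteq> flip x)"
  by (cases w) (auto simp: reduced_def)

lemma reduced_push: "reduced w \<Longrightarrow> reduced (push x w)"
  by (cases w) (auto simp: reduced_Cons)

lemma push_flip_push: "reduced w \<Longrightarrow> push (flip x) (push x w) = w"
  by (cases w rule: list.exhaust; cases "tl w") (auto simp: reduced_Cons)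

lemma push_push_flip: "reduced w \<Longrightarrow> push x (push (flip x) w) = w"
  using push_flip_push[of w "flip x"] by simp

lemma reduced_foldr: "reduced w \<Longrightarrow> reduced (foldr push u w)"
  by (induction u) (auto intro: reduced_push)

lemma foldr_push_push: "reduced u \<Longrightarrow> reduced w \<Longrightarrow>
    foldr push (push x u) w = push x (foldr push u w)"
  by (cases u) (auto simp: reduced_Cons push_push_flip reduced_foldr)

lemma foldr_push_assoc: "reduced v \<Longrightarrow> reduced w \<Longrightarrow>
    foldr push (foldr push u v) w = foldr push u (foldr push v w)"
  by (induction u) (auto simp: foldr_push_push reduced_foldr)

lemma foldr_push_Nil: "reduced u \<Longrightarrow> foldr push u [] = u"
proof (induction u)
  case (Cons x u)
  then show ?case by (cases u) (auto simp: reduced_Cons)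
qed simp

lemma push_words_over: "fst x < n \<Longrightarrow> w \<in> words_over n \<Longrightarrow> push x w \<in> words_over n"
  by (cases w) (auto simp: words_over_def)

lemma foldr_words_over: "u \<in> words_over n \<Longrightarrow> w \<in> words_over n \<Longrightarrow> foldr push u w \<in> words_over n"
proof (induction u)
  case (Cons x u)
  then have "fst x < n" "u \<in> words_over n"
    by (auto simp: words_over_def)
  with Cons show ?case by (simp add: push_words_over)
qed simp

lemma foldr_push_inverse: "reduced w \<Longrightarrow> foldr push (rev (map flip u)) (foldr push u w) = w"
  by (induction u arbitrary: w) (auto simp: push_flip_push reduced_foldr)

lemma group_free_group: "group (free_group n)"
proof (rule groupI)
  fix u assume u: "u \<in> carrier (free_group n)"
  define v where "v = foldr push (rev (map flip u)) []"
  have "rev (map flip u) \<in> words_over n"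
    using u by (auto simp: free_group_def words_over_def flip_def)
  then have "v \<in> carrier (free_group n)"
    using foldr_words_over[of _ n "[]"] reduced_foldr[of "[]"]
    by (simp add: v_def free_group_def words_over_def reduced_def)
  moreover have "foldr push v u = []"
    using u foldr_push_inverse[of "[]" u] foldr_push_assoc[of "[]" u "rev (map flip u)"]
    by (auto simp: v_def free_group_def foldr_push_Nil reduced_def)
  ultimately show "\<exists>v\<in>carrier (free_group n). v \<otimes>\<^bsub>free_group n\<^esub> u = \<one>\<^bsub>free_group n\<^esub>"
    by (auto simp: free_group_def)
qed (auto simp: free_group_def foldr_words_over reduced_foldr foldr_push_assoc,
     auto simp: words_over_def reduced_def)


section \<open>Finite generation, finite presentation, word problem\<close>

definition fin_gen :: "('a, 'b) monoid_scheme \<Rightarrow> bool" where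
  "fin_gen G \<longleftrightarrow> (\<exists>S. finite S \<and> S \<subseteq> carrier G \<and> generate G S = carrier G)"

definition normal_closure :: "('a, 'b) monoid_scheme \<Rightarrow> 'a set \<Rightarrow> 'a set" where
  "normal_closure G R = \<Inter>{N. N \<lhd> G \<and> R \<subseteq> N}"

definition finitely_presented :: "('a, 'b) monoid_scheme \<Rightarrow> bool" where
  "finitely_presented G \<longleftrightarrow> group G \<and>
     (\<exists>n R. finite R \<and> R \<subseteq> carrier (free_group n) \<and>
        G \<cong> free_group n Mod normal_closure (free_group n) R)"

text \<open>
  Whether the word problem is solvable does not depend on the choice of the finite generating
  tuple.  The predicate entails finite generation.
\<close>

definition solvable_word_problem :: "('a, 'b) monoid_scheme \<Rightarrow> bool" where
  "solvable_word_problem G \<longleftrightarrow>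
     (\<exists>gs. set gs \<subseteq> carrier G \<and> generate G (set gs) = carrier G \<and>
        recursive_set
          (word_code ` {w \<in> words_over (length gs). word_eval G (\<lambda>i. gs ! i) w = \<one>\<^bsub>G\<^esub>}))"

text \<open>
  The locale \<open>simple_group\<close> of HOL-Algebra demands \<open>order G > 1\<close>, which excludes all infinite
  groups because \<open>card\<close> of an infinite set is \<open>0\<close>.
\<close>

definition is_simple :: "('a, 'b) monoid_scheme \<Rightarrow> bool" where
  "is_simple G \<longleftrightarrow> group G \<and> carrier G \<noteq> {\<one>\<^bsub>G\<^esub>} \<and>
     (\<forall>N. N \<lhd> G \<longrightarrow> N = carrier G \<or> N = {\<one>\<^bsub>G\<^esub>})"


section \<open>Properties of groups\<close>

definition amenable :: "('a, 'b) monoid_scheme \<Rightarrow> bool" where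
  "amenable G \<longleftrightarrow> (\<exists>\<mu> :: 'a set \<Rightarrow> real.
     \<mu> (carrier G) = 1 \<and>
     (\<forall>A. A \<subseteq> carrier G \<longrightarrow> 0 \<le> \<mu> A) \<and>
     (\<forall>A B. A \<subseteq> carrier G \<longrightarrow> B \<subseteq> carrier G \<longrightarrow> A \<inter> B = {} \<longrightarrow> \<mu> (A \<union> B) = \<mu> A + \<mu> B) \<and>
     (\<forall>g\<in>carrier G. \<forall>A. A \<subseteq> carrier G \<longrightarrow> \<mu> (g <#\<^bsub>G\<^esub> A) = \<mu> A))"

definition no_free_subgroup :: "('a, 'b) monoid_scheme \<Rightarrow> bool" where
  "no_free_subgroup G \<longleftrightarrow> \<not> (\<exists>H. subgroup H G \<and> G\<lparr>carrier := H\<rparr> \<cong> free_group 2)"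

definition left_invariant :: "('a, 'b) monoid_scheme \<Rightarrow> 'a rel \<Rightarrow> bool" where
  "left_invariant G r \<longleftrightarrow>
     (\<forall>a\<in>carrier G. \<forall>b\<in>carrier G. \<forall>c\<in>carrier G. (a, b) \<in> r \<longrightarrow> (c \<otimes>\<^bsub>G\<^esub> a, c \<otimes>\<^bsub>G\<^esub> b) \<in> r)"

definition right_invariant :: "('a, 'b) monoid_scheme \<Rightarrow> 'a rel \<Rightarrow> bool" where
  "right_invariant G r \<longleftrightarrow>
     (\<forall>a\<in>carrier G. \<forall>b\<in>carrier G. \<forall>c\<in>carrier G. (a, b) \<in> r \<longrightarrow> (a \<otimes>\<^bsub>G\<^esub> c, b \<otimes>\<^bsub>G\<^esub> c) \<in> r)"

definition left_orderable :: "('a, 'b) monoid_scheme \<Rightarrow> bool" where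
  "left_orderable G \<longleftrightarrow> (\<exists>r. linear_order_on (carrier G) r \<and> left_invariant G r)"

definition biorderable :: "('a, 'b) monoid_scheme \<Rightarrow> bool" where
  "biorderable G \<longleftrightarrow>
     (\<exists>r. linear_order_on (carrier G) r \<and> left_invariant G r \<and> right_invariant G r)"

definition locally_indicable :: "('a, 'b) monoid_scheme \<Rightarrow> bool" where
  "locally_indicable G \<longleftrightarrow>
     (\<forall>H. subgroup H G \<longrightarrow> H \<noteq> {\<one>\<^bsub>G\<^esub>} \<longrightarrow> fin_gen (G\<lparr>carrier := H\<rparr>) \<longrightarrow>
        (\<exists>N. N \<lhd> G\<lparr>carrier := H\<rparr> \<and> G\<lparr>carrier := H\<rparr> Mod N \<cong> integer_group))"

definition unique_product :: "('a, 'b) monoid_scheme \<Rightarrow> bool" where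
  "unique_product G \<longleftrightarrow>
     (\<forall>X Y. finite X \<longrightarrow> finite Y \<longrightarrow> X \<noteq> {} \<longrightarrow> Y \<noteq> {} \<longrightarrow> X \<subseteq> carrier G \<longrightarrow> Y \<subseteq> carrier G \<longrightarrow>
        (\<exists>g. \<exists>!p. p \<in> X \<times> Y \<and> fst p \<otimes>\<^bsub>G\<^esub> snd p = g))"

definition torsion_free :: "('a, 'b) monoid_scheme \<Rightarrow> bool" where
  "torsion_free G \<longleftrightarrow>
     (\<forall>x\<in>carrier G. x \<noteq> \<one>\<^bsub>G\<^esub> \<longrightarrow> (\<forall>n::nat. n > 0 \<longrightarrow> x [^]\<^bsub>G\<^esub> n \<noteq> \<one>\<^bsub>G\<^esub>))"

definition hamming :: "nat \<Rightarrow> (nat \<Rightarrow> nat) \<Rightarrow> (nat \<Rightarrow> nat) \<Rightarrow> real" where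
  "hamming n p q = real (card {i. i < n \<and> p i \<noteq> q i}) / real n"

definition sofic :: "('a, 'b) monoid_scheme \<Rightarrow> bool" where
  "sofic G \<longleftrightarrow>
     (\<forall>F \<epsilon>. finite F \<longrightarrow> F \<subseteq> carrier G \<longrightarrow> \<epsilon> > 0 \<longrightarrow>
        (\<exists>n \<phi>. n > 0 \<and> (\<forall>g\<in>carrier G. \<phi> g permutes {..<n}) \<and>
           (\<forall>g\<in>F. \<forall>h\<in>F. hamming n (\<phi> (g \<otimes>\<^bsub>G\<^esub> h)) (\<phi> g \<circ> \<phi> h) < \<epsilon>) \<and>
           (\<forall>g\<in>F. \<forall>h\<in>F. g \<noteq> h \<longrightarrow> hamming n (\<phi> g) (\<phi> h) > 1 - \<epsilon>)))"

definition no_law :: "('a, 'b) monoid_scheme \<Rightarrow> bool" where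
  "no_law G \<longleftrightarrow>
     (\<forall>w. reduced w \<longrightarrow> w \<noteq> [] \<longrightarrow> (\<exists>a. range a \<subseteq> carrier G \<and> word_eval G a w \<noteq> \<one>\<^bsub>G\<^esub>))"

text \<open>
  Names for the properties under consideration.  A property has to be evaluated on groups over
  several types, which a variable of type \<open>'a monoid \<Rightarrow> bool\<close> would not permit.
\<close>

datatype group_property =
    Amenable | No_Free_Subgroup | Left_Orderable | Locally_Indicable | Biorderable
  | Unique_Product | Torsion_Free | Sofic | No_Law | Tautological

primrec satisfies :: "('a, 'b) monoid_scheme \<Rightarrow> group_property \<Rightarrow> bool" where
  "satisfies G Amenable = amenable G"
| "satisfies G No_Free_Subgroup = no_free_subgroup G"
| "satisfies G Left_Orderable = left_orderable G"
| "satisfies G Locally_Indicable = locally_indicable G"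
| "satisfies G Biorderable = biorderable G"
| "satisfies G Unique_Product = unique_product G"
| "satisfies G Torsion_Free = torsion_free G"
| "satisfies G Sofic = sofic G"
| "satisfies G No_Law = no_law G"
| "satisfies G Tautological = True"


section \<open>First-order sentences in the language of groups\<close>

datatype grp_term = TVar nat | TOne | TInv grp_term | TMul grp_term grp_term

datatype grp_form =
  FEq grp_term grp_term | FBot | FImp grp_form grp_form | FAll nat grp_form

primrec term_val :: "('a, 'b) monoid_scheme \<Rightarrow> (nat \<Rightarrow> 'a) \<Rightarrow> grp_term \<Rightarrow> 'a" where
  "term_val G s (TVar i) = s i"
| "term_val G s TOne = \<one>\<^bsub>G\<^esub>"
| "term_val G s (TInv t) = inv\<^bsub>G\<^esub> (term_val G s t)"
| "term_val G s (TMul t u) = term_val G s t \<otimes>\<^bsub>G\<^esub> term_val G s u"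

primrec form_holds :: "('a, 'b) monoid_scheme \<Rightarrow> (nat \<Rightarrow> 'a) \<Rightarrow> grp_form \<Rightarrow> bool" where
  "form_holds G s (FEq t u) \<longleftrightarrow> term_val G s t = term_val G s u"
| "form_holds G s FBot \<longleftrightarrow> False"
| "form_holds G s (FImp p q) \<longleftrightarrow> (form_holds G s p \<longrightarrow> form_holds G s q)"
| "form_holds G s (FAll i p) \<longleftrightarrow> (\<forall>x\<in>carrier G. form_holds G (s(i := x)) p)"

primrec term_vars :: "grp_term \<Rightarrow> nat set" where
  "term_vars (TVar i) = {i}"
| "term_vars TOne = {}"
| "term_vars (TInv t) = term_vars t"
| "term_vars (TMul t u) = term_vars t \<union> term_vars u"

primrec free_vars :: "grp_form \<Rightarrow> nat set" where
  "free_vars (FEq t u) = term_vars t \<union> term_vars u"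
| "free_vars FBot = {}"
| "free_vars (FImp p q) = free_vars p \<union> free_vars q"
| "free_vars (FAll i p) = free_vars p - {i}"

definition sentence :: "grp_form \<Rightarrow> bool" where
  "sentence p \<longleftrightarrow> free_vars p = {}"

definition is_model :: "('a, 'b) monoid_scheme \<Rightarrow> grp_form set \<Rightarrow> bool" where
  "is_model G T \<longleftrightarrow> (\<forall>p\<in>T. \<forall>s. range s \<subseteq> carrier G \<longrightarrow> form_holds G s p)"

primrec term_code :: "grp_term \<Rightarrow> nat" where
  "term_code (TVar i) = prod_encode (0, i)"
| "term_code TOne = prod_encode (1, 0)"
| "term_code (TInv t) = prod_encode (2, term_code t)"
| "term_code (TMul t u) = prod_encode (3, prod_encode (term_code t, term_code u))"

primrec form_code :: "grp_form \<Rightarrow> nat" where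
  "form_code (FEq t u) = prod_encode (0, prod_encode (term_code t, term_code u))"
| "form_code FBot = prod_encode (1, 0)"
| "form_code (FImp p q) = prod_encode (2, prod_encode (form_code p, form_code q))"
| "form_code (FAll i p) = prod_encode (3, prod_encode (i, form_code p))"


section \<open>Properties of properties\<close>

text \<open>
  Statements about arbitrary groups refer to the groups whose carrier is a subset of a type
  \<open>'u\<close>, which is left arbitrary.  Finitely generated groups are countable, hence isomorphic to
  groups whose carrier is a subset of \<open>nat\<close>; statements that only concern such groups use \<open>nat\<close>.
\<close>

definition recursively_axiomatizable :: "'u itself \<Rightarrow> group_property \<Rightarrow> bool" where
  "recursively_axiomatizable (U :: 'u itself) P \<longleftrightarrow>
     (\<exists>T. recursive_set (form_code ` T) \<and> (\<forall>p\<in>T. sentence p) \<and>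
        (\<forall>G :: 'u monoid. group G \<longrightarrow> (satisfies G P \<longleftrightarrow> is_model G T)))"

definition closed_under_subgroups :: "'u itself \<Rightarrow> group_property \<Rightarrow> bool" where
  "closed_under_subgroups (U :: 'u itself) P \<longleftrightarrow>
     (\<forall>(G :: 'u monoid) H. group G \<longrightarrow> satisfies G P \<longrightarrow> subgroup H G \<longrightarrow>
        satisfies (G\<lparr>carrier := H\<rparr>) P)"

definition boone_higman :: "group_property \<Rightarrow> bool" where
  "boone_higman P \<longleftrightarrow>
     (\<forall>G :: nat monoid. group G \<longrightarrow> fin_gen G \<longrightarrow> solvable_word_problem G \<longrightarrow> satisfies G P \<longrightarrow>
        (\<exists>(H :: nat monoid) S. finitely_presented H \<and> satisfies H P \<and>
           subgroup S H \<and> is_simple (H\<lparr>carrier := S\<rparr>) \<and> mon G (H\<lparr>carrier := S\<rparr>) \<noteq> {}))"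

definition strongly_undecidable :: "group_property \<Rightarrow> bool" where
  "strongly_undecidable P \<longleftrightarrow>
     (\<exists>(G :: nat monoid) X. finitely_presented G \<and> finite X \<and> X \<subseteq> carrier G \<and>
        (\<exists>H :: nat monoid. group H \<and> satisfies H P \<and> (\<exists>\<phi>\<in>epi G H. inj_on \<phi> X)) \<and>
        (\<forall>H :: nat monoid. group H \<longrightarrow> satisfies H P \<longrightarrow> (\<exists>\<phi>\<in>epi G H. inj_on \<phi> X) \<longrightarrow>
           \<not> solvable_word_problem H))"


section \<open>The space of enumerated groups\<close>

text \<open>
  The type class topology on this type is the product topology with \<open>nat\<close> discrete.  The
  underlying set is indexed from \<open>0\<close> instead of \<open>1\<close>.
\<close>

type_synonym enum_structure = "(nat \<times> nat \<Rightarrow> nat) \<times> (nat \<Rightarrow> nat) \<times> nat"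

definition group_of :: "enum_structure \<Rightarrow> nat monoid" where
  "group_of = (\<lambda>(m, i, e). \<lparr>carrier = UNIV, monoid.mult = (\<lambda>x y. m (x, y)), one = e\<rparr>)"

definition enumerated_groups :: "enum_structure set" where
  "enumerated_groups =
     {(m, i, e). group (group_of (m, i, e)) \<and> (\<forall>x. m (x, i x) = e \<and> m (i x, x) = e)}"

definition enum_space :: "group_property \<Rightarrow> enum_structure topology" where
  "enum_space P = subtopology euclidean {g \<in> enumerated_groups. satisfies (group_of g) P}"

definition comeager_in :: "'a topology \<Rightarrow> 'a set \<Rightarrow> bool" where
  "comeager_in X C \<longleftrightarrow> C \<subseteq> topspace X \<and>
     (\<exists>\<U>. countable \<U> \<and> (\<forall>U\<in>\<U>. openin X U \<and> X closure_of U = topspace X) \<and>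
        topspace X \<inter> \<Inter>\<U> \<subseteq> C)"

end

theory Submission
  imports Defs
begin

text \<open>
  Suppose that a comeager set \<open>C\<close> of the space of enumerated groups with the property \<open>P\<close> consists
  of isomorphic groups.  Strong undecidability provides finitely many words in \<open>n\<close> letters, some of
  which are to become trivial while others are to stay distinct, such that the relations among the
  members of a tuple with this behaviour are never decidable as soon as the subgroup that the tuple
  generates satisfies \<open>P\<close>; and some group with \<open>P\<close> contains such a tuple
  (\<open>strongly_undecidable_tuples\<close>).  To contain such a tuple at prescribed positions is an open
  condition, so \<open>C\<close> contains a group \<open>k\<close> with such a tuple.  Let \<open>N\<close> be the set of its relations.
  All members of \<open>C\<close> are isomorphic to \<open>k\<close>, hence each of them contains a tuple \<open>c\<close> whose set of
  relations is \<open>N\<close>.  For fixed \<open>c\<close> this is a closed condition, and there are only countably many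
  \<open>c\<close>; by the Baire category theorem (\<open>Baire_closed_cover\<close>) the condition for one of them has
  interior.  This means that a finite part of a multiplication table forces, in every
  enumerated group with \<open>P\<close>, the set of relations of \<open>c\<close> to be \<open>N\<close>.

  Now \<open>N\<close> is recursive (\<open>recursive_word_kernel_if_generic\<close>), a contradiction: a word lies in \<open>N\<close> if
  and only if this follows from the axioms of \<open>P\<close>, the finite table and the statement that the group
  is infinite, and a word lies outside \<open>N\<close> if and only if that follows from the same theory; both
  conditions are recursively enumerable.

  The enumerability of consequences replaces a proof calculus by propositional logic.  A theory is
  translated into a recursive list of clauses over numerically coded atoms, which describe a Henkin
  model: its elements are named by numbers, and there is a named counterexample for each universal
  statement that fails.  Truth assignments that satisfy the clauses correspond to countable groups
  that satisfy the theory (\<open>sat_clauses_iff_models\<close>).  By compactness of the Cantor space, a theory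
  without a model is refuted by finitely many clauses over finitely many atoms, and this can be
  checked by a bounded search (\<open>recursive_set_if_determined\<close>).

  The same correspondence yields the compactness theorem for countable groups
  (\<open>models_compactness\<close>), from which it follows that the groups with \<open>P\<close> form a closed, hence
  completely metrizable, subspace: the diagram of a limit \<open>g\<close> of such groups together with the
  axioms of \<open>P\<close> is finitely satisfiable, so \<open>g\<close> embeds into a group with \<open>P\<close>
  (\<open>closed_groups_with\<close>).

  The hypotheses on axioms and subgroups refer to an arbitrary infinite type.  They are first
  transferred to countable groups, which requires that all properties under consideration are
  invariant under isomorphism between groups over different types.
\<close>


section \<open>Computable functions\<close>

text \<open>
  The values of a function on lists of a wrong length are disregarded, since the rules for
  \<open>recursive_fn\<close> determine them in an arbitrary way.  After this closure under extensional
  equality it suffices to work with unary functions and pairing.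
\<close>
definition computable_fn :: "nat \<Rightarrow> (nat list \<Rightarrow> nat) \<Rightarrow> bool" where
  "computable_fn n f \<longleftrightarrow> (\<exists>F. recursive_fn n F \<and> (\<forall>xs. length xs = n \<longrightarrow> F xs = f xs))"

definition computable :: "(nat \<Rightarrow> nat) \<Rightarrow> bool" where
  "computable f \<longleftrightarrow> computable_fn 1 (\<lambda>xs. f (xs ! 0))"

definition computable2 :: "(nat \<Rightarrow> nat \<Rightarrow> nat) \<Rightarrow> bool" where
  "computable2 f \<longleftrightarrow> computable_fn 2 (\<lambda>xs. f (xs ! 0) (xs ! 1))"

definition decidable :: "(nat \<Rightarrow> bool) \<Rightarrow> bool" where
  "decidable P \<longleftrightarrow> computable (\<lambda>x. of_bool (P x))"

lemma recursive_set_if_decidable: "decidable (\<lambda>x. x \<in> A) \<Longrightarrow> recursive_set A"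
  unfolding decidable_def computable_def computable_fn_def recursive_set_def by fastforce

lemma decidable_if_recursive_set: "recursive_set A \<Longrightarrow> decidable (\<lambda>x. x \<in> A)"
  unfolding decidable_def computable_def computable_fn_def recursive_set_def
  by (force simp: length_Suc_conv)

lemma computable_fn_proj: "i < n \<Longrightarrow> computable_fn n (\<lambda>xs. xs ! i)"
  unfolding computable_fn_def by (blast intro: rec_proj)

lemma computable_fn_comp1:
  assumes "computable f" "computable_fn n a"
  shows "computable_fn n (\<lambda>xs. f (a xs))"
proof -
  obtain F A where F: "recursive_fn 1 F" "\<And>xs. length xs = 1 \<Longrightarrow> F xs = f (xs ! 0)"
    and A: "recursive_fn n A" "\<And>xs. length xs = n \<Longrightarrow> A xs = a xs"
    using assms unfolding computable_def computable_fn_def by metis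
  have "recursive_fn n (\<lambda>xs. F (map (\<lambda>f. f xs) [A]))"
    using F A by (intro rec_comp) auto
  then show ?thesis
    unfolding computable_fn_def using F A by (intro exI[of _ "\<lambda>xs. F (map (\<lambda>f. f xs) [A])"]) auto
qed

lemma computable_fn_comp2:
  assumes "computable2 f" "computable_fn n a" "computable_fn n b"
  shows "computable_fn n (\<lambda>xs. f (a xs) (b xs))"
proof -
  obtain F A B where F: "recursive_fn 2 F" "\<And>xs. length xs = 2 \<Longrightarrow> F xs = f (xs ! 0) (xs ! 1)"
    and A: "recursive_fn n A" "\<And>xs. length xs = n \<Longrightarrow> A xs = a xs"
    and B: "recursive_fn n B" "\<And>xs. length xs = n \<Longrightarrow> B xs = b xs"
    using assms unfolding computable2_def computable_fn_def by metis
  have "recursive_fn n (\<lambda>xs. F (map (\<lambda>f. f xs) [A, B]))"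
    using F A B by (intro rec_comp) (auto simp: numeral_2_eq_2)
  then show ?thesis
    unfolding computable_fn_def using F A B
    by (intro exI[of _ "\<lambda>xs. F (map (\<lambda>f. f xs) [A, B])"]) auto
qed

lemma computable_comp: "computable f \<Longrightarrow> computable g \<Longrightarrow> computable (\<lambda>x. f (g x))"
  using computable_fn_comp1[of f 1 "\<lambda>xs. g (xs ! 0)"] by (simp add: computable_def)

lemma computable_comp2:
  "computable2 f \<Longrightarrow> computable a \<Longrightarrow> computable b \<Longrightarrow> computable (\<lambda>x. f (a x) (b x))"
  using computable_fn_comp2[of f 1 "\<lambda>xs. a (xs ! 0)" "\<lambda>xs. b (xs ! 0)"] by (simp add: computable_def)

lemma computable_id: "computable (\<lambda>x. x)"
  unfolding computable_def by (rule computable_fn_proj) simp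

lemma computable_Suc: "computable Suc"
  unfolding computable_def computable_fn_def by (blast intro: rec_suc)

lemma computable_const: "computable (\<lambda>_. c)"
proof (induction c)
  case 0
  show ?case unfolding computable_def computable_fn_def by (blast intro: rec_zero)
next
  case (Suc c)
  then show ?case using computable_comp[OF computable_Suc] by simp
qed

lemma computable_fn_const: "0 < n \<Longrightarrow> computable_fn n (\<lambda>_. c)"
  using computable_fn_comp1[OF computable_const computable_fn_proj] by blast

lemma computable2_rec_nat:
  assumes "computable f" "computable_fn 3 (\<lambda>xs. g (xs ! 0) (xs ! 1) (xs ! 2))"
  shows "computable2 (\<lambda>n x. rec_nat (f x) (\<lambda>k r. g k r x) n)"
proof -
  obtain F G where F: "recursive_fn 1 F" "\<And>xs. length xs = 1 \<Longrightarrow> F xs = f (xs ! 0)"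
    and G: "recursive_fn 3 G" "\<And>xs. length xs = 3 \<Longrightarrow> G xs = g (xs ! 0) (xs ! 1) (xs ! 2)"
    using assms unfolding computable_def computable_fn_def by metis
  have "recursive_fn (1 + 1) (\<lambda>xs. rec_nat (F (tl xs)) (\<lambda>k r. G (k # r # tl xs)) (hd xs))"
    using F G by (intro rec_prim) (auto simp: numeral_3_eq_3)
  then have "recursive_fn 2 (\<lambda>xs. rec_nat (F (tl xs)) (\<lambda>k r. G (k # r # tl xs)) (hd xs))"
    by (simp add: numeral_2_eq_2)
  moreover have "rec_nat (F (tl xs)) (\<lambda>k r. G (k # r # tl xs)) (hd xs) =
    rec_nat (f (xs ! 1)) (\<lambda>k r. g k r (xs ! 1)) (xs ! 0)" if "length xs = 2" for xs
    using that F G by (cases xs) (auto simp: length_Suc_conv numeral_2_eq_2)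
  ultimately show ?thesis
    unfolding computable2_def computable_fn_def by blast
qed

lemma computable_Least_zero:
  assumes "computable2 p" "\<And>x. \<exists>k. p k x = 0"
  shows "computable (\<lambda>x. LEAST k. p k x = 0)"
proof -
  obtain F where F: "recursive_fn 2 F" "\<And>xs. length xs = 2 \<Longrightarrow> F xs = p (xs ! 0) (xs ! 1)"
    using assms unfolding computable2_def computable_fn_def by metis
  have "recursive_fn 1 (\<lambda>xs. LEAST k. F (k # xs) = 0)"
    using F assms(2) by (intro rec_min) (auto simp: numeral_2_eq_2)
  moreover have "(LEAST k. F (k # xs) = 0) = (LEAST k. p k (xs ! 0) = 0)" if "length xs = 1" for xs
    using that F by simp
  ultimately show ?thesis
    unfolding computable_def computable_fn_def by blast
qed

lemma computable2_swap: "computable2 f \<Longrightarrow> computable2 (\<lambda>x y. f y x)"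
  using computable_fn_comp2[of f 2 "\<lambda>xs. xs ! 1" "\<lambda>xs. xs ! 0"]
  by (simp add: computable2_def computable_fn_proj)

lemma computable2_add: "computable2 (+)"
proof -
  have "computable2 (\<lambda>n x. rec_nat x (\<lambda>k r. Suc r) n)"
    by (intro computable2_rec_nat computable_id computable_fn_comp1[OF computable_Suc]
        computable_fn_proj) simp
  moreover have "rec_nat x (\<lambda>k r. Suc r) n = n + x" for n x :: nat
    by (induction n) auto
  ultimately show ?thesis by simp
qed

lemma computable2_mult: "computable2 (*)"
proof -
  have "computable2 (\<lambda>n x. rec_nat 0 (\<lambda>k r. r + x) n)"
    by (intro computable2_rec_nat computable_const computable_fn_comp2[OF computable2_add]
        computable_fn_proj) simp_all
  moreover have "rec_nat 0 (\<lambda>k r. r + x) n = n * x" for n x :: nat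
    by (induction n) auto
  ultimately show ?thesis by simp
qed

lemma computable2_diff: "computable2 (-)"
proof -
  have "computable2 (\<lambda>n x. rec_nat 0 (\<lambda>k r. k) n)"
    by (intro computable2_rec_nat computable_const computable_fn_proj) simp
  moreover have "rec_nat 0 (\<lambda>k r. k) n = n - 1" for n :: nat
    by (cases n) auto
  ultimately have "computable2 (\<lambda>n x. n - 1)" by simp
  then have "computable (\<lambda>n. n - 1)"
    using computable_comp2[OF _ computable_id computable_id] by blast
  then have "computable2 (\<lambda>n x. rec_nat x (\<lambda>k r. r - 1) n)"
    by (intro computable2_rec_nat computable_id computable_fn_comp1[of "\<lambda>n. n - 1"]
        computable_fn_proj) simp_all
  moreover have "rec_nat x (\<lambda>k r. r - 1) n = x - n" for n x :: nat
    by (induction n) auto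
  ultimately have "computable2 (\<lambda>n x. x - n)" by simp
  then show ?thesis using computable2_swap by blast
qed

lemma computable_power2: "computable (\<lambda>n. 2 ^ n)"
proof -
  have "computable2 (\<lambda>n x. rec_nat 1 (\<lambda>k r. r + r) n)"
    by (intro computable2_rec_nat computable_const computable_fn_comp2[OF computable2_add]
        computable_fn_proj) simp_all
  moreover have "rec_nat 1 (\<lambda>k r. r + r) n = (2::nat) ^ n" for n :: nat
    by (induction n) auto
  ultimately have "computable2 (\<lambda>n x. 2 ^ n)" by simp
  then show ?thesis
    using computable_comp2[OF _ computable_id computable_id] by blast
qed

lemma computable_triangle: "computable triangle"
proof -
  have "computable2 (\<lambda>n x. rec_nat 0 (\<lambda>k r. r + Suc k) n)"
    by (intro computable2_rec_nat computable_const computable_fn_comp2[OF computable2_add]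
        computable_fn_comp1[OF computable_Suc] computable_fn_proj) simp_all
  moreover have "rec_nat 0 (\<lambda>k r. r + Suc k) n = triangle n" for n :: nat
    by (induction n) auto
  ultimately have "computable2 (\<lambda>n x. triangle n)" by simp
  then show ?thesis
    using computable_comp2[OF _ computable_id computable_id] by blast
qed

lemmas computable_add = computable_comp2[OF computable2_add]
lemmas computable_mult = computable_comp2[OF computable2_mult]
lemmas computable_diff = computable_comp2[OF computable2_diff]

lemma computable_pair:
  "computable f \<Longrightarrow> computable g \<Longrightarrow> computable (\<lambda>x. prod_encode (f x, g x))"
  by (simp add: prod_encode_def computable_add computable_comp[OF computable_triangle])

lemma decidable_less: "computable f \<Longrightarrow> computable g \<Longrightarrow> decidable (\<lambda>x. f x < g x)"
proof -
  assume "computable f" "computable g"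
  then have "computable (\<lambda>x. 1 - (Suc (f x) - g x))"
    by (intro computable_diff computable_const computable_comp[OF computable_Suc])
  moreover have "1 - (Suc (f x) - g x) = of_bool (f x < g x)" for x by auto
  ultimately show ?thesis by (simp add: decidable_def)
qed

lemma decidable_not: "decidable P \<Longrightarrow> decidable (\<lambda>x. \<not> P x)"
proof -
  assume "decidable P"
  then have "computable (\<lambda>x. 1 - of_bool (P x))"
    unfolding decidable_def by (intro computable_diff computable_const)
  moreover have "1 - of_bool (P x) = (of_bool (\<not> P x) :: nat)" for x by simp
  ultimately show ?thesis by (simp only: decidable_def)
qed

lemma decidable_conj: "decidable P \<Longrightarrow> decidable Q \<Longrightarrow> decidable (\<lambda>x. P x \<and> Q x)"
  using computable_mult[of "\<lambda>x. of_bool (P x)" "\<lambda>x. of_bool (Q x)"]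
  by (simp add: decidable_def of_bool_conj)

lemma decidable_disj: "decidable P \<Longrightarrow> decidable Q \<Longrightarrow> decidable (\<lambda>x. P x \<or> Q x)"
  using decidable_not[OF decidable_conj[OF decidable_not decidable_not]] by simp

lemma decidable_iff: "decidable P \<Longrightarrow> decidable Q \<Longrightarrow> decidable (\<lambda>x. P x \<longleftrightarrow> Q x)"
proof -
  assume "decidable P" "decidable Q"
  then have "decidable (\<lambda>x. (P x \<and> Q x) \<or> (\<not> P x \<and> \<not> Q x))"
    by (intro decidable_disj decidable_conj decidable_not)
  moreover have "(P x \<and> Q x) \<or> (\<not> P x \<and> \<not> Q x) \<longleftrightarrow> (P x \<longleftrightarrow> Q x)" for x by blast
  ultimately show ?thesis by (simp only:)
qed

lemma decidable_const: "decidable (\<lambda>_. b)"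
  unfolding decidable_def by (rule computable_const)

lemma decidable_le: "computable f \<Longrightarrow> computable g \<Longrightarrow> decidable (\<lambda>x. f x \<le> g x)"
  using decidable_not[OF decidable_less, of g f] by (simp add: linorder_not_less)

lemma decidable_eq: "computable f \<Longrightarrow> computable g \<Longrightarrow> decidable (\<lambda>x. f x = g x)"
  using decidable_conj[OF decidable_le decidable_le, of f g g f] by (simp add: order_eq_iff)

lemma computable_if:
  assumes "decidable P" "computable f" "computable g"
  shows "computable (\<lambda>x. if P x then f x else g x)"
proof -
  have "computable (\<lambda>x. of_bool (P x) * f x + (1 - of_bool (P x)) * g x)"
    using assms unfolding decidable_def
    by (intro computable_add computable_mult computable_diff computable_const)
  moreover have "of_bool (P x) * f x + (1 - of_bool (P x)) * g x = (if P x then f x else g x)" for x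
    by simp
  ultimately show ?thesis by simp
qed

lemma computable_Least2:
  assumes "computable2 (\<lambda>k x. of_bool (P k x))" "\<And>x. \<exists>k. P k x"
  shows "computable (\<lambda>x. LEAST k. P k x)"
proof -
  have "computable2 (\<lambda>k x. 1 - of_bool (P k x))"
    using computable_fn_comp2[OF computable2_diff computable_fn_const[where c = 1]
        assms(1)[unfolded computable2_def]]
    unfolding computable2_def by simp
  then have "computable (\<lambda>x. LEAST k. 1 - of_bool (P k x) = (0::nat))"
    using assms(2) by (intro computable_Least_zero) auto
  moreover have "1 - of_bool (P k x) = (0::nat) \<longleftrightarrow> P k x" for k x by simp
  ultimately show ?thesis by (simp only:)
qed

lemma prod_encode_less_triangle: "prod_encode (m, n) < triangle (Suc k) \<longleftrightarrow> m + n \<le> k"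
proof
  assume "m + n \<le> k"
  moreover have "mono triangle"
    by (rule mono_iff_le_Suc[THEN iffD2]) simp
  ultimately have "triangle (m + n) \<le> triangle k" by (simp add: monoD)
  then show "prod_encode (m, n) < triangle (Suc k)"
    using \<open>m + n \<le> k\<close> by (simp add: prod_encode_def)
next
  assume l: "prod_encode (m, n) < triangle (Suc k)"
  have "mono triangle"
    by (rule mono_iff_le_Suc[THEN iffD2]) simp
  then have "triangle (Suc k) \<le> triangle (m + n)" if "k < m + n"
    using that by (metis Suc_leI monoD)
  with l show "m + n \<le> k" by (force simp: prod_encode_def not_le)
qed

text \<open>
  The pairing function enumerates the diagonals one after the other, and the diagonal on which a
  number lies is found by minimization.  Both components can be read off from it.
\<close>
lemma computable_prod_decode_sum: "computable (\<lambda>z. fst (prod_decode z) + snd (prod_decode z))"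
proof -
  have "computable2 (\<lambda>k z. of_bool (z < triangle (Suc k)))"
  proof -
    have "computable2 (\<lambda>k z. 1 - (Suc z - triangle (Suc k)))"
      unfolding computable2_def
      by (intro computable_fn_comp2[OF computable2_diff] computable_fn_proj
          computable_fn_const
          computable_fn_comp1[OF computable_triangle] computable_fn_comp1[OF computable_Suc]) simp_all
    moreover have "1 - (Suc z - triangle (Suc k)) = of_bool (z < triangle (Suc k))" for k z by auto
    ultimately show ?thesis by simp
  qed
  moreover have "\<exists>k. z < triangle (Suc k)" for z
    using prod_encode_less_triangle[of "fst (prod_decode z)" "snd (prod_decode z)"] by auto
  ultimately have "computable (\<lambda>z. LEAST k. z < triangle (Suc k))"
    by (rule computable_Least2)
  moreover have "(LEAST k. z < triangle (Suc k)) = fst (prod_decode z) + snd (prod_decode z)" for z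
    using prod_encode_less_triangle[of "fst (prod_decode z)" "snd (prod_decode z)"]
    by (auto intro!: Least_equality)
  ultimately show ?thesis by simp
qed

lemma computable_prod_decode:
  assumes "computable f"
  shows "computable (\<lambda>x. fst (prod_decode (f x)))" "computable (\<lambda>x. snd (prod_decode (f x)))"
proof -
  let ?s = "\<lambda>z. fst (prod_decode z) + snd (prod_decode z)"
  have z: "z = triangle (?s z) + fst (prod_decode z)" for z
    using prod_decode_inverse[of z]
    by (simp del: prod_decode_inverse add: prod_encode_def case_prod_unfold)
  have 1: "computable (\<lambda>z. z - triangle (?s z))"
    by (intro computable_diff computable_id computable_comp[OF computable_triangle]
        computable_prod_decode_sum)
  moreover have e: "z - triangle (?s z) = fst (prod_decode z)" for z
    using z[of z] by (metis add_diff_cancel_left')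
  ultimately have 2: "computable (\<lambda>z. fst (prod_decode z))" by simp
  then have "computable (\<lambda>z. ?s z - fst (prod_decode z))"
    by (intro computable_diff computable_prod_decode_sum)
  then have 3: "computable (\<lambda>z. snd (prod_decode z))" by simp
  show "computable (\<lambda>x. fst (prod_decode (f x)))" "computable (\<lambda>x. snd (prod_decode (f x)))"
    by (rule computable_comp[OF 2 assms] computable_comp[OF 3 assms])+
qed

lemma computable_Least:
  assumes "decidable (\<lambda>z. P (fst (prod_decode z)) (snd (prod_decode z)))" "\<And>x. \<exists>k. P k x"
  shows "computable (\<lambda>x. LEAST k. P k x)"
proof (rule computable_Least2)
  have 2: "computable2 (\<lambda>k x. prod_encode (k, x))"
    unfolding computable2_def prod_encode_def split_conv
    by (intro computable_fn_comp2[OF computable2_add] computable_fn_comp1[OF computable_triangle]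
        computable_fn_proj) simp_all
  show "computable2 (\<lambda>k x. of_bool (P k x))"
    using computable_fn_comp1[OF assms(1)[unfolded decidable_def] 2[unfolded computable2_def]]
    by (simp add: computable2_def)
qed (rule assms(2))

lemma decidable_subst:
  "decidable P \<Longrightarrow> computable f \<Longrightarrow> decidable (\<lambda>x. P (f x))"
  using computable_comp by (auto simp: decidable_def)

text \<open>
  The search for a witness may also stop at the bound, and is therefore regular.
\<close>
lemma decidable_bex:
  assumes "decidable (\<lambda>z. P (fst (prod_decode z)) (snd (prod_decode z)))" "computable b"
  shows "decidable (\<lambda>x. \<exists>k<b x. P k x)"
proof -
  let ?L = "\<lambda>x. LEAST k. P k x \<or> k = b x"
  have "computable ?L"
    by (intro computable_Least decidable_disj assms(1) decidable_eq computable_prod_decode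
        computable_comp[OF assms(2)] computable_id) auto
  moreover have "(\<exists>k<b x. P k x) \<longleftrightarrow> ?L x < b x" for x
  proof
    assume "\<exists>k<b x. P k x"
    then show "?L x < b x" by (metis (mono_tags, lifting) Least_le order_le_less_trans)
  next
    assume l: "?L x < b x"
    have "P (?L x) x \<or> ?L x = b x" by (rule LeastI[of _ "b x"]) simp
    with l show "\<exists>k<b x. P k x" by auto
  qed
  ultimately show ?thesis using decidable_less[OF _ assms(2)] by simp
qed

lemma decidable_ball:
  assumes "decidable (\<lambda>z. P (fst (prod_decode z)) (snd (prod_decode z)))" "computable b"
  shows "decidable (\<lambda>x. \<forall>k<b x. P k x)"
  using decidable_not[OF decidable_bex[OF decidable_not[OF assms(1)] assms(2)]] by simp

lemma computable_div:
  assumes "computable f" "computable g"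
  shows "computable (\<lambda>x. f x div g x)"
proof -
  have "computable (\<lambda>x. LEAST q. g x = 0 \<or> f x < Suc q * g x)"
    by (intro computable_Least decidable_disj decidable_eq decidable_less computable_const
        computable_mult computable_comp[OF computable_Suc] computable_prod_decode
        computable_comp[OF assms(1)] computable_comp[OF assms(2)] computable_id)
      (metis dividend_less_times_div mult.commute mult_Suc neq0_conv)
  moreover have "(LEAST q. g x = 0 \<or> f x < Suc q * g x) = f x div g x" for x
  proof (cases "g x = 0")
    case False
    have "f x < Suc q * g x \<longleftrightarrow> f x div g x \<le> q" for q
      using False by (metis div_less_iff_less_mult less_Suc_eq_le neq0_conv)
    then show ?thesis using False by (auto intro!: Least_equality)
  qed (auto intro: Least_equality)
  ultimately show ?thesis by simp
qed

lemma decidable_odd: "computable f \<Longrightarrow> decidable (\<lambda>x. odd (f x))"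
proof -
  assume "computable f"
  then have "decidable (\<lambda>x. f x - 2 * (f x div 2) = 1)"
    by (intro decidable_eq computable_diff computable_mult computable_div computable_const)
  moreover have "f x - 2 * (f x div 2) = 1 \<longleftrightarrow> odd (f x)" for x by presburger
  ultimately show ?thesis by simp
qed

lemmas computable_intros =
  computable_id computable_const computable_add computable_mult computable_diff computable_div
  computable_comp[OF computable_Suc] computable_comp[OF computable_power2]
  computable_pair computable_prod_decode computable_if
  decidable_less decidable_le decidable_eq decidable_odd decidable_not decidable_conj decidable_disj
  decidable_iff decidable_const

text \<open>
  Post's theorem: a simultaneous search for a witness of membership and for one of non-membership
  terminates, and tells which of the two holds.
\<close>
lemma recursive_set_if_both_enumerable:
  assumes P: "decidable (\<lambda>z. P (fst (prod_decode z)) (snd (prod_decode z)))"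
    and Q: "decidable (\<lambda>z. Q (fst (prod_decode z)) (snd (prod_decode z)))"
    and A: "\<And>x. x \<in> A \<longleftrightarrow> (\<exists>k. P k x)" "\<And>x. x \<notin> A \<longleftrightarrow> (\<exists>k. Q k x)"
  shows "recursive_set A"
proof -
  let ?L = "\<lambda>x. LEAST k. P k x \<or> Q k x"
  have ex: "\<exists>k. P k x \<or> Q k x" for x using A by blast
  have "computable ?L"
    using P Q ex by (intro computable_Least decidable_disj)
  then have "decidable (\<lambda>x. P (?L x) x)"
    using decidable_subst[OF P, of "\<lambda>x. prod_encode (?L x, x)"] by (simp add: computable_intros)
  moreover have "x \<in> A \<longleftrightarrow> P (?L x) x" for x
    using LeastI_ex[OF ex] A by blast
  ultimately show ?thesis
    by (simp add: recursive_set_if_decidable)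
qed

lemma computable_finite_table: "computable (\<lambda>x. if x < length xs then xs ! x else c)"
proof (induction xs rule: rev_induct)
  case Nil
  then show ?case by (simp add: computable_const)
next
  case (snoc y xs)
  have "computable (\<lambda>x. if x = length xs then y else if x < length xs then xs ! x else c)"
    by (rule computable_if[OF decidable_eq[OF computable_id computable_const] computable_const snoc])
  moreover have "(if x = length xs then y else if x < length xs then xs ! x else c)
     = (if x < length (xs @ [y]) then (xs @ [y]) ! x else c)" for x
    by (auto simp: nth_append)
  ultimately show ?case by (simp only:)
qed


section \<open>Evaluation of words\<close>

lemma words_over_simps [simp]:
  "[] \<in> words_over n" "x # w \<in> words_over n \<longleftrightarrow> fst x < n \<and> w \<in> words_over n"
  by (auto simp: words_over_def)

lemma word_eval_closed:
  assumes "group G" "\<And>i. i < n \<Longrightarrow> a i \<in> carrier G" "w \<in> words_over n"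
  shows "word_eval G a w \<in> carrier G"
proof -
  interpret group G by fact
  show ?thesis using assms(3) by (induction w) (use assms(2) in auto)
qed

section \<open>Clauses\<close>

text \<open>
  A literal is coded by an atom and its sign as parity.  Clauses of three literals suffice below;
  shorter ones repeat a literal.
\<close>
definition Pos :: "nat \<Rightarrow> nat" where "Pos x = 2 * x + 1"
definition Neg :: "nat \<Rightarrow> nat" where "Neg x = 2 * x"

definition lit_true :: "(nat \<Rightarrow> bool) \<Rightarrow> nat \<Rightarrow> bool" where
  "lit_true \<alpha> l \<longleftrightarrow> (\<alpha> (l div 2) \<longleftrightarrow> odd l)"

definition clause :: "nat \<Rightarrow> nat \<Rightarrow> nat \<Rightarrow> nat" where
  "clause k l m = prod_encode (k, prod_encode (l, m))"

definition clause_lits :: "nat \<Rightarrow> nat set" where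
  "clause_lits c = {fst (prod_decode c), fst (prod_decode (snd (prod_decode c))),
     snd (prod_decode (snd (prod_decode c)))}"

definition clause_true :: "(nat \<Rightarrow> bool) \<Rightarrow> nat \<Rightarrow> bool" where
  "clause_true \<alpha> c \<longleftrightarrow> (\<exists>l\<in>clause_lits c. lit_true \<alpha> l)"

lemma lit_true_simps [simp]: "lit_true \<alpha> (Pos x) \<longleftrightarrow> \<alpha> x" "lit_true \<alpha> (Neg x) \<longleftrightarrow> \<not> \<alpha> x"
  by (auto simp: lit_true_def Pos_def Neg_def)

lemma clause_true_clause [simp]:
  "clause_true \<alpha> (clause k l m) \<longleftrightarrow> lit_true \<alpha> k \<or> lit_true \<alpha> l \<or> lit_true \<alpha> m"
  by (simp add: clause_true_def clause_def clause_lits_def)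

text \<open>
  The truth of a clause depends on three coordinates of an assignment only, so that the
  assignments that satisfy it form a closed subset of the compact space \<open>nat \<Rightarrow> bool\<close>.
\<close>
lemma clause_compactness:
  assumes "\<And>F. finite F \<Longrightarrow> F \<subseteq> K \<Longrightarrow> \<exists>\<alpha>. \<forall>c\<in>F. clause_true \<alpha> c"
  shows "\<exists>\<alpha>. \<forall>c\<in>K. clause_true \<alpha> c"
proof -
  let ?X = "product_topology (\<lambda>_. discrete_topology UNIV) UNIV :: (nat \<Rightarrow> bool) topology"
  let ?S = "\<lambda>c. {\<alpha>. clause_true \<alpha> c}"
  have "compact_space ?X"
    by (simp add: compact_space_product_topology compact_space_discrete_topology)
  have coord: "closedin ?X {\<alpha>. \<alpha> x = b}" for x b
    using closedin_continuous_map_preimage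
      [OF continuous_map_product_projection[of x UNIV "\<lambda>_. discrete_topology UNIV"], of "{b}"]
    by simp
  have "closedin ?X (?S c)" for c
  proof -
    have "?S c = (\<Union>l\<in>clause_lits c. {\<alpha>. \<alpha> (l div 2) = odd l})"
      by (auto simp: clause_true_def lit_true_def)
    then show ?thesis
      by (auto simp: clause_lits_def intro!: closedin_Union coord)
  qed
  then have cl: "\<forall>C\<in>?S ` K. closedin ?X C" by blast
  have fip: "\<Inter>F \<noteq> {}" if F: "finite F" "F \<subseteq> ?S ` K" for F
  proof -
    obtain K' where "K' \<subseteq> K" "finite K'" "F = ?S ` K'"
      using finite_subset_image[OF F] by blast
    then show ?thesis using assms[of K'] by auto
  qed
  have "\<Inter>(?S ` K) \<noteq> {}"
    by (rule spec[OF compact_space_fip[THEN iffD1, OF \<open>compact_space ?X\<close>], THEN mp]) (use cl fip in blast)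
  then show ?thesis by auto
qed

section \<open>Clauses that describe a Henkin model\<close>

text \<open>
  Every number is regarded as a name of an element of a group.  Apart from names that express the
  group operations, \<open>val_name t s\<close> denotes the value of the term with code \<open>t\<close> under the
  assignment of variables with code \<open>s\<close>, and \<open>wit_name i p s\<close> an element that falsifies the
  formula with code \<open>p\<close> when it is assigned to the variable \<open>i\<close>, if there is one.  The assignment
  with code \<open>0\<close> interprets the free variables of a theory, and \<open>upd_env\<close> changes an assignment at
  one variable.  A formula is always accompanied by an assignment, so that universal formulas are
  instantiated by a change of the assignment and not by substitution.
\<close>
definition one_name :: nat where "one_name = prod_encode (0, 0)"
definition inv_name :: "nat \<Rightarrow> nat" where "inv_name a = prod_encode (1, a)"
definition mul_name :: "nat \<Rightarrow> nat \<Rightarrow> nat" where "mul_name a b = prod_encode (2, prod_encode (a, b))"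
definition val_name :: "nat \<Rightarrow> nat \<Rightarrow> nat" where "val_name t s = prod_encode (3, prod_encode (s, t))"
definition wit_name :: "nat \<Rightarrow> nat \<Rightarrow> nat \<Rightarrow> nat" where
  "wit_name i p s = prod_encode (4, prod_encode (s, prod_encode (i, p)))"

definition upd_env :: "nat \<Rightarrow> nat \<Rightarrow> nat \<Rightarrow> nat" where
  "upd_env s i a = Suc (prod_encode (s, prod_encode (i, a)))"

text \<open>
  The atoms say that two names denote the same element, that a formula holds under an assignment,
  and that a word contains only letters of the first \<open>n\<close> generators and evaluates to a named
  element.
\<close>
definition eq_atom :: "nat \<Rightarrow> nat \<Rightarrow> nat" where "eq_atom a b = prod_encode (0, prod_encode (a, b))"
definition form_atom :: "nat \<Rightarrow> nat \<Rightarrow> nat" where "form_atom p s = prod_encode (1, prod_encode (p, s))"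
definition word_atom :: "nat \<Rightarrow> nat \<Rightarrow> nat" where "word_atom w a = prod_encode (2, prod_encode (w, a))"

text \<open>
  The letter \<open>(i, b)\<close> has the code \<open>2 * i + of_bool b\<close>, and the generators are the values of the
  free variables; this names the inverse of the letter.
\<close>
definition letter_inv_name :: "nat \<Rightarrow> nat" where
  "letter_inv_name l = (let x = val_name (prod_encode (0, l div 2)) 0 in if odd l then x else inv_name x)"

text \<open>
  The parameters range over all numbers, whether or not they are codes of terms or formulas.
  Therefore the clauses can be listed without any decoding of syntax.  A word is evaluated by moving
  the inverse of its first letter to the other side of the equation.  If this letter is not one of
  the first \<open>n\<close> generators, then the first of the last two clauses makes the atom false, and the
  second one becomes a tautology.
\<close>
definition schemata :: "nat \<Rightarrow> (nat \<Rightarrow> nat \<Rightarrow> nat \<Rightarrow> nat \<Rightarrow> nat) list" where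
  "schemata n =
   [\<lambda>a b c d. let l = Pos (eq_atom a a) in clause l l l,
    \<lambda>a b c d. clause (Neg (eq_atom a b)) (Neg (eq_atom c b)) (Pos (eq_atom a c)),
    \<lambda>a b c d. let l = Pos (eq_atom (mul_name a c) (mul_name b c)) in clause (Neg (eq_atom a b)) l l,
    \<lambda>a b c d. let l = Pos (eq_atom (mul_name c a) (mul_name c b)) in clause (Neg (eq_atom a b)) l l,
    \<lambda>a b c d. let l = Pos (eq_atom (mul_name (mul_name a b) c) (mul_name a (mul_name b c)))
      in clause l l l,
    \<lambda>a b c d. let l = Pos (eq_atom (mul_name one_name a) a) in clause l l l,
    \<lambda>a b c d. let l = Pos (eq_atom (mul_name (inv_name a) a) one_name) in clause l l l,
    \<lambda>a b c d. let l = Pos (eq_atom (val_name (prod_encode (0, a)) (upd_env c b d))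
      (if a = b then d else val_name (prod_encode (0, a)) c)) in clause l l l,
    \<lambda>a b c d. let l = Pos (eq_atom (val_name (prod_encode (1, 0)) a) one_name) in clause l l l,
    \<lambda>a b c d. let l = Pos (eq_atom (val_name (prod_encode (2, a)) b) (inv_name (val_name a b)))
      in clause l l l,
    \<lambda>a b c d. let l = Pos (eq_atom (val_name (prod_encode (3, prod_encode (a, b))) c)
      (mul_name (val_name a c) (val_name b c))) in clause l l l,
    \<lambda>a b c d. let l = Pos (eq_atom (val_name a c) (val_name b c))
      in clause (Neg (form_atom (prod_encode (0, prod_encode (a, b))) c)) l l,
    \<lambda>a b c d. let l = Neg (eq_atom (val_name a c) (val_name b c))
      in clause (Pos (form_atom (prod_encode (0, prod_encode (a, b))) c)) l l,
    \<lambda>a b c d. let l = Neg (form_atom (prod_encode (1, 0)) a) in clause l l l,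
    \<lambda>a b c d. clause (Neg (form_atom (prod_encode (2, prod_encode (a, b))) c))
      (Neg (form_atom a c)) (Pos (form_atom b c)),
    \<lambda>a b c d. let l = Pos (form_atom (prod_encode (2, prod_encode (a, b))) c)
      in clause l l (Pos (form_atom a c)),
    \<lambda>a b c d. let l = Pos (form_atom (prod_encode (2, prod_encode (a, b))) c)
      in clause l l (Neg (form_atom b c)),
    \<lambda>a b c d. let l = Neg (form_atom (prod_encode (3, prod_encode (a, b))) c)
      in clause l l (Pos (form_atom b (upd_env c a d))),
    \<lambda>a b c d. let l = Pos (form_atom (prod_encode (3, prod_encode (a, b))) c)
      in clause l l (Neg (form_atom b (upd_env c a (wit_name a b c)))),
    \<lambda>a b c d. let l = Neg (word_atom 0 a) in clause l l (Pos (eq_atom one_name a)),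
    \<lambda>a b c d. let l = Pos (word_atom 0 a) in clause l l (Neg (eq_atom one_name a)),
    \<lambda>a b c d. let l = Neg (word_atom (Suc (prod_encode (a, b))) c)
      in clause l l (if a < 2 * n then Pos (word_atom b (mul_name (letter_inv_name a) c)) else l),
    \<lambda>a b c d. let l = Pos (word_atom (Suc (prod_encode (a, b))) c)
      in clause l (if a < 2 * n then l else Neg (word_atom (Suc (prod_encode (a, b))) c))
        (Neg (word_atom b (mul_name (letter_inv_name a) c)))]"

definition base_clauses :: "nat \<Rightarrow> nat set" where
  "base_clauses n = {f a b c d | f a b c d. f \<in> set (schemata n)}"

text \<open>
  The meaning of the clauses for the set \<open>\<alpha>\<close> of true atoms, see \<open>truth_assignment_iff\<close>.
\<close>
locale truth_assignment =
  fixes n :: nat and \<alpha> :: "nat \<Rightarrow> bool"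
  assumes eq_refl: "\<alpha> (eq_atom a a)"
    and eq_euclid: "\<alpha> (eq_atom a b) \<Longrightarrow> \<alpha> (eq_atom c b) \<Longrightarrow> \<alpha> (eq_atom a c)"
    and mul_cong_left: "\<alpha> (eq_atom a b) \<Longrightarrow> \<alpha> (eq_atom (mul_name a c) (mul_name b c))"
    and mul_cong_right: "\<alpha> (eq_atom a b) \<Longrightarrow> \<alpha> (eq_atom (mul_name c a) (mul_name c b))"
    and mul_assoc: "\<alpha> (eq_atom (mul_name (mul_name a b) c) (mul_name a (mul_name b c)))"
    and one_left: "\<alpha> (eq_atom (mul_name one_name a) a)"
    and inv_left: "\<alpha> (eq_atom (mul_name (inv_name a) a) one_name)"
    and val_var: "\<alpha> (eq_atom (val_name (prod_encode (0, i)) (upd_env s j a))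
      (if i = j then a else val_name (prod_encode (0, i)) s))"
    and val_one: "\<alpha> (eq_atom (val_name (prod_encode (1, 0)) s) one_name)"
    and val_inv: "\<alpha> (eq_atom (val_name (prod_encode (2, t)) s) (inv_name (val_name t s)))"
    and val_mul: "\<alpha> (eq_atom (val_name (prod_encode (3, prod_encode (t, u))) s)
      (mul_name (val_name t s) (val_name u s)))"
    and form_eq: "\<alpha> (form_atom (prod_encode (0, prod_encode (t, u))) s) \<longleftrightarrow>
      \<alpha> (eq_atom (val_name t s) (val_name u s))"
    and form_bot: "\<not> \<alpha> (form_atom (prod_encode (1, 0)) s)"
    and form_imp: "\<alpha> (form_atom (prod_encode (2, prod_encode (p, q))) s) \<longleftrightarrow>
      (\<alpha> (form_atom p s) \<longrightarrow> \<alpha> (form_atom q s))"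
    and form_all: "\<alpha> (form_atom (prod_encode (3, prod_encode (i, p))) s) \<Longrightarrow>
      \<alpha> (form_atom p (upd_env s i a))"
    and form_wit: "\<alpha> (form_atom p (upd_env s i (wit_name i p s))) \<Longrightarrow>
      \<alpha> (form_atom (prod_encode (3, prod_encode (i, p))) s)"
    and word_Nil: "\<alpha> (word_atom 0 a) \<longleftrightarrow> \<alpha> (eq_atom one_name a)"
    and word_Cons: "\<alpha> (word_atom (Suc (prod_encode (l, w))) a) \<longleftrightarrow>
      l < 2 * n \<and> \<alpha> (word_atom w (mul_name (letter_inv_name l) a))"

lemma truth_assignment_iff: "truth_assignment n \<alpha> \<longleftrightarrow> (\<forall>c\<in>base_clauses n. clause_true \<alpha> c)"
proof
  assume "\<forall>c\<in>base_clauses n. clause_true \<alpha> c"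
  then have H: "clause_true \<alpha> ((schemata n ! k) a b c d)" if "k < length (schemata n)" for k a b c d
    using that nth_mem unfolding base_clauses_def by blast
  note D = schemata_def Let_def
  show "truth_assignment n \<alpha>"
  proof
    fix a b c d i j s t u p q l w
    show "\<alpha> (eq_atom a a)"
      using H[of 0 a] by (simp add: D)
    show "\<alpha> (eq_atom a b) \<Longrightarrow> \<alpha> (eq_atom c b) \<Longrightarrow> \<alpha> (eq_atom a c)"
      using H[of 1 a b c] by (simp add: D)
    show "\<alpha> (eq_atom a b) \<Longrightarrow> \<alpha> (eq_atom (mul_name a c) (mul_name b c))"
      using H[of 2 a b c] by (simp add: D)
    show "\<alpha> (eq_atom a b) \<Longrightarrow> \<alpha> (eq_atom (mul_name c a) (mul_name c b))"
      using H[of 3 a b c] by (simp add: D)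
    show "\<alpha> (eq_atom (mul_name (mul_name a b) c) (mul_name a (mul_name b c)))"
      using H[of 4 a b c] by (simp add: D)
    show "\<alpha> (eq_atom (mul_name one_name a) a)"
      using H[of 5 a] by (simp add: D)
    show "\<alpha> (eq_atom (mul_name (inv_name a) a) one_name)"
      using H[of 6 a] by (simp add: D)
    show "\<alpha> (eq_atom (val_name (prod_encode (0, i)) (upd_env s j a))
      (if i = j then a else val_name (prod_encode (0, i)) s))"
      using H[of 7 i j s a] by (simp add: D)
    show "\<alpha> (eq_atom (val_name (prod_encode (1, 0)) s) one_name)"
      using H[of 8 s] by (simp add: D)
    show "\<alpha> (eq_atom (val_name (prod_encode (2, t)) s) (inv_name (val_name t s)))"
      using H[of 9 t s] by (simp add: D)
    show "\<alpha> (eq_atom (val_name (prod_encode (3, prod_encode (t, u))) s)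
      (mul_name (val_name t s) (val_name u s)))"
      using H[of 10 t u s] by (simp add: D)
    show "\<alpha> (form_atom (prod_encode (0, prod_encode (t, u))) s) \<longleftrightarrow>
      \<alpha> (eq_atom (val_name t s) (val_name u s))"
      using H[of 11 t u s] H[of 12 t u s] by (auto simp: D)
    show "\<not> \<alpha> (form_atom (prod_encode (1, 0)) s)"
      using H[of 13 s] by (simp add: D)
    show "\<alpha> (form_atom (prod_encode (2, prod_encode (p, q))) s) \<longleftrightarrow>
      (\<alpha> (form_atom p s) \<longrightarrow> \<alpha> (form_atom q s))"
      using H[of 14 p q s] H[of 15 p q s] H[of 16 p q s] by (auto simp: D)
    show "\<alpha> (form_atom (prod_encode (3, prod_encode (i, p))) s) \<Longrightarrow>
      \<alpha> (form_atom p (upd_env s i a))"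
      using H[of 17 i p s a] by (simp add: D)
    show "\<alpha> (form_atom p (upd_env s i (wit_name i p s))) \<Longrightarrow>
      \<alpha> (form_atom (prod_encode (3, prod_encode (i, p))) s)"
      using H[of 18 i p s] by (simp add: D)
    show "\<alpha> (word_atom 0 a) \<longleftrightarrow> \<alpha> (eq_atom one_name a)"
      using H[of 19 a] H[of 20 a] by (auto simp: D)
    show "\<alpha> (word_atom (Suc (prod_encode (l, w))) a) \<longleftrightarrow>
      l < 2 * n \<and> \<alpha> (word_atom w (mul_name (letter_inv_name l) a))"
      using H[of 21 l w a] H[of 22 l w a] by (auto simp: D split: if_splits)
  qed
next
  assume "truth_assignment n \<alpha>"
  then interpret truth_assignment n \<alpha> .
  note facts = eq_refl mul_cong_left mul_cong_right mul_assoc one_left inv_left val_var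
    val_one val_inv val_mul form_eq form_bot form_imp form_all form_wit word_Nil word_Cons
  have "clause_true \<alpha> (f a b c d)" if "f \<in> set (schemata n)" for f a b c d
    using that unfolding schemata_def Let_def list.set
    apply (elim insertE emptyE; hypsubst)
                        apply (simp_all add: facts del: One_nat_def)
     apply (use eq_euclid[of a b c] in simp)
    apply (use form_wit[of b c a] in auto)
    done
  note true = this
  show "\<forall>c\<in>base_clauses n. clause_true \<alpha> c"
  proof
    fix e
    assume "e \<in> base_clauses n"
    then obtain f a b c d where "f \<in> set (schemata n)" "e = f a b c d"
      unfolding base_clauses_def by (elim CollectE exE conjE)
    then show "clause_true \<alpha> e" by (simp only: true)
  qed
qed


section \<open>From truth assignments to models\<close>

definition models :: "('a, 'b) monoid_scheme \<Rightarrow> (nat \<Rightarrow> 'a) \<Rightarrow> grp_form set \<Rightarrow> bool" where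
  "models M \<iota> \<Gamma> \<longleftrightarrow> group M \<and> range \<iota> \<subseteq> carrier M \<and> (\<forall>\<phi>\<in>\<Gamma>. form_holds M \<iota> \<phi>)"

context truth_assignment
begin

text \<open>
  The least name of an element serves as the element itself, so that the carrier of the model
  consists of natural numbers instead of equivalence classes.
\<close>
definition rep :: "nat \<Rightarrow> nat" where
  "rep a = (LEAST b. \<alpha> (eq_atom a b))"

definition term_model :: "nat monoid" where
  "term_model = \<lparr>carrier = range rep, monoid.mult = (\<lambda>x y. rep (mul_name x y)), one = rep one_name\<rparr>"

definition val_env :: "nat \<Rightarrow> nat \<Rightarrow> nat" where
  "val_env s i = rep (val_name (prod_encode (0, i)) s)"

lemma eq_sym: "\<alpha> (eq_atom a b) \<Longrightarrow> \<alpha> (eq_atom b a)"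
  using eq_euclid eq_refl by blast

lemma eq_trans: "\<alpha> (eq_atom a b) \<Longrightarrow> \<alpha> (eq_atom b c) \<Longrightarrow> \<alpha> (eq_atom a c)"
  using eq_euclid eq_sym by blast

lemma eq_rep: "\<alpha> (eq_atom a (rep a))"
  unfolding rep_def using eq_refl by (rule LeastI)

lemma rep_eq_iff: "rep a = rep b \<longleftrightarrow> \<alpha> (eq_atom a b)"
proof
  assume "rep a = rep b"
  then show "\<alpha> (eq_atom a b)" by (metis eq_rep eq_euclid)
next
  assume "\<alpha> (eq_atom a b)"
  then have "\<alpha> (eq_atom a c) \<longleftrightarrow> \<alpha> (eq_atom b c)" for c using eq_sym eq_trans by blast
  then show "rep a = rep b" by (simp add: rep_def)
qed

lemma rep_mul_rep [simp]:
  "rep (mul_name (rep a) b) = rep (mul_name a b)" "rep (mul_name a (rep b)) = rep (mul_name a b)"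
  using mul_cong_left mul_cong_right eq_rep eq_sym by (auto simp: rep_eq_iff)

lemma group_term_model: "group term_model"
proof (rule groupI)
  fix x y z
  assume "x \<in> carrier term_model" "y \<in> carrier term_model" "z \<in> carrier term_model"
  then show "x \<otimes>\<^bsub>term_model\<^esub> y \<otimes>\<^bsub>term_model\<^esub> z = x \<otimes>\<^bsub>term_model\<^esub> (y \<otimes>\<^bsub>term_model\<^esub> z)"
    by (auto simp: term_model_def rep_eq_iff mul_assoc)
next
  fix x
  assume "x \<in> carrier term_model"
  then obtain a where "x = rep a" by (auto simp: term_model_def)
  then have "rep (inv_name a) \<otimes>\<^bsub>term_model\<^esub> x = \<one>\<^bsub>term_model\<^esub>"
    by (auto simp: term_model_def rep_eq_iff inv_left)
  then show "\<exists>y\<in>carrier term_model. y \<otimes>\<^bsub>term_model\<^esub> x = \<one>\<^bsub>term_model\<^esub>"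
    by (auto simp: term_model_def)
qed (auto simp: term_model_def rep_eq_iff one_left)

sublocale term_model: group term_model
  by (rule group_term_model)

lemma term_model_simps [simp]:
  "rep a \<in> carrier term_model" "rep a \<otimes>\<^bsub>term_model\<^esub> rep b = rep (mul_name a b)"
  "\<one>\<^bsub>term_model\<^esub> = rep one_name"
  by (auto simp: term_model_def)

lemma term_model_inv [simp]: "inv\<^bsub>term_model\<^esub> (rep a) = rep (inv_name a)"
  by (rule term_model.inv_equality) (auto simp: rep_eq_iff inv_left)

lemma rep_val_name: "rep (val_name (term_code t) s) = term_val term_model (val_env s) t"
proof (induction t)
  case TOne
  show ?case using val_one by (simp add: rep_eq_iff)
next
  case (TInv t)
  have "rep (val_name (term_code (TInv t)) s) = rep (inv_name (val_name (term_code t) s))"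
    using val_inv by (simp add: rep_eq_iff)
  also have "\<dots> = inv\<^bsub>term_model\<^esub> (rep (val_name (term_code t) s))" by simp
  finally show ?case using TInv by simp
next
  case (TMul t u)
  have "rep (val_name (term_code (TMul t u)) s) =
      rep (mul_name (val_name (term_code t) s) (val_name (term_code u) s))"
    using val_mul by (simp add: rep_eq_iff)
  also have "\<dots> = rep (val_name (term_code t) s) \<otimes>\<^bsub>term_model\<^esub> rep (val_name (term_code u) s)" by simp
  finally show ?case using TMul by simp
qed (simp add: val_env_def)

lemma val_env_upd: "val_env (upd_env s i a) = (val_env s)(i := rep a)"
proof
  fix j
  show "val_env (upd_env s i a) j = ((val_env s)(i := rep a)) j"
    using val_var[of j s i a] by (auto simp: val_env_def rep_eq_iff)
qed

text \<open>
  The truth lemma.  The named witnesses are needed for universal formulas only: if \<open>FAll i p\<close> is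
  false in the assignment, then so is \<open>p\<close> at the witness.
\<close>
lemma form_atom_iff: "\<alpha> (form_atom (form_code p) s) \<longleftrightarrow> form_holds term_model (val_env s) p"
proof (induction p arbitrary: s)
  case (FEq t u)
  show ?case by (simp add: form_eq flip: rep_eq_iff rep_val_name)
next
  case (FAll i p)
  have "\<alpha> (form_atom (form_code (FAll i p)) s) \<longleftrightarrow>
      (\<forall>a. \<alpha> (form_atom (form_code p) (upd_env s i a)))"
    using form_all form_wit by auto
  also have "\<dots> \<longleftrightarrow> (\<forall>a. form_holds term_model ((val_env s)(i := rep a)) p)"
    by (simp only: FAll.IH val_env_upd)
  also have "\<dots> \<longleftrightarrow> form_holds term_model (val_env s) (FAll i p)"
    by (auto simp: term_model_def)
  finally show ?case .
qed (use form_bot form_imp in auto)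

lemma range_val_env: "range (val_env s) \<subseteq> carrier term_model"
  by (auto simp: val_env_def)

lemma word_atom_iff:
  "\<alpha> (word_atom (word_code w) a) \<longleftrightarrow> w \<in> words_over n \<and> word_eval term_model (val_env 0) w = rep a"
proof (induction w arbitrary: a)
  case Nil
  show ?case by (simp add: word_code_def word_Nil rep_eq_iff)
next
  case (Cons x w)
  obtain i b where x: "x = (i, b)" by (cases x)
  let ?l = "2 * i + of_bool b :: nat"
  let ?y = "if b then inv\<^bsub>term_model\<^esub> (val_env 0 i) else val_env 0 i"
  have y: "?y \<in> carrier term_model"
    using range_val_env[of 0] by auto
  have l: "?l < 2 * n \<longleftrightarrow> i < n" "?l div 2 = i" "odd ?l \<longleftrightarrow> b" by auto
  have li: "rep (letter_inv_name ?l) = inv\<^bsub>term_model\<^esub> ?y"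
    unfolding letter_inv_name_def Let_def l(2,3)
    using term_model.inv_inv[of "val_env 0 i"] range_val_env[of 0] by (auto simp: val_env_def)
  have "\<alpha> (word_atom (word_code (x # w)) a) \<longleftrightarrow>
      i < n \<and> \<alpha> (word_atom (word_code w) (mul_name (letter_inv_name ?l) a))"
    using word_Cons[of ?l "word_code w" a] unfolding l by (simp add: word_code_def x)
  also have "\<dots> \<longleftrightarrow> i < n \<and> w \<in> words_over n \<and>
      word_eval term_model (val_env 0) w = inv\<^bsub>term_model\<^esub> ?y \<otimes>\<^bsub>term_model\<^esub> rep a"
    unfolding Cons.IH li[symmetric] by simp
  also have "\<dots> \<longleftrightarrow> i < n \<and> w \<in> words_over n \<and>
      ?y \<otimes>\<^bsub>term_model\<^esub> word_eval term_model (val_env 0) w = rep a"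
  proof (intro conj_cong refl)
    assume "w \<in> words_over n"
    then have w: "word_eval term_model (val_env 0) w \<in> carrier term_model"
      using range_val_env[of 0] by (intro word_eval_closed[OF group_term_model]) auto
    show "word_eval term_model (val_env 0) w = inv\<^bsub>term_model\<^esub> ?y \<otimes>\<^bsub>term_model\<^esub> rep a \<longleftrightarrow>
        ?y \<otimes>\<^bsub>term_model\<^esub> word_eval term_model (val_env 0) w = rep a"
      unfolding term_model.inv_solve_left[OF w y term_model_simps(1)] by (rule eq_commute)
  qed
  finally show ?case by (simp add: x)
qed

lemma models_term_model:
  assumes "\<And>\<phi>. \<phi> \<in> \<Gamma> \<Longrightarrow> \<alpha> (form_atom (form_code \<phi>) 0)"
  shows "models term_model (val_env 0) \<Gamma>"
  using assms form_atom_iff group_term_model range_val_env by (auto simp: models_def)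

end


section \<open>From models to truth assignments\<close>

lemma snd_prod_decode_less: "fst (prod_decode x) \<noteq> 0 \<Longrightarrow> snd (prod_decode x) < x"
proof -
  assume 0: "fst (prod_decode x) \<noteq> 0"
  obtain m k where x: "prod_decode x = (m, k)" by force
  have "s \<le> triangle s" for s by (induction s) auto
  then have "m + k \<le> triangle (m + k)" .
  then have "k < prod_encode (m, k)"
    using 0[unfolded x] by (simp add: prod_encode_def)
  then show ?thesis using x by (metis prod_decode_inverse snd_conv)
qed

lemma fst_prod_decode_le: "fst (prod_decode x) \<le> x"
  using le_prod_encode_1[of "fst (prod_decode x)" "snd (prod_decode x)"] by simp

lemma snd_prod_decode_le: "snd (prod_decode x) \<le> x"
  using le_prod_encode_2[of "snd (prod_decode x)" "fst (prod_decode x)"] by simp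

lemma prod_decode_components_less:
  assumes "fst (prod_decode x) \<noteq> 0"
  shows "snd (prod_decode x) < x" "fst (prod_decode (snd (prod_decode x))) < x"
    "snd (prod_decode (snd (prod_decode x))) < x"
  using snd_prod_decode_less[OF assms] fst_prod_decode_le[of "snd (prod_decode x)"]
    snd_prod_decode_le[of "snd (prod_decode x)"] by linarith+

text \<open>
  The decoding functions are total, with arbitrary values where a number is not a code.  In this way
  the clauses about numbers that are not codes hold for the assignment that comes from a model, too.
\<close>
function decode_term :: "nat \<Rightarrow> grp_term" where
  "decode_term x = (let k = fst (prod_decode x); y = snd (prod_decode x) in
     if k = 0 then TVar y
     else if k = 1 then TOne
     else if k = 2 then TInv (decode_term y)
     else TMul (decode_term (fst (prod_decode y))) (decode_term (snd (prod_decode y))))"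
  by pat_completeness auto
termination
  by (relation "Wellfounded.measure id")
    (auto simp: prod_decode_components_less)

function decode_form :: "nat \<Rightarrow> grp_form" where
  "decode_form x = (let k = fst (prod_decode x); y = snd (prod_decode x) in
     if k = 0 then FEq (decode_term (fst (prod_decode y))) (decode_term (snd (prod_decode y)))
     else if k = 1 then FBot
     else if k = 2 then FImp (decode_form (fst (prod_decode y))) (decode_form (snd (prod_decode y)))
     else FAll (fst (prod_decode y)) (decode_form (snd (prod_decode y))))"
  by pat_completeness auto
termination
  by (relation "Wellfounded.measure id")
    (auto simp: prod_decode_components_less)

declare decode_term.simps [simp del] decode_form.simps [simp del]

lemma decode_term_simps [simp]:
  "decode_term (prod_encode (0, i)) = TVar i"
  "decode_term (prod_encode (Suc 0, i)) = TOne"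
  "decode_term (prod_encode (2, t)) = TInv (decode_term t)"
  "decode_term (prod_encode (3, prod_encode (t, u))) = TMul (decode_term t) (decode_term u)"
  by (subst decode_term.simps; simp)+

lemma decode_form_simps [simp]:
  "decode_form (prod_encode (0, prod_encode (t, u))) = FEq (decode_term t) (decode_term u)"
  "decode_form (prod_encode (Suc 0, i)) = FBot"
  "decode_form (prod_encode (2, prod_encode (p, q))) = FImp (decode_form p) (decode_form q)"
  "decode_form (prod_encode (3, prod_encode (i, p))) = FAll i (decode_form p)"
  by (subst decode_form.simps; simp)+

lemma decode_term_code [simp]: "decode_term (term_code t) = t"
  by (induction t) auto

lemma decode_form_code [simp]: "decode_form (form_code p) = p"
  by (induction p) auto

definition decode_word :: "nat \<Rightarrow> word" where
  "decode_word x = map (\<lambda>l. (l div 2, odd l)) (list_decode x)"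

lemma decode_word_simps [simp]:
  "decode_word 0 = []" "decode_word (Suc (prod_encode (l, w))) = (l div 2, odd l) # decode_word w"
  by (auto simp: decode_word_def)

lemma decode_word_code [simp]: "decode_word (word_code w) = w"
proof -
  have "(\<lambda>l. (l div 2, odd l)) (case x of (i, b) \<Rightarrow> 2 * i + of_bool b) = x" for x :: "nat \<times> bool"
    by (cases x) auto
  then show ?thesis by (simp add: decode_word_def word_code_def comp_def)
qed

lemma word_code_decode [simp]: "word_code (decode_word x) = x"
proof -
  have "(case (l div 2, odd l) of (i, b) \<Rightarrow> 2 * i + of_bool b) = l" for l :: nat
    by (simp add: mult_2) presburger
  then have "map ((\<lambda>(i, b). 2 * i + of_bool b) \<circ> (\<lambda>l. (l div 2, odd l))) xs = xs" for xs :: "nat list"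
    by (induction xs) (simp_all)
  then show ?thesis by (simp add: decode_word_def word_code_def)
qed

text \<open>
  An element of the carrier in any case, because it becomes the value of a name.
\<close>
definition counterexample :: "('a, 'b) monoid_scheme \<Rightarrow> (nat \<Rightarrow> 'a) \<Rightarrow> nat \<Rightarrow> grp_form \<Rightarrow> 'a" where
  "counterexample M s i p = (SOME a. a \<in> carrier M \<and>
     ((\<exists>b\<in>carrier M. \<not> form_holds M (s(i := b)) p) \<longrightarrow> \<not> form_holds M (s(i := a)) p))"

lemma counterexample:
  assumes "carrier M \<noteq> {}"
  shows "counterexample M s i p \<in> carrier M"
    and "\<exists>b\<in>carrier M. \<not> form_holds M (s(i := b)) p \<Longrightarrow>
      \<not> form_holds M (s(i := counterexample M s i p)) p"
proof -
  have "\<exists>a. a \<in> carrier M \<and>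
     ((\<exists>b\<in>carrier M. \<not> form_holds M (s(i := b)) p) \<longrightarrow> \<not> form_holds M (s(i := a)) p)"
    using assms by blast
  from someI_ex[OF this]
  show "counterexample M s i p \<in> carrier M"
    "\<exists>b\<in>carrier M. \<not> form_holds M (s(i := b)) p \<Longrightarrow>
      \<not> form_holds M (s(i := counterexample M s i p)) p"
    unfolding counterexample_def by blast+
qed

text \<open>
  A name may contain an assignment, whose values are names again.  All of them have smaller codes.
\<close>
function name_val :: "('a, 'b) monoid_scheme \<Rightarrow> (nat \<Rightarrow> 'a) \<Rightarrow> nat \<Rightarrow> 'a"
  and env_val :: "('a, 'b) monoid_scheme \<Rightarrow> (nat \<Rightarrow> 'a) \<Rightarrow> nat \<Rightarrow> nat \<Rightarrow> 'a" where
  "name_val M \<iota> x = (let k = fst (prod_decode x); y = snd (prod_decode x) in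
     if k = 0 then \<one>\<^bsub>M\<^esub>
     else if k = 1 then inv\<^bsub>M\<^esub> (name_val M \<iota> y)
     else if k = 2 then name_val M \<iota> (fst (prod_decode y)) \<otimes>\<^bsub>M\<^esub> name_val M \<iota> (snd (prod_decode y))
     else let s = env_val M \<iota> (fst (prod_decode y)); z = snd (prod_decode y) in
       if k = 3 then term_val M s (decode_term z)
       else counterexample M s (fst (prod_decode z)) (decode_form (snd (prod_decode z))))"
| "env_val M \<iota> s = (if s = 0 then \<iota> else
     let y = snd (prod_decode (s - 1)) in
       (env_val M \<iota> (fst (prod_decode (s - 1))))
         (fst (prod_decode y) := name_val M \<iota> (snd (prod_decode y))))"
  by pat_completeness auto
termination
  by (relation "Wellfounded.measure (\<lambda>z. case z of Inl (_, _, x) \<Rightarrow> x | Inr (_, _, x) \<Rightarrow> x)")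
    (auto simp: prod_decode_components_less intro: le_less_trans[OF fst_prod_decode_le]
      le_less_trans[OF order_trans[OF snd_prod_decode_le snd_prod_decode_le]])

declare name_val.simps [simp del] env_val.simps [simp del]

lemma name_val_simps [simp]:
  "name_val M \<iota> one_name = \<one>\<^bsub>M\<^esub>"
  "name_val M \<iota> (inv_name a) = inv\<^bsub>M\<^esub> (name_val M \<iota> a)"
  "name_val M \<iota> (mul_name a b) = name_val M \<iota> a \<otimes>\<^bsub>M\<^esub> name_val M \<iota> b"
  "name_val M \<iota> (val_name t s) = term_val M (env_val M \<iota> s) (decode_term t)"
  "name_val M \<iota> (wit_name i p s) = counterexample M (env_val M \<iota> s) i (decode_form p)"
  by (subst name_val.simps; simp add: one_name_def inv_name_def mul_name_def val_name_def wit_name_def)+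

lemma env_val_simps [simp]:
  "env_val M \<iota> 0 = \<iota>" "env_val M \<iota> (upd_env s i a) = (env_val M \<iota> s)(i := name_val M \<iota> a)"
  by (subst env_val.simps; simp add: upd_env_def)+

definition model_assignment :: "nat \<Rightarrow> ('a, 'b) monoid_scheme \<Rightarrow> (nat \<Rightarrow> 'a) \<Rightarrow> nat \<Rightarrow> bool" where
  "model_assignment n M \<iota> x \<longleftrightarrow>
    (let k = fst (prod_decode x); y = fst (prod_decode (snd (prod_decode x)));
         z = snd (prod_decode (snd (prod_decode x))) in
      if k = 0 then name_val M \<iota> y = name_val M \<iota> z
      else if k = 1 then form_holds M (env_val M \<iota> z) (decode_form y)
      else decode_word y \<in> words_over n \<and> word_eval M \<iota> (decode_word y) = name_val M \<iota> z)"

lemma model_assignment_simps [simp]: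
  "model_assignment n M \<iota> (eq_atom a b) \<longleftrightarrow> name_val M \<iota> a = name_val M \<iota> b"
  "model_assignment n M \<iota> (form_atom p s) \<longleftrightarrow> form_holds M (env_val M \<iota> s) (decode_form p)"
  "model_assignment n M \<iota> (word_atom w a) \<longleftrightarrow>
    decode_word w \<in> words_over n \<and> word_eval M \<iota> (decode_word w) = name_val M \<iota> a"
  by (auto simp: model_assignment_def eq_atom_def form_atom_def word_atom_def)

context group
begin

lemma term_val_closed: "range s \<subseteq> carrier G \<Longrightarrow> term_val G s t \<in> carrier G"
  by (induction t) auto

lemma name_val_closed:
  assumes "range \<iota> \<subseteq> carrier G"
  shows "name_val G \<iota> x \<in> carrier G" "range (env_val G \<iota> s) \<subseteq> carrier G"
proof -
  have "M = G \<Longrightarrow> range \<iota> \<subseteq> carrier G \<Longrightarrow> name_val M \<iota> x \<in> carrier G"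
    "M = G \<Longrightarrow> range \<iota> \<subseteq> carrier G \<Longrightarrow> range (env_val M \<iota> s) \<subseteq> carrier G" for M
  proof (induction M \<iota> x and M \<iota> s rule: name_val_env_val.induct)
    case (1 M \<iota> x)
    have c: "carrier G \<noteq> {}" by auto
    show ?case
      by (subst name_val.simps) (use 1 in \<open>simp add: Let_def term_val_closed counterexample[OF c]\<close>)
  next
    case (2 M \<iota> s)
    then show ?case
      by (subst env_val.simps) (auto simp: Let_def)
  qed
  then show "name_val G \<iota> x \<in> carrier G" "range (env_val G \<iota> s) \<subseteq> carrier G"
    using assms by auto
qed

lemma truth_assignment_model_assignment:
  assumes \<iota>: "range \<iota> \<subseteq> carrier G"
  shows "truth_assignment n (model_assignment n G \<iota>)"
proof
  fix a b c i j s t u p q l w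
  note [simp] = name_val_closed[OF \<iota>]
  have c: "carrier G \<noteq> {}" by auto
  show "model_assignment n G \<iota> (eq_atom (mul_name (mul_name a b) c) (mul_name a (mul_name b c)))"
    by (simp add: m_assoc)
  show "model_assignment n G \<iota> (form_atom p (upd_env s i (wit_name i p s))) \<Longrightarrow>
      model_assignment n G \<iota> (form_atom (prod_encode (3, prod_encode (i, p))) s)"
    using counterexample(2)[OF c] by auto
  show "model_assignment n G \<iota> (word_atom (Suc (prod_encode (l, w))) a) \<longleftrightarrow>
      l < 2 * n \<and> model_assignment n G \<iota> (word_atom w (mul_name (letter_inv_name l) a))"
  proof -
    let ?i = "l div 2" and ?b = "odd l"
    let ?y = "if odd l then inv (\<iota> ?i) else \<iota> ?i"
    have y: "?y \<in> carrier G" using \<iota> by auto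
    have 1: "l div 2 < n \<longleftrightarrow> l < 2 * n" by auto
    have 2: "name_val G \<iota> (letter_inv_name l) = inv ?y"
      using \<iota> by (auto simp: letter_inv_name_def Let_def image_subset_iff)
    have "word_eval G \<iota> (decode_word w) \<in> carrier G" if "decode_word w \<in> words_over n"
      using \<iota> that by (intro word_eval_closed is_group) auto
    then have "?y \<otimes> word_eval G \<iota> (decode_word w) = name_val G \<iota> a \<longleftrightarrow>
        word_eval G \<iota> (decode_word w) = inv ?y \<otimes> name_val G \<iota> a" if "decode_word w \<in> words_over n"
      using inv_solve_left[OF _ y name_val_closed(1)[OF \<iota>]] that by (simp only: eq_commute)
    then show ?thesis
      by (auto simp: 1 2)
  qed
qed (use name_val_closed[OF \<iota>] \<iota> in \<open>auto simp: image_subset_iff\<close>)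

end

text \<open>
  The two translations, stated for an arbitrary condition \<open>P\<close> on the set of words that evaluate to
  the neutral element.
\<close>
lemma sat_clauses_iff_models:
  "(\<exists>\<alpha>. (\<forall>c\<in>base_clauses n. clause_true \<alpha> c) \<and> (\<forall>\<phi>\<in>\<Gamma>. \<alpha> (form_atom (form_code \<phi>) 0)) \<and>
      P (\<lambda>w. \<alpha> (word_atom (word_code w) one_name))) \<longleftrightarrow>
   (\<exists>(M :: nat monoid) \<iota>. models M \<iota> \<Gamma> \<and> P (\<lambda>w. w \<in> words_over n \<and> word_eval M \<iota> w = \<one>\<^bsub>M\<^esub>))"
  (is "?L \<longleftrightarrow> ?R")
proof
  assume ?L
  then obtain \<alpha> where \<alpha>: "truth_assignment n \<alpha>" "\<forall>\<phi>\<in>\<Gamma>. \<alpha> (form_atom (form_code \<phi>) 0)"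
    "P (\<lambda>w. \<alpha> (word_atom (word_code w) one_name))"
    unfolding truth_assignment_iff by blast
  interpret truth_assignment n \<alpha> by fact
  have "(\<lambda>w. \<alpha> (word_atom (word_code w) one_name)) =
      (\<lambda>w. w \<in> words_over n \<and> word_eval term_model (val_env 0) w = \<one>\<^bsub>term_model\<^esub>)"
    by (simp add: word_atom_iff)
  then show ?R
    using models_term_model[of \<Gamma>] \<alpha>(2,3) by metis
next
  assume ?R
  then obtain M :: "nat monoid" and \<iota> where M: "models M \<iota> \<Gamma>"
    and P: "P (\<lambda>w. w \<in> words_over n \<and> word_eval M \<iota> w = \<one>\<^bsub>M\<^esub>)"
    by blast
  interpret group M using M by (simp add: models_def)
  let ?\<alpha> = "model_assignment n M \<iota>"
  have "\<forall>c\<in>base_clauses n. clause_true ?\<alpha> c"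
    using truth_assignment_model_assignment[of \<iota> n] M by (simp add: models_def truth_assignment_iff)
  moreover have "\<forall>\<phi>\<in>\<Gamma>. ?\<alpha> (form_atom (form_code \<phi>) 0)"
    using M by (simp add: models_def)
  moreover have "(\<lambda>w. ?\<alpha> (word_atom (word_code w) one_name)) =
      (\<lambda>w. w \<in> words_over n \<and> word_eval M \<iota> w = \<one>\<^bsub>M\<^esub>)"
    by simp
  ultimately show ?L
    using P by metis
qed

text \<open>
  Finitely many clauses involve only finitely many members of \<open>\<Gamma>\<close>, so this is an instance of
  propositional compactness.
\<close>
theorem models_compactness:
  assumes "\<And>\<Delta>. finite \<Delta> \<Longrightarrow> \<Delta> \<subseteq> \<Gamma> \<Longrightarrow> \<exists>(M :: nat monoid) \<iota>. models M \<iota> \<Delta>"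
  shows "\<exists>(M :: nat monoid) \<iota>. models M \<iota> \<Gamma>"
proof -
  let ?u = "\<lambda>\<phi>. let l = Pos (form_atom (form_code \<phi>) 0) in clause l l l"
  have "\<exists>\<alpha>. \<forall>c\<in>base_clauses 0 \<union> ?u ` \<Gamma>. clause_true \<alpha> c"
  proof (rule clause_compactness)
    fix F
    assume F: "finite F" "F \<subseteq> base_clauses 0 \<union> ?u ` \<Gamma>"
    then have F': "finite (F - base_clauses 0)" "F - base_clauses 0 \<subseteq> ?u ` \<Gamma>" by auto
    obtain \<Delta> where \<Delta>: "\<Delta> \<subseteq> \<Gamma>" "finite \<Delta>" "F - base_clauses 0 = ?u ` \<Delta>"
      using finite_subset_image[OF F'] by blast
    obtain M :: "nat monoid" and \<iota> where "models M \<iota> \<Delta>"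
      using assms[OF \<Delta>(2,1)] by blast
    then obtain \<alpha> where \<alpha>: "\<forall>c\<in>base_clauses 0. clause_true \<alpha> c"
      "\<forall>\<phi>\<in>\<Delta>. \<alpha> (form_atom (form_code \<phi>) 0)"
      using sat_clauses_iff_models[of 0 \<Delta> "\<lambda>_. True"] by auto
    have "clause_true \<alpha> c" if "c \<in> F" for c
    proof (cases "c \<in> base_clauses 0")
      case False
      then have "c \<in> ?u ` \<Delta>" using \<Delta>(3) that by blast
      then show ?thesis using \<alpha> by (auto simp: Let_def)
    qed (use \<alpha> in blast)
    then show "\<exists>\<alpha>. \<forall>c\<in>F. clause_true \<alpha> c" by blast
  qed
  then show ?thesis
    using sat_clauses_iff_models[of 0 \<Gamma> "\<lambda>_. True"] by (auto simp: Let_def ball_Un)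
qed

section \<open>Deciding words that are determined by an enumerable theory\<close>

definition enumerable :: "grp_form set \<Rightarrow> bool" where
  "enumerable \<Gamma> \<longleftrightarrow> (\<exists>\<gamma>. computable \<gamma> \<and> form_code ` \<Gamma> = range \<gamma>)"

definition apply4 :: "(nat \<Rightarrow> nat \<Rightarrow> nat \<Rightarrow> nat \<Rightarrow> nat) \<Rightarrow> nat \<Rightarrow> nat" where
  "apply4 f x = (let y = snd (prod_decode x); z = snd (prod_decode y) in
     f (fst (prod_decode x)) (fst (prod_decode y)) (fst (prod_decode z)) (snd (prod_decode z)))"

definition theory_clause :: "nat \<Rightarrow> nat" where
  "theory_clause p = (let l = Pos (form_atom p 0) in clause l l l)"

text \<open>
  The first component of the index selects a schema, the second one provides the parameters; all
  remaining indices are used for the members of the theory, which is listed by \<open>\<gamma>\<close>.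
\<close>
definition clause_enum :: "(nat \<Rightarrow> nat) \<Rightarrow> nat \<Rightarrow> nat \<Rightarrow> nat" where
  "clause_enum \<gamma> n j =
     (if fst (prod_decode j) < length (map apply4 (schemata n))
      then (map apply4 (schemata n) ! fst (prod_decode j)) (snd (prod_decode j))
      else theory_clause (\<gamma> (snd (prod_decode j))))"

lemma apply4_encode [simp]:
  "apply4 f (prod_encode (a, prod_encode (b, prod_encode (c, d)))) = f a b c d"
  by (simp add: apply4_def)

lemma clause_enum_encode:
  "k < length (schemata n) \<Longrightarrow> clause_enum \<gamma> n (prod_encode (k, x)) = apply4 (schemata n ! k) x"
  "length (schemata n) \<le> k \<Longrightarrow> clause_enum \<gamma> n (prod_encode (k, x)) = theory_clause (\<gamma> x)"
  by (simp_all add: clause_enum_def)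

lemma range_clause_enum: "range (clause_enum \<gamma> n) = base_clauses n \<union> theory_clause ` range \<gamma>"
proof
  show "range (clause_enum \<gamma> n) \<subseteq> base_clauses n \<union> theory_clause ` range \<gamma>"
  proof
    fix c
    assume "c \<in> range (clause_enum \<gamma> n)"
    then obtain j where c: "c = clause_enum \<gamma> n j" by auto
    show "c \<in> base_clauses n \<union> theory_clause ` range \<gamma>"
    proof (cases "fst (prod_decode j) < length (schemata n)")
      case True
      then show ?thesis
        using nth_mem[OF True] unfolding c clause_enum_def base_clauses_def apply4_def Let_def
        by (intro UnI1) force
    next
      case False
      then show ?thesis by (simp add: c clause_enum_def)
    qed
  qed
  show "base_clauses n \<union> theory_clause ` range \<gamma> \<subseteq> range (clause_enum \<gamma> n)"
  proof
    fix e
    assume "e \<in> base_clauses n \<union> theory_clause ` range \<gamma>"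
    then consider "e \<in> base_clauses n" | x where "e = theory_clause (\<gamma> x)" by blast
    then show "e \<in> range (clause_enum \<gamma> n)"
    proof cases
      case 1
      then obtain f a b c d where "f \<in> set (schemata n)" "e = f a b c d"
        unfolding base_clauses_def by (elim CollectE exE conjE)
      moreover then obtain k where "k < length (schemata n)" "f = schemata n ! k"
        by (auto simp: in_set_conv_nth)
      ultimately have
        "e = clause_enum \<gamma> n (prod_encode (k, prod_encode (a, prod_encode (b, prod_encode (c, d)))))"
        by (simp add: clause_enum_encode)
      then show ?thesis by (rule range_eqI)
    next
      case 2
      then have "e = clause_enum \<gamma> n (prod_encode (length (schemata n), x))"
        by (simp add: clause_enum_encode)
      then show ?thesis by (rule range_eqI)
    qed
  qed
qed

lemma computable_dispatch:
  assumes "\<forall>f\<in>set fs. computable f" "computable g"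
  shows "computable (\<lambda>j. if fst (prod_decode j) < length fs
    then (fs ! fst (prod_decode j)) (snd (prod_decode j)) else g (snd (prod_decode j)))"
  using assms(1)
proof (induction fs rule: rev_induct)
  case Nil
  show ?case
    using computable_comp[OF assms(2) computable_prod_decode(2)[OF computable_id]] by simp
next
  case (snoc f fs)
  have "computable (\<lambda>j. if fst (prod_decode j) = length fs then f (snd (prod_decode j))
    else if fst (prod_decode j) < length fs
    then (fs ! fst (prod_decode j)) (snd (prod_decode j)) else g (snd (prod_decode j)))"
    using snoc
    by (intro computable_if[OF decidable_eq[OF computable_prod_decode(1)[OF computable_id] computable_const]
          computable_comp[OF _ computable_prod_decode(2)[OF computable_id]]]) auto
  moreover have "(if fst (prod_decode j) = length fs then f (snd (prod_decode j))
    else if fst (prod_decode j) < length fs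
    then (fs ! fst (prod_decode j)) (snd (prod_decode j)) else g (snd (prod_decode j))) =
    (if fst (prod_decode j) < length (fs @ [f])
    then ((fs @ [f]) ! fst (prod_decode j)) (snd (prod_decode j)) else g (snd (prod_decode j)))" for j
    by (auto simp: nth_append)
  ultimately show ?case by (simp only:)
qed

lemmas code_defs = apply4_def theory_clause_def clause_def Pos_def Neg_def eq_atom_def form_atom_def
  word_atom_def one_name_def inv_name_def mul_name_def val_name_def wit_name_def upd_env_def
  letter_inv_name_def Let_def

lemma computable_schemata: "\<forall>f\<in>set (schemata n). computable (apply4 f)"
  unfolding schemata_def list.set ball_simps code_defs
  by (intro conjI TrueI computable_intros)

lemma computable_clause_enum:
  assumes "computable \<gamma>"
  shows "computable (clause_enum \<gamma> n)"
proof -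
  have "computable (\<lambda>x. theory_clause (\<gamma> x))"
    unfolding code_defs by (intro computable_intros assms)
  then show ?thesis
    unfolding clause_enum_def
    using computable_dispatch[of "map apply4 (schemata n)" "\<lambda>x. theory_clause (\<gamma> x)"]
      computable_schemata by auto
qed

text \<open>
  The bits of \<open>A\<close> form an assignment to the atoms below \<open>k\<close>; clauses with other atoms do not count
  as falsified.
\<close>
definition falsifies :: "nat \<Rightarrow> nat \<Rightarrow> nat \<Rightarrow> bool" where
  "falsifies A k c \<longleftrightarrow> (\<forall>l\<in>clause_lits c. l div 2 < k \<and> odd (A div 2 ^ (l div 2)) \<noteq> odd l)"

definition refutes :: "(nat \<Rightarrow> nat) \<Rightarrow> nat \<Rightarrow> nat \<Rightarrow> nat \<Rightarrow> bool" where
  "refutes \<gamma> n l k \<longleftrightarrow>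
     (\<forall>A < 2 ^ k. falsifies A k (clause l l l) \<or> (\<exists>j<k. falsifies A k (clause_enum \<gamma> n j)))"

lemma decidable_falsifies:
  assumes "computable a" "computable k" "computable c"
  shows "decidable (\<lambda>x. falsifies (a x) (k x) (c x))"
  unfolding falsifies_def clause_lits_def ball_simps by (intro computable_intros assms)

lemma decidable_refutes:
  assumes "computable \<gamma>" "computable l" "computable k"
  shows "decidable (\<lambda>x. refutes \<gamma> n (l x) (k x))"
  unfolding refutes_def clause_def
  by (intro decidable_ball decidable_bex decidable_falsifies computable_intros
      computable_comp[OF assms(1)] computable_comp[OF assms(2)] computable_comp[OF assms(3)]
      computable_comp[OF computable_clause_enum[OF assms(1)]])

lemma set_encode_less_power2: "A \<subseteq> {..<k} \<Longrightarrow> set_encode A < 2 ^ k"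
proof -
  assume "A \<subseteq> {..<k}"
  then have "set_encode A \<le> (\<Sum>i<k. 2 ^ i)"
    unfolding set_encode_def by (intro sum_mono2) auto
  also have "\<dots> = 2 ^ k - 1" by (induction k) auto
  finally show ?thesis by (metis One_nat_def Suc_pred le_imp_less_Suc zero_less_numeral zero_less_power)
qed

text \<open>
  A refutation is a finite certificate of unsatisfiability: every assignment to finitely many atoms
  falsifies one of finitely many clauses.  Every unsatisfiable list of clauses has one, by
  compactness.
\<close>
lemma ex_refutes_iff:
  "(\<exists>k. refutes \<gamma> n l k) \<longleftrightarrow> \<not> (\<exists>\<alpha>. lit_true \<alpha> l \<and> (\<forall>j. clause_true \<alpha> (clause_enum \<gamma> n j)))"
proof
  assume "\<exists>k. refutes \<gamma> n l k"
  then obtain k where k: "refutes \<gamma> n l k" by blast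
  show "\<not> (\<exists>\<alpha>. lit_true \<alpha> l \<and> (\<forall>j. clause_true \<alpha> (clause_enum \<gamma> n j)))"
  proof
    assume "\<exists>\<alpha>. lit_true \<alpha> l \<and> (\<forall>j. clause_true \<alpha> (clause_enum \<gamma> n j))"
    then obtain \<alpha> where \<alpha>: "lit_true \<alpha> l" "\<forall>j. clause_true \<alpha> (clause_enum \<gamma> n j)" by blast
    let ?S = "{i. i < k \<and> \<alpha> i}"
    have bit: "odd (set_encode ?S div 2 ^ i) \<longleftrightarrow> i < k \<and> \<alpha> i" for i
      using set_encode_inverse[of ?S] by (auto simp: set_decode_def)
    have "\<not> clause_true \<alpha> c" if "falsifies (set_encode ?S) k c" for c
      using that by (auto simp: falsifies_def clause_true_def lit_true_def bit)
    note not_true = this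
    have "set_encode ?S < 2 ^ k"
      by (intro set_encode_less_power2) auto
    then consider "falsifies (set_encode ?S) k (clause l l l)"
      | j where "falsifies (set_encode ?S) k (clause_enum \<gamma> n j)"
      using k unfolding refutes_def by blast
    then show False
      using \<alpha> by cases (auto dest: not_true)
  qed
next
  assume unsat: "\<not> (\<exists>\<alpha>. lit_true \<alpha> l \<and> (\<forall>j. clause_true \<alpha> (clause_enum \<gamma> n j)))"
  let ?K = "insert (clause l l l) (range (clause_enum \<gamma> n))"
  have "\<not> (\<exists>\<alpha>. \<forall>c\<in>?K. clause_true \<alpha> c)"
    using unsat by auto
  then obtain F where F: "finite F" "F \<subseteq> ?K" "\<not> (\<exists>\<alpha>. \<forall>c\<in>F. clause_true \<alpha> c)"
    using clause_compactness[of ?K] by blast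
  have F': "finite (F - {clause l l l})" "F - {clause l l l} \<subseteq> range (clause_enum \<gamma> n)"
    using F by auto
  obtain J where J: "finite J" "F - {clause l l l} = clause_enum \<gamma> n ` J"
    using finite_subset_image[OF F'] by blast
  \<comment> \<open>a common bound for the indices of the clauses in \<open>F\<close> and for their atoms\<close>
  have "finite (J \<union> (\<lambda>l. l div 2) ` \<Union>(clause_lits ` F))"
    using J F(1) by (auto simp: clause_lits_def)
  then obtain k where k: "\<forall>i \<in> J \<union> (\<lambda>l. l div 2) ` \<Union>(clause_lits ` F). i < k"
    using finite_nat_set_iff_bounded by blast
  have "refutes \<gamma> n l k"
    unfolding refutes_def
  proof (intro allI impI)
    fix A :: nat
    let ?\<alpha> = "\<lambda>i. odd (A div 2 ^ i)"
    obtain c where c: "c \<in> F" "\<not> clause_true ?\<alpha> c"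
      using F(3) by blast
    have "falsifies A k c"
      using c k by (auto simp: falsifies_def clause_true_def lit_true_def)
    moreover have "c = clause l l l \<or> (\<exists>j\<in>J. c = clause_enum \<gamma> n j)"
      using c(1) J(2) by blast
    ultimately show "falsifies A k (clause l l l) \<or> (\<exists>j<k. falsifies A k (clause_enum \<gamma> n j))"
      using k by blast
  qed
  then show "\<exists>k. refutes \<gamma> n l k" ..
qed

text \<open>
  That a word \<open>w\<close> lies in \<open>N\<close> is equivalent to the inconsistency of \<open>\<Gamma>\<close> with \<open>w \<noteq> 1\<close>, and that it
  does not is equivalent to the inconsistency of \<open>\<Gamma>\<close> with \<open>w = 1\<close>; the model \<open>M\<^sub>0\<close> prevents both from
  happening at once.  Inconsistency is witnessed by a refutation.
\<close>
theorem recursive_set_if_determined: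
  fixes M\<^sub>0 :: "nat monoid"
  assumes "enumerable \<Gamma>" and M\<^sub>0: "models M\<^sub>0 \<iota>\<^sub>0 \<Gamma>"
    and det: "\<And>(M :: nat monoid) \<iota>. models M \<iota> \<Gamma> \<Longrightarrow>
      {w \<in> words_over n. word_eval M \<iota> w = \<one>\<^bsub>M\<^esub>} = N"
  shows "recursive_set (word_code ` N)"
proof -
  obtain \<gamma> where \<gamma>: "computable \<gamma>" "form_code ` \<Gamma> = range \<gamma>"
    using assms(1) by (auto simp: enumerable_def)
  have enum: "(\<forall>j. clause_true \<alpha> (clause_enum \<gamma> n j)) \<longleftrightarrow>
      (\<forall>c\<in>base_clauses n. clause_true \<alpha> c) \<and> (\<forall>\<phi>\<in>\<Gamma>. \<alpha> (form_atom (form_code \<phi>) 0))" for \<alpha>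
  proof -
    have "(\<forall>j. clause_true \<alpha> (clause_enum \<gamma> n j)) \<longleftrightarrow>
        (\<forall>c\<in>base_clauses n \<union> theory_clause ` form_code ` \<Gamma>. clause_true \<alpha> c)"
      unfolding \<gamma>(2) range_clause_enum[symmetric] by blast
    then show ?thesis by (simp add: ball_Un theory_clause_def Let_def)
  qed
  have mem: "x \<in> word_code ` N \<longleftrightarrow> decode_word x \<in> N" for x
    by (metis decode_word_code word_code_decode image_iff)
  have sat: "(\<exists>\<alpha>. P (\<alpha> (word_atom x one_name)) \<and> (\<forall>j. clause_true \<alpha> (clause_enum \<gamma> n j))) \<longleftrightarrow>
      P (decode_word x \<in> N)" for P x
  proof -
    have "(\<exists>\<alpha>. P (\<alpha> (word_atom x one_name)) \<and> (\<forall>j. clause_true \<alpha> (clause_enum \<gamma> n j))) \<longleftrightarrow>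
        (\<exists>(M :: nat monoid) \<iota>. models M \<iota> \<Gamma> \<and>
          P (decode_word x \<in> words_over n \<and> word_eval M \<iota> (decode_word x) = \<one>\<^bsub>M\<^esub>))"
      using sat_clauses_iff_models[of n \<Gamma> "\<lambda>S. P (S (decode_word x))"]
      unfolding enum word_code_decode by (simp only: conj_ac)
    also have "\<dots> \<longleftrightarrow> (\<exists>(M :: nat monoid) \<iota>. models M \<iota> \<Gamma> \<and> P (decode_word x \<in> N))"
    proof (intro iff_exI conj_cong refl arg_cong[of _ _ P])
      fix M :: "nat monoid" and \<iota>
      assume "models M \<iota> \<Gamma>"
      from det[OF this] show "decode_word x \<in> words_over n \<and> word_eval M \<iota> (decode_word x) = \<one>\<^bsub>M\<^esub> \<longleftrightarrow>
          decode_word x \<in> N" by blast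
    qed
    also have "\<dots> \<longleftrightarrow> P (decode_word x \<in> N)"
      using M\<^sub>0 by blast
    finally show ?thesis .
  qed
  show ?thesis
  proof (rule recursive_set_if_both_enumerable)
    show "decidable (\<lambda>z. refutes \<gamma> n (Neg (word_atom (snd (prod_decode z)) one_name)) (fst (prod_decode z)))"
      unfolding code_defs by (intro decidable_refutes \<gamma>(1) computable_intros)
    show "decidable (\<lambda>z. refutes \<gamma> n (Pos (word_atom (snd (prod_decode z)) one_name)) (fst (prod_decode z)))"
      unfolding code_defs by (intro decidable_refutes \<gamma>(1) computable_intros)
    show "x \<in> word_code ` N \<longleftrightarrow> (\<exists>k. refutes \<gamma> n (Neg (word_atom x one_name)) k)" for x
      unfolding ex_refutes_iff mem using sat[of Not x] by simp
    show "x \<notin> word_code ` N \<longleftrightarrow> (\<exists>k. refutes \<gamma> n (Pos (word_atom x one_name)) k)" for x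
      unfolding ex_refutes_iff mem using sat[of "\<lambda>b. b" x] by simp
  qed
qed


section \<open>Invariance under isomorphism\<close>

lemma word_eval_cong:
  "w \<in> words_over n \<Longrightarrow> (\<And>i. i < n \<Longrightarrow> a i = b i) \<Longrightarrow> word_eval G a w = word_eval G b w"
  by (induction w) auto

lemma (in group_hom) hom_word_eval:
  assumes "w \<in> words_over n" "\<And>i. i < n \<Longrightarrow> a i \<in> carrier G"
  shows "h (word_eval G a w) = word_eval H (\<lambda>i. h (a i)) w"
  using assms(1)
proof (induction w)
  case (Cons x w)
  then show ?case
    using word_eval_closed[OF G.is_group assms(2), where w = w] assms(2) by (cases x) auto
qed simp

lemma ex_words_over: "\<exists>n. w \<in> words_over n"
proof (induction w)
  case (Cons x w)
  then obtain n where "w \<in> words_over n" by blast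
  then have "x # w \<in> words_over (max n (Suc (fst x)))"
    by (auto simp: words_over_def)
  then show ?case by blast
qed auto

text \<open>
  An isomorphism together with its inverse, in order that each implication below yields its
  converse by exchanging the two groups.
\<close>
locale group_iso = G: group G + H: group H
  for G :: "('a, 'b) monoid_scheme" and H :: "('c, 'd) monoid_scheme" +
  fixes f :: "'a \<Rightarrow> 'c" and g :: "'c \<Rightarrow> 'a"
  assumes f_closed [simp]: "x \<in> carrier G \<Longrightarrow> f x \<in> carrier H"
    and g_closed [simp]: "y \<in> carrier H \<Longrightarrow> g y \<in> carrier G"
    and g_f [simp]: "x \<in> carrier G \<Longrightarrow> g (f x) = x"
    and f_g [simp]: "y \<in> carrier H \<Longrightarrow> f (g y) = y"
    and f_mult: "x \<in> carrier G \<Longrightarrow> x' \<in> carrier G \<Longrightarrow> f (x \<otimes>\<^bsub>G\<^esub> x') = f x \<otimes>\<^bsub>H\<^esub> f x'"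
begin

lemma g_mult: "x \<in> carrier H \<Longrightarrow> y \<in> carrier H \<Longrightarrow> g (x \<otimes>\<^bsub>H\<^esub> y) = g x \<otimes>\<^bsub>G\<^esub> g y"
  using f_mult[of "g x" "g y"] g_f[of "g x \<otimes>\<^bsub>G\<^esub> g y"] by simp

sublocale f: group_hom G H f
  by unfold_locales (auto simp: hom_def f_mult)

sublocale g: group_hom H G g
  by unfold_locales (auto simp: hom_def g_mult)

lemma g_image: "g ` carrier H = carrier G"
  by (auto simp: image_iff) (metis f_closed g_f)

lemma f_image: "f ` carrier G = carrier H"
  by (auto simp: image_iff) (metis f_g g_closed)

lemma inj_on_g: "inj_on g (carrier H)"
  by (metis f_g inj_onI)

lemma subgroup_iso:
  assumes "subgroup K H"
  shows "subgroup (g ` K) G" "group_iso (G\<lparr>carrier := g ` K\<rparr>) (H\<lparr>carrier := K\<rparr>) f g"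
proof -
  show K: "subgroup (g ` K) G"
    using assms by (rule g.subgroup_img_is_subgroup)
  have mem: "y \<in> carrier H" if "y \<in> K" for y
    using assms that by (rule subgroup.mem_carrier)
  show "group_iso (G\<lparr>carrier := g ` K\<rparr>) (H\<lparr>carrier := K\<rparr>) f g"
  proof (intro group_iso.intro group_iso_axioms.intro)
    show "group (G\<lparr>carrier := g ` K\<rparr>)" using K G.subgroup_imp_group by blast
    show "group (H\<lparr>carrier := K\<rparr>)" using assms H.subgroup_imp_group by blast
  qed (auto simp: mem f_mult)
qed

lemma iso_g: "g \<in> iso H G"
  using g_image inj_on_g by (auto simp: iso_def bij_betw_def g.homh)

lemma amenable: "amenable G \<Longrightarrow> amenable H"
proof -
  assume "amenable G"
  then obtain \<mu> :: "'a set \<Rightarrow> real" where \<mu>: "\<mu> (carrier G) = 1"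
    "\<forall>A. A \<subseteq> carrier G \<longrightarrow> 0 \<le> \<mu> A"
    "\<forall>A B. A \<subseteq> carrier G \<longrightarrow> B \<subseteq> carrier G \<longrightarrow> A \<inter> B = {} \<longrightarrow> \<mu> (A \<union> B) = \<mu> A + \<mu> B"
    "\<forall>x\<in>carrier G. \<forall>A. A \<subseteq> carrier G \<longrightarrow> \<mu> (x <#\<^bsub>G\<^esub> A) = \<mu> A"
    unfolding amenable_def by (elim exE conjE)
  note \<mu> = \<mu>(1) \<mu>(2-)[rule_format]
  let ?\<mu> = "\<lambda>A. \<mu> (g ` A)"
  have sub: "g ` A \<subseteq> carrier G" if "A \<subseteq> carrier H" for A using that by auto
  have "?\<mu> (A \<union> B) = ?\<mu> A + ?\<mu> B" if "A \<subseteq> carrier H" "B \<subseteq> carrier H" "A \<inter> B = {}" for A B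
    using \<mu>(3)[OF sub sub, of A B] that inj_on_image_Int[OF inj_on_g, of A B]
    by (simp add: image_Un)
  moreover have "?\<mu> (x <#\<^bsub>H\<^esub> A) = ?\<mu> A" if "x \<in> carrier H" "A \<subseteq> carrier H" for x A
  proof -
    have "g ` (x <#\<^bsub>H\<^esub> A) = g x <#\<^bsub>G\<^esub> (g ` A)"
      using that by (auto simp: l_coset_def g_mult subset_eq image_iff)
    then show ?thesis using \<mu>(4)[of "g x" "g ` A"] that sub by simp
  qed
  ultimately show "amenable H"
    unfolding amenable_def using \<mu>(1,2) sub g_image by (intro exI[of _ ?\<mu>]) simp
qed

lemma no_free_subgroup: "no_free_subgroup G \<Longrightarrow> no_free_subgroup H"
  unfolding no_free_subgroup_def
proof (rule notI, elim exE conjE)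
  fix K
  assume G: "\<nexists>K. subgroup K G \<and> G\<lparr>carrier := K\<rparr> \<cong> free_group 2"
    and K: "subgroup K H" "H\<lparr>carrier := K\<rparr> \<cong> free_group 2"
  interpret K: group_iso "G\<lparr>carrier := g ` K\<rparr>" "H\<lparr>carrier := K\<rparr>" f g
    using K(1) by (rule subgroup_iso)
  have "H\<lparr>carrier := K\<rparr> \<cong> G\<lparr>carrier := g ` K\<rparr>"
    using K.iso_g by (rule is_isoI)
  then have "G\<lparr>carrier := g ` K\<rparr> \<cong> free_group 2"
    using K(2) iso_trans K.H.iso_sym by blast
  then show False using G subgroup_iso(1)[OF K(1)] by blast
qed

lemma invariant_order:
  assumes "linear_order_on (carrier G) r"
  defines "r' \<equiv> {(x, y) \<in> carrier H \<times> carrier H. (g x, g y) \<in> r}"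
  shows "linear_order_on (carrier H) r'"
    and "left_invariant G r \<Longrightarrow> left_invariant H r'"
    and "right_invariant G r \<Longrightarrow> right_invariant H r'"
proof -
  have r: "refl_on (carrier G) r" "trans r" "antisym r" "total_on (carrier G) r"
    using assms(1) by (auto simp: order_on_defs)
  have "refl_on (carrier H) r'"
    using r(1) by (auto simp: refl_on_def r'_def)
  moreover have "trans r'"
    using r(2) unfolding trans_def r'_def by blast
  moreover have "antisym r'"
    using r(3) inj_on_g unfolding antisym_def r'_def inj_on_def by blast
  moreover have "total_on (carrier H) r'"
  proof (rule total_onI)
    fix x y
    assume "x \<in> carrier H" "y \<in> carrier H" "x \<noteq> y"
    then show "(x, y) \<in> r' \<or> (y, x) \<in> r'"
      using r(4)[unfolded total_on_def, rule_format, of "g x" "g y"] inj_onD[OF inj_on_g, of x y]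
      by (auto simp: r'_def)
  qed
  ultimately show "linear_order_on (carrier H) r'"
    by (auto simp: order_on_defs r'_def)
  show "left_invariant G r \<Longrightarrow> left_invariant H r'" "right_invariant G r \<Longrightarrow> right_invariant H r'"
    by (auto simp: left_invariant_def right_invariant_def r'_def g_mult)
qed

lemma left_orderable: "left_orderable G \<Longrightarrow> left_orderable H"
  unfolding left_orderable_def using invariant_order by blast

lemma biorderable: "biorderable G \<Longrightarrow> biorderable H"
  unfolding biorderable_def using invariant_order by blast

lemma fin_gen: "fin_gen H \<Longrightarrow> fin_gen G"
proof -
  assume "fin_gen H"
  then obtain S where S: "finite S" "S \<subseteq> carrier H" "generate H S = carrier H"
    unfolding fin_gen_def by blast
  have "generate G (g ` S) = carrier G"
    using g.generate_img[OF S(2)] S(3) g_image by simp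
  then show "fin_gen G"
    unfolding fin_gen_def using S by (intro exI[of _ "g ` S"]) auto
qed

lemma epi_transfer: "h \<in> epi G Z \<Longrightarrow> h \<circ> g \<in> epi H Z"
  unfolding epi_def mem_Collect_eq image_comp[symmetric] g_image
  using hom_compose[OF g.homh] by blast

end

text \<open>
  Epimorphisms can be composed with isomorphisms, whereas quotient groups would have to be
  transported along with their carriers.
\<close>
lemma ex_quotient_iso_iff:
  assumes "group G" "group Z"
  shows "(\<exists>N. N \<lhd> G \<and> G Mod N \<cong> Z) \<longleftrightarrow> epi G Z \<noteq> {}"
proof
  assume "\<exists>N. N \<lhd> G \<and> G Mod N \<cong> Z"
  then obtain N h where N: "N \<lhd> G" and h: "h \<in> iso (G Mod N) Z"
    by (auto simp: is_iso_def)
  have "(\<lambda>a. N #>\<^bsub>G\<^esub> a) \<in> hom G (G Mod N)"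
    using N by (rule normal.r_coset_hom_Mod)
  then have "h \<circ> (\<lambda>a. N #>\<^bsub>G\<^esub> a) \<in> hom G Z"
    using h by (intro hom_compose) (auto simp: iso_def)
  moreover have "(\<lambda>a. N #>\<^bsub>G\<^esub> a) ` carrier G = carrier (G Mod N)"
    by (auto simp: FactGroup_def RCOSETS_def)
  then have "(h \<circ> (\<lambda>a. N #>\<^bsub>G\<^esub> a)) ` carrier G = carrier Z"
    using h unfolding image_comp[symmetric] by (simp add: iso_def bij_betw_def)
  ultimately show "epi G Z \<noteq> {}" unfolding epi_def by blast
next
  assume "epi G Z \<noteq> {}"
  then obtain h where h: "h \<in> hom G Z" "h ` carrier G = carrier Z" by (auto simp: epi_def)
  interpret group_hom G Z h
    using assms h by (simp add: group_hom_def group_hom_axioms_def)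
  show "\<exists>N. N \<lhd> G \<and> G Mod N \<cong> Z"
    using normal_kernel FactGroup_iso[OF h(2)] by blast
qed

context group_iso
begin

lemma locally_indicable: "locally_indicable G \<Longrightarrow> locally_indicable H"
  unfolding locally_indicable_def
proof (intro allI impI)
  fix K
  assume G: "\<forall>K. subgroup K G \<longrightarrow> K \<noteq> {\<one>\<^bsub>G\<^esub>} \<longrightarrow> fin_gen (G\<lparr>carrier := K\<rparr>) \<longrightarrow>
        (\<exists>N. N \<lhd> G\<lparr>carrier := K\<rparr> \<and> G\<lparr>carrier := K\<rparr> Mod N \<cong> integer_group)"
    and K: "subgroup K H" "K \<noteq> {\<one>\<^bsub>H\<^esub>}" "fin_gen (H\<lparr>carrier := K\<rparr>)"
  interpret K: group_iso "G\<lparr>carrier := g ` K\<rparr>" "H\<lparr>carrier := K\<rparr>" f g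
    using K(1) by (rule subgroup_iso)
  have "g ` K \<noteq> {\<one>\<^bsub>G\<^esub>}"
  proof
    assume "g ` K = {\<one>\<^bsub>G\<^esub>}"
    then have "f ` g ` K = {\<one>\<^bsub>H\<^esub>}" by simp
    moreover have "f ` g ` K = K"
      using subgroup.mem_carrier[OF K(1)] by (force simp: image_image)
    ultimately show False using K(2) by simp
  qed
  then have "\<exists>N. N \<lhd> G\<lparr>carrier := g ` K\<rparr> \<and> G\<lparr>carrier := g ` K\<rparr> Mod N \<cong> integer_group"
    using G subgroup_iso(1)[OF K(1)] K.fin_gen[OF K(3)] by blast
  then have "epi (G\<lparr>carrier := g ` K\<rparr>) integer_group \<noteq> {}"
    using ex_quotient_iso_iff[OF K.G.is_group group_integer_group] by blast
  then have "epi (H\<lparr>carrier := K\<rparr>) integer_group \<noteq> {}"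
    using K.epi_transfer by blast
  then show "\<exists>N. N \<lhd> H\<lparr>carrier := K\<rparr> \<and> H\<lparr>carrier := K\<rparr> Mod N \<cong> integer_group"
    using ex_quotient_iso_iff[OF K.H.is_group group_integer_group] by blast
qed

lemma unique_product: "unique_product G \<Longrightarrow> unique_product H"
  unfolding unique_product_def
proof (intro allI impI)
  fix X Y
  assume G: "\<forall>X Y. finite X \<longrightarrow> finite Y \<longrightarrow> X \<noteq> {} \<longrightarrow> Y \<noteq> {} \<longrightarrow> X \<subseteq> carrier G \<longrightarrow> Y \<subseteq> carrier G \<longrightarrow>
        (\<exists>c. \<exists>!p. p \<in> X \<times> Y \<and> fst p \<otimes>\<^bsub>G\<^esub> snd p = c)"
    and XY: "finite X" "finite Y" "X \<noteq> {}" "Y \<noteq> {}" "X \<subseteq> carrier H" "Y \<subseteq> carrier H"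
  have "\<exists>c. \<exists>!p. p \<in> g ` X \<times> g ` Y \<and> fst p \<otimes>\<^bsub>G\<^esub> snd p = c"
    by (rule G[rule_format]) (use XY in auto)
  then obtain c p where p: "p \<in> g ` X \<times> g ` Y" "fst p \<otimes>\<^bsub>G\<^esub> snd p = c"
    and unique: "\<And>q. q \<in> g ` X \<times> g ` Y \<and> fst q \<otimes>\<^bsub>G\<^esub> snd q = c \<Longrightarrow> q = p"
    by (elim exE ex1E) metis
  obtain x y where xy: "x \<in> X" "y \<in> Y" "p = (g x, g y)" using p(1) by auto
  have c: "c = g (x \<otimes>\<^bsub>H\<^esub> y)"
    using p(2) xy XY by (auto simp: g_mult subset_eq)
  have "q = (x, y)" if q: "q \<in> X \<times> Y" "fst q \<otimes>\<^bsub>H\<^esub> snd q = x \<otimes>\<^bsub>H\<^esub> y" for q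
  proof -
    have in_H: "fst q \<in> carrier H" "snd q \<in> carrier H" "x \<in> carrier H" "y \<in> carrier H"
      using q(1) xy XY by auto
    have "(g (fst q), g (snd q)) = p"
      using q in_H by (intro unique) (auto simp: c simp flip: g_mult)
    then show ?thesis
      using xy(3) in_H inj_on_g by (auto simp: inj_on_def prod_eq_iff)
  qed
  then show "\<exists>c. \<exists>!p. p \<in> X \<times> Y \<and> fst p \<otimes>\<^bsub>H\<^esub> snd p = c"
    using xy(1,2) by (intro exI[of _ "x \<otimes>\<^bsub>H\<^esub> y"] ex1I[of _ "(x, y)"]) auto
qed

lemma torsion_free: "torsion_free G \<Longrightarrow> torsion_free H"
  unfolding torsion_free_def
  by (metis f.hom_one f_g g.hom_nat_pow g.hom_one g_closed)

lemma sofic: "sofic G \<Longrightarrow> sofic H"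
  unfolding sofic_def
proof (intro allI impI)
  fix F and \<epsilon> :: real
  assume G: "\<forall>F \<epsilon>. finite F \<longrightarrow> F \<subseteq> carrier G \<longrightarrow> \<epsilon> > 0 \<longrightarrow>
        (\<exists>n \<phi>. n > 0 \<and> (\<forall>x\<in>carrier G. \<phi> x permutes {..<n}) \<and>
           (\<forall>x\<in>F. \<forall>y\<in>F. hamming n (\<phi> (x \<otimes>\<^bsub>G\<^esub> y)) (\<phi> x \<circ> \<phi> y) < \<epsilon>) \<and>
           (\<forall>x\<in>F. \<forall>y\<in>F. x \<noteq> y \<longrightarrow> hamming n (\<phi> x) (\<phi> y) > 1 - \<epsilon>))"
    and F: "finite F" "F \<subseteq> carrier H" "\<epsilon> > 0"
  have "g ` F \<subseteq> carrier G" using F by auto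
  then obtain n \<phi> where n: "n > 0" and \<phi>: "\<forall>x\<in>carrier G. \<phi> x permutes {..<n}"
    "\<forall>x\<in>g ` F. \<forall>y\<in>g ` F. hamming n (\<phi> (x \<otimes>\<^bsub>G\<^esub> y)) (\<phi> x \<circ> \<phi> y) < \<epsilon>"
    "\<forall>x\<in>g ` F. \<forall>y\<in>g ` F. x \<noteq> y \<longrightarrow> hamming n (\<phi> x) (\<phi> y) > 1 - \<epsilon>"
    using G[rule_format, of "g ` F" \<epsilon>] F by auto
  have "\<forall>x\<in>F. \<forall>y\<in>F. x \<noteq> y \<longrightarrow> g x \<noteq> g y"
    using F(2) inj_on_g by (auto simp: inj_on_def)
  then show "\<exists>n \<phi>. n > 0 \<and> (\<forall>x\<in>carrier H. \<phi> x permutes {..<n}) \<and>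
           (\<forall>x\<in>F. \<forall>y\<in>F. hamming n (\<phi> (x \<otimes>\<^bsub>H\<^esub> y)) (\<phi> x \<circ> \<phi> y) < \<epsilon>) \<and>
           (\<forall>x\<in>F. \<forall>y\<in>F. x \<noteq> y \<longrightarrow> hamming n (\<phi> x) (\<phi> y) > 1 - \<epsilon>)"
    using n \<phi> F(2) by (intro exI[of _ n] exI[of _ "\<phi> \<circ> g"]) (auto simp: g_mult subset_eq)
qed

lemma no_law: "no_law G \<Longrightarrow> no_law H"
  unfolding no_law_def
proof (intro allI impI)
  fix w
  assume G: "\<forall>w. reduced w \<longrightarrow> w \<noteq> [] \<longrightarrow> (\<exists>a. range a \<subseteq> carrier G \<and> word_eval G a w \<noteq> \<one>\<^bsub>G\<^esub>)"
    and w: "reduced w" "w \<noteq> []"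
  then obtain a where a: "range a \<subseteq> carrier G" "word_eval G a w \<noteq> \<one>\<^bsub>G\<^esub>" by blast
  obtain n where n: "w \<in> words_over n" using ex_words_over by blast
  have "word_eval H (\<lambda>i. f (a i)) w = f (word_eval G a w)"
    using f.hom_word_eval[OF n, of a] a(1) by (simp add: image_subset_iff)
  moreover have "word_eval G a w \<in> carrier G"
    using word_eval_closed[OF G.is_group _ n, where a = a] a(1) by (simp add: image_subset_iff)
  then have "f (word_eval G a w) \<noteq> \<one>\<^bsub>H\<^esub>"
    using a(2) g_f g.hom_one by metis
  ultimately show "\<exists>a. range a \<subseteq> carrier H \<and> word_eval H a w \<noteq> \<one>\<^bsub>H\<^esub>"
    using a(1) by (intro exI[of _ "\<lambda>i. f (a i)"]) auto
qed

lemma satisfies_imp: "satisfies G P \<Longrightarrow> satisfies H P"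
  by (cases P)
    (simp_all add: amenable no_free_subgroup left_orderable locally_indicable biorderable
      unique_product torsion_free sofic no_law)

lemma f_term_val: "range s \<subseteq> carrier G \<Longrightarrow> f (term_val G s t) = term_val H (f \<circ> s) t"
  by (induction t) (auto simp: f_mult G.term_val_closed)

lemma form_holds_iff:
  "range s \<subseteq> carrier G \<Longrightarrow> form_holds G s p \<longleftrightarrow> form_holds H (f \<circ> s) p"
proof (induction p arbitrary: s)
  case (FEq t u)
  have "f x = f y \<longleftrightarrow> x = y" if "x \<in> carrier G" "y \<in> carrier G" for x y
    using that by (metis g_f)
  from this[OF G.term_val_closed[OF FEq] G.term_val_closed[OF FEq]] show ?case
    unfolding form_holds.simps f_term_val[OF FEq, symmetric] by (rule sym)
next
  case (FAll i p)
  have "form_holds G (s(i := x)) p \<longleftrightarrow> form_holds H ((f \<circ> s)(i := f x)) p" if "x \<in> carrier G" for x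
  proof -
    have "range (s(i := x)) \<subseteq> carrier G" using FAll.prems that by auto
    from FAll.IH[OF this] show ?thesis by (simp only: fun_upd_comp)
  qed
  then show ?case by (simp add: comp_def flip: f_image)
qed auto

lemma is_model_imp: "is_model G T \<Longrightarrow> is_model H T"
  unfolding is_model_def
proof (intro ballI allI impI)
  fix p and s :: "nat \<Rightarrow> 'c"
  assume G: "\<forall>p\<in>T. \<forall>s. range s \<subseteq> carrier G \<longrightarrow> form_holds G s p" and p: "p \<in> T"
    and s: "range s \<subseteq> carrier H"
  have gs: "range (g \<circ> s) \<subseteq> carrier G" using s by auto
  then have "form_holds G (g \<circ> s) p" using G p by blast
  moreover have "f \<circ> (g \<circ> s) = s" using s by (simp add: fun_eq_iff image_subset_iff)
  ultimately show "form_holds H s p" using form_holds_iff[OF gs] by simp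
qed

lemma swap: "group_iso H G g f"
  by unfold_locales (auto simp: g_mult)

end

lemma satisfies_iso: "group_iso G H f g \<Longrightarrow> satisfies G P \<longleftrightarrow> satisfies H P"
  by (metis group_iso.satisfies_imp group_iso.swap)

lemma is_model_iso: "group_iso G H f g \<Longrightarrow> is_model G T \<longleftrightarrow> is_model H T"
  by (metis group_iso.is_model_imp group_iso.swap)

lemma group_iso_if_iso:
  assumes "group G" "group H" "f \<in> iso G H"
  shows "group_iso G H f (inv_into (carrier G) f)"
proof -
  interpret G: group G by fact
  interpret H: group H by fact
  have f: "f \<in> hom G H" "inj_on f (carrier G)" "f ` carrier G = carrier H"
    using assms(3) by (auto simp: iso_def bij_betw_def)
  then show ?thesis
    by unfold_locales (auto simp: hom_def inv_into_into f_inv_into_f)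
qed

definition image_group :: "('a \<Rightarrow> 'c) \<Rightarrow> ('a, 'b) monoid_scheme \<Rightarrow> 'c monoid" where
  "image_group f G = \<lparr>carrier = f ` carrier G,
     monoid.mult = (\<lambda>x y. f (inv_into (carrier G) f x \<otimes>\<^bsub>G\<^esub> inv_into (carrier G) f y)),
     one = f \<one>\<^bsub>G\<^esub>\<rparr>"

lemma group_iso_image_group:
  assumes "group G" "inj_on f (carrier G)"
  shows "group_iso G (image_group f G) f (inv_into (carrier G) f)"
proof -
  interpret G: group G by fact
  have "group (image_group f G)"
  proof (rule groupI)
    fix x
    assume "x \<in> carrier (image_group f G)"
    then obtain a where "a \<in> carrier G" "x = f a" by (auto simp: image_group_def)
    then show "\<exists>y\<in>carrier (image_group f G). y \<otimes>\<^bsub>image_group f G\<^esub> x = \<one>\<^bsub>image_group f G\<^esub>"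
      using assms(2) by (intro bexI[of _ "f (inv\<^bsub>G\<^esub> a)"]) (auto simp: image_group_def)
  qed (use assms(2) in \<open>auto simp: image_group_def G.m_assoc\<close>)
  then interpret H: group "image_group f G" .
  show ?thesis
    by unfold_locales (use assms(2) in \<open>auto simp: image_group_def\<close>)
qed

section \<open>Transfer of axiomatizability and closure to countable groups\<close>

text \<open>
  Every group over \<open>nat\<close> has an isomorphic copy over the infinite type \<open>'u\<close>, which satisfies the same
  sentences and has the same properties.
\<close>
lemma recursively_axiomatizable_nat:
  assumes "infinite (UNIV :: 'u set)" "recursively_axiomatizable TYPE('u) P"
  shows "recursively_axiomatizable TYPE(nat) P"
proof -
  obtain j :: "nat \<Rightarrow> 'u" where "inj j"
    using assms(1) infinite_countable_subset by blast
  then have iso: "group_iso G (image_group j G) j (inv_into (carrier G) j)" if "group G" for G :: "nat monoid"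
    using that by (intro group_iso_image_group) (auto intro: inj_on_subset)
  obtain T where T: "recursive_set (form_code ` T)" "\<forall>p\<in>T. sentence p"
    "\<And>G :: 'u monoid. group G \<Longrightarrow> satisfies G P \<longleftrightarrow> is_model G T"
    using assms(2) unfolding recursively_axiomatizable_def by blast
  have "satisfies G P \<longleftrightarrow> is_model G T" if "group G" for G :: "nat monoid"
    using satisfies_iso[OF iso[OF that]] is_model_iso[OF iso[OF that]] T(3)[of "image_group j G"]
      iso[OF that] by (auto simp: group_iso_def)
  then show ?thesis
    unfolding recursively_axiomatizable_def using T(1,2) by blast
qed

lemma closed_under_subgroups_nat:
  assumes "infinite (UNIV :: 'u set)" "closed_under_subgroups TYPE('u) P"
  shows "closed_under_subgroups TYPE(nat) P"
  unfolding closed_under_subgroups_def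
proof (intro allI impI)
  fix G :: "nat monoid" and K
  assume G: "group G" "satisfies G P" and K: "subgroup K G"
  obtain j :: "nat \<Rightarrow> 'u" where "inj j"
    using assms(1) infinite_countable_subset by blast
  then interpret group_iso G "image_group j G" j "inv_into (carrier G) j"
    using G(1) by (intro group_iso_image_group) (auto intro: inj_on_subset)
  interpret swap: group_iso "image_group j G" G "inv_into (carrier G) j" j
    by (rule swap)
  have "satisfies ((image_group j G)\<lparr>carrier := j ` K\<rparr>) P"
    using assms(2) satisfies_imp[OF G(2)] swap.subgroup_iso(1)[OF K] H.is_group
    unfolding closed_under_subgroups_def by blast
  then show "satisfies (G\<lparr>carrier := K\<rparr>) P"
    using satisfies_iso[OF swap.subgroup_iso(2)[OF K]] by blast
qed


section \<open>The topology of the space of enumerated groups\<close>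

lemma euclidean_discrete: "(euclidean :: 'a::discrete_topology topology) = discrete_topology UNIV"
  by (simp add: topology_eq open_discrete)

lemma completely_metrizable_nat: "completely_metrizable_space (euclidean :: nat topology)"
  by (simp add: euclidean_discrete completely_metrizable_space_discrete_topology)

lemma completely_metrizable_nat_fun:
  "completely_metrizable_space (euclidean :: ('i::countable \<Rightarrow> nat) topology)"
  unfolding euclidean_product_topology[symmetric] completely_metrizable_space_product_topology
  using completely_metrizable_nat by simp

lemma completely_metrizable_enum_structure:
  "completely_metrizable_space (euclidean :: enum_structure topology)"
  unfolding prod_topology_euclidean[symmetric] completely_metrizable_space_prod_topology
  by (intro disjI2 conjI completely_metrizable_nat completely_metrizable_nat_fun)

text \<open>
  Continuity of functions with discrete values.
\<close>
definition locally_constant :: "(enum_structure \<Rightarrow> nat) \<Rightarrow> bool" where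
  "locally_constant F \<longleftrightarrow> (\<forall>v. open {g. F g = v})"

lemma locally_constant_const: "locally_constant (\<lambda>_. c)"
  by (simp add: locally_constant_def)

lemma continuous_locally_constant: "continuous_on UNIV F \<Longrightarrow> locally_constant F"
  unfolding locally_constant_def
  using open_vimage[of "{_}" F] by (auto simp: vimage_def open_discrete)

lemma locally_constant_one: "locally_constant (\<lambda>g. snd (snd g))"
  by (intro continuous_locally_constant continuous_on_snd continuous_on_id)

lemma locally_constant_mult:
  assumes "locally_constant F" "locally_constant F'"
  shows "locally_constant (\<lambda>g. fst g (F g, F' g))"
proof -
  have c: "locally_constant (\<lambda>g. fst g p)" for p
    by (rule continuous_locally_constant, rule continuous_on_compose2[OF continuous_on_product_coordinates])
      (intro continuous_on_fst continuous_on_id subset_UNIV)+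
  have "{g. fst g (F g, F' g) = v} =
      (\<Union>a b. {g. F g = a} \<inter> {g. F' g = b} \<inter> {g. fst g (a, b) = v})" for v by auto
  then show ?thesis
    using assms c unfolding locally_constant_def by (auto intro!: open_UN open_Int)
qed

lemma locally_constant_inv:
  assumes "locally_constant F"
  shows "locally_constant (\<lambda>g. fst (snd g) (F g))"
proof -
  have c: "locally_constant (\<lambda>g. fst (snd g) p)" for p
    by (rule continuous_locally_constant, rule continuous_on_compose2[OF continuous_on_product_coordinates])
      (intro continuous_on_fst continuous_on_snd continuous_on_id subset_UNIV)+
  have "{g. fst (snd g) (F g) = v} = (\<Union>a. {g. F g = a} \<inter> {g. fst (snd g) a = v})" for v by auto
  then show ?thesis
    using assms c unfolding locally_constant_def by (auto intro!: open_UN open_Int)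
qed

lemma open_eq_locally_constant:
  assumes "locally_constant F" "locally_constant F'"
  shows "open {g. F g = F' g}"
proof -
  have "{g. F g = F' g} = (\<Union>a. {g. F g = a} \<inter> {g. F' g = a})" by auto
  then show ?thesis
    using assms unfolding locally_constant_def by (auto intro!: open_UN open_Int)
qed

lemma closed_eq_locally_constant:
  assumes "locally_constant F" "locally_constant F'"
  shows "closed {g. F g = F' g}"
proof -
  have "- {g. F g = F' g} = (\<Union>a. \<Union>b\<in>- {a}. {g. F g = a} \<inter> {g. F' g = b})" by auto
  then show ?thesis
    using assms unfolding locally_constant_def closed_def by (auto intro!: open_UN open_Int)
qed

lemmas locally_constant_intros = locally_constant_const locally_constant_one locally_constant_mult
  locally_constant_inv

lemma group_of_simps [simp]:
  "carrier (group_of g) = UNIV" "x \<otimes>\<^bsub>group_of g\<^esub> y = fst g (x, y)" "\<one>\<^bsub>group_of g\<^esub> = snd (snd g)"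
  by (auto simp: group_of_def split: prod.splits)

lemma group_group_of: "g \<in> enumerated_groups \<Longrightarrow> group (group_of g)"
  by (auto simp: enumerated_groups_def)

lemma inv_group_of: "g \<in> enumerated_groups \<Longrightarrow> inv\<^bsub>group_of g\<^esub> x = fst (snd g) x"
  using group.inv_equality[OF group_group_of, of g "fst (snd g) x" x]
  by (auto simp: enumerated_groups_def)

text \<open>
  Since inversion and the neutral element are part of the structure, the axioms are equations, each
  of which defines a closed set.
\<close>
lemma mem_enumerated_groups_iff:
  "g \<in> enumerated_groups \<longleftrightarrow>
    (\<forall>x y z. fst g (fst g (x, y), z) = fst g (x, fst g (y, z))) \<and>
    (\<forall>x. fst g (snd (snd g), x) = x) \<and>
    (\<forall>x. fst g (x, fst (snd g) x) = snd (snd g)) \<and> (\<forall>x. fst g (fst (snd g) x, x) = snd (snd g))"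
proof
  assume g: "g \<in> enumerated_groups"
  interpret group "group_of g" using g by (rule group_group_of)
  show "(\<forall>x y z. fst g (fst g (x, y), z) = fst g (x, fst g (y, z))) \<and>
    (\<forall>x. fst g (snd (snd g), x) = x) \<and>
    (\<forall>x. fst g (x, fst (snd g) x) = snd (snd g)) \<and> (\<forall>x. fst g (fst (snd g) x, x) = snd (snd g))"
    using g m_assoc l_one by (auto simp: enumerated_groups_def)
next
  assume g: "(\<forall>x y z. fst g (fst g (x, y), z) = fst g (x, fst g (y, z))) \<and>
    (\<forall>x. fst g (snd (snd g), x) = x) \<and>
    (\<forall>x. fst g (x, fst (snd g) x) = snd (snd g)) \<and> (\<forall>x. fst g (fst (snd g) x, x) = snd (snd g))"
  have "group (group_of g)"
  proof (rule groupI)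
    fix x
    show "\<exists>y\<in>carrier (group_of g). y \<otimes>\<^bsub>group_of g\<^esub> x = \<one>\<^bsub>group_of g\<^esub>"
      using g by (intro bexI[of _ "fst (snd g) x"]) (simp_all only: group_of_simps UNIV_I)
  qed (use g in \<open>simp_all only: group_of_simps UNIV_I\<close>)
  then show "g \<in> enumerated_groups"
    using g by (cases g) (auto simp: enumerated_groups_def)
qed

lemma closed_enumerated_groups: "closed enumerated_groups"
proof -
  have "enumerated_groups =
    (\<Inter>x y z. {g. fst g (fst g (x, y), z) = fst g (x, fst g (y, z))}) \<inter>
    (\<Inter>x. {g. fst g (snd (snd g), x) = x}) \<inter>
    (\<Inter>x. {g. fst g (x, fst (snd g) x) = snd (snd g)}) \<inter>
    (\<Inter>x. {g. fst g (fst (snd g) x, x) = snd (snd g)})"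
    by (simp only: set_eq_iff mem_enumerated_groups_iff Int_iff INT_iff mem_Collect_eq UNIV_I
        simp_thms ball_UNIV conj_assoc)
  then show ?thesis
    by (rule ssubst) (intro closed_INT closed_Int ballI closed_eq_locally_constant locally_constant_intros)
qed

text \<open>
  The value of a word in terms of the three components of a structure.  In contrast to \<open>word_eval\<close>,
  which involves the inverse that is defined from the multiplication, it depends on finitely many
  entries of the structure in an obvious way.
\<close>

fun word_value :: "(nat \<Rightarrow> nat) \<Rightarrow> word \<Rightarrow> enum_structure \<Rightarrow> nat" where
  "word_value a [] g = snd (snd g)"
| "word_value a ((i, b) # w) g =
    fst g (if b then fst (snd g) (a i) else a i, word_value a w g)"

lemma word_value_eq:
  "g \<in> enumerated_groups \<Longrightarrow> word_eval (group_of g) a w = word_value a w g"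
proof (induction w)
  case (Cons x w)
  then show ?case by (cases x) (simp add: inv_group_of)
qed simp

lemma locally_constant_word_value: "locally_constant (word_value a w)"
proof (induction w)
  case Nil
  show ?case using locally_constant_one by (simp add: locally_constant_def)
next
  case (Cons x w)
  obtain i b where x: "x = (i, b)" by (cases x)
  have "locally_constant (\<lambda>g. if b then fst (snd g) (a i) else a i)"
    by (cases b) (simp_all add: locally_constant_intros)
  from locally_constant_mult[OF this Cons]
  have "locally_constant (\<lambda>g. word_value a (x # w) g)" by (simp add: x)
  then show ?case .
qed

text \<open>
  Restrictions on the multiplication alone are sufficient to define a basis of neighbourhoods of a
  group, because they determine its neutral element and its inverses, see \<open>open_contains_agree\<close>.
\<close>
definition agree :: "nat \<Rightarrow> enum_structure \<Rightarrow> enum_structure set" where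
  "agree r g = {g'. \<forall>x<r. \<forall>y<r. fst g' (x, y) = fst g (x, y)}"

lemma open_agree: "open (agree r g)"
proof -
  have "agree r g = (\<Inter>x\<in>{..<r}. \<Inter>y\<in>{..<r}. {g'. fst g' (x, y) = fst g (x, y)})"
    by (auto simp: agree_def)
  then show ?thesis
    by (auto intro!: open_INT open_eq_locally_constant locally_constant_intros)
qed

lemma open_fun_contains_cylinder:
  fixes A :: "('a \<Rightarrow> nat) set"
  assumes "open A" "m \<in> A"
  obtains F where "finite F" "\<And>m'. (\<And>x. x \<in> F \<Longrightarrow> m' x = m x) \<Longrightarrow> m' \<in> A"
proof -
  obtain X where X: "m \<in> (\<Pi>\<^sub>E i\<in>UNIV. X i)" "finite {i. X i \<noteq> UNIV}" "(\<Pi>\<^sub>E i\<in>UNIV. X i) \<subseteq> A"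
    using product_topology_open_contains_basis[of "\<lambda>_. euclidean" UNIV A m] assms
    by (auto simp: open_fun_def)
  have "m' \<in> A" if "\<And>x. x \<in> {i. X i \<noteq> UNIV} \<Longrightarrow> m' x = m x" for m'
  proof -
    have "m' x \<in> X x" for x
      using that[of x] X(1) by (cases "X x = UNIV") (auto simp: PiE_def Pi_def)
    then show ?thesis using X(3) by (auto simp: PiE_def)
  qed
  with X(2) that show ?thesis by blast
qed

lemma open_contains_agree:
  assumes "open U" "g \<in> U" "g \<in> enumerated_groups"
  obtains r where "agree r g \<inter> enumerated_groups \<subseteq> U"
proof -
  obtain m i e where g: "g = (m, i, e)" by (cases g)
  obtain A B where AB: "open A" "open B" "g \<in> A \<times> B" "A \<times> B \<subseteq> U"
    by (rule open_prod_elim[OF assms(1,2)])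
  have mem: "m \<in> A" "(i, e) \<in> B" using AB(3) by (auto simp: g)
  obtain I E where IE: "open I" "open E" "(i, e) \<in> I \<times> E" "I \<times> E \<subseteq> B"
    by (rule open_prod_elim[OF AB(2) mem(2)])
  have mem': "i \<in> I" "e \<in> E" using IE(3) by auto
  obtain F where F: "finite F" "\<And>m'. (\<And>x. x \<in> F \<Longrightarrow> m' x = m x) \<Longrightarrow> m' \<in> A"
    using open_fun_contains_cylinder[OF AB(1) mem(1)] by blast
  obtain F' where F': "finite F'" "\<And>i'. (\<And>x. x \<in> F' \<Longrightarrow> i' x = i x) \<Longrightarrow> i' \<in> I"
    using open_fun_contains_cylinder[OF IE(1) mem'(1)] by blast
  have "finite (fst ` F \<union> snd ` F \<union> F' \<union> i ` F' \<union> {e})"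
    using F F' by auto
  then obtain r where r: "\<forall>x \<in> fst ` F \<union> snd ` F \<union> F' \<union> i ` F' \<union> {e}. x < r"
    using finite_nat_set_iff_bounded by blast
  have "g' \<in> U" if g': "g' \<in> agree r g" "g' \<in> enumerated_groups" for g'
  proof -
    obtain m' i' e' where g'': "g' = (m', i', e')" by (cases g')
    have m': "m' (x, y) = m (x, y)" if "x < r" "y < r" for x y
      using g'(1) that by (simp add: agree_def g g'')
    interpret G: group "group_of g" using assms(3) by (rule group_group_of)
    interpret G': group "group_of g'" using g'(2) by (rule group_group_of)
    have "e' = e"
    proof -
      \<comment> \<open>the neutral element is the only idempotent of a group\<close>
      have "m (e, e) = e" using G.r_one[of e] by (simp add: g)
      then have "m' (e, e) = e" using m' r by simp
      then show ?thesis using G'.r_cancel_one[of e e] by (simp add: g'')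
    qed
    moreover have "i' x = i x" if "x \<in> F'" for x
    proof -
      have "m (x, i x) = e" using assms(3) by (simp add: enumerated_groups_def g)
      then have "m' (x, i x) = e'" using m' r that \<open>e' = e\<close> by simp
      moreover have "m' (x, i' x) = e'" using g'(2) by (simp add: enumerated_groups_def g'')
      moreover have "x \<in> Units (group_of g')" by (simp add: G'.Units_eq)
      ultimately show ?thesis using G'.Units_l_cancel[of x "i' x" "i x"] by (simp add: g'')
    qed
    then have "i' \<in> I" by (rule F'(2))
    moreover have "m' x = m x" if "x \<in> F" for x
    proof -
      have "fst x < r" "snd x < r" using r that by auto
      from m'[OF this] show ?thesis by simp
    qed
    then have "m' \<in> A" by (rule F(2))
    ultimately show ?thesis using AB(4) IE(4) mem'(2) by (auto simp: g'')
  qed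
  then show thesis using that[of r] by blast
qed

section \<open>The groups with an axiomatizable hereditary property form a closed subspace\<close>

definition prod_form :: "nat \<Rightarrow> nat \<Rightarrow> nat \<Rightarrow> grp_form" where
  "prod_form x y z = FEq (TMul (TVar x) (TVar y)) (TVar z)"

definition neq_form :: "nat \<Rightarrow> nat \<Rightarrow> grp_form" where
  "neq_form x y = FImp (FEq (TVar x) (TVar y)) FBot"

lemma form_holds_simps [simp]:
  "form_holds M s (prod_form x y z) \<longleftrightarrow> s x \<otimes>\<^bsub>M\<^esub> s y = s z"
  "form_holds M s (neq_form x y) \<longleftrightarrow> s x \<noteq> s y"
  by (auto simp: prod_form_def neq_form_def)

lemma term_val_cong: "(\<And>i. i \<in> term_vars t \<Longrightarrow> s i = s' i) \<Longrightarrow> term_val G s t = term_val G s' t"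
  by (induction t) auto

lemma form_holds_cong:
  "(\<And>i. i \<in> free_vars p \<Longrightarrow> s i = s' i) \<Longrightarrow> form_holds G s p \<longleftrightarrow> form_holds G s' p"
proof (induction p arbitrary: s s')
  case (FEq t u)
  then show ?case using term_val_cong[of t s s' G] term_val_cong[of u s s' G] by simp
next
  case (FImp p q)
  have "form_holds G s p \<longleftrightarrow> form_holds G s' p" "form_holds G s q \<longleftrightarrow> form_holds G s' q"
    using FImp.prems by (intro FImp.IH; simp)+
  then show ?case by simp
next
  case (FAll i p)
  have "form_holds G (s(i := x)) p \<longleftrightarrow> form_holds G (s'(i := x)) p" for x
    using FAll.prems by (intro FAll.IH) auto
  then show ?case by simp
qed auto

lemma is_model_if_sentences:
  fixes M :: "('a, 'b) monoid_scheme"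
  assumes "\<forall>p\<in>T. sentence p" "models M \<iota> T"
  shows "is_model M T"
  unfolding is_model_def
proof (intro ballI allI impI)
  fix p and s :: "nat \<Rightarrow> 'a"
  assume "p \<in> T" "range s \<subseteq> carrier M"
  moreover have "form_holds M s p \<longleftrightarrow> form_holds M \<iota> p"
    using assms(1) \<open>p \<in> T\<close> by (intro form_holds_cong) (auto simp: sentence_def)
  ultimately show "form_holds M s p"
    using assms(2) by (auto simp: models_def)
qed

definition groups_with :: "group_property \<Rightarrow> enum_structure set" where
  "groups_with P = {g \<in> enumerated_groups. satisfies (group_of g) P}"

lemma satisfies_if_embeds:
  assumes P: "closed_under_subgroups TYPE(nat) P" "satisfies (M :: nat monoid) P"
    and G: "group (G :: nat monoid)" and M: "group M" and h: "h \<in> mon G M"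
  shows "satisfies G P"
proof -
  have h: "h \<in> hom G M" "inj_on h (carrier G)" using h by (auto simp: mon_def)
  interpret group_hom G M h
    using G M h(1) by (simp add: group_hom_def group_hom_axioms_def)
  have K: "subgroup (h ` carrier G) M" by (rule img_is_subgroup)
  then have grp: "group (M\<lparr>carrier := h ` carrier G\<rparr>)" using H.subgroup_imp_group by blast
  have "h \<in> iso G (M\<lparr>carrier := h ` carrier G\<rparr>)"
    using h(2) by (intro isoI homI) (simp_all add: bij_betw_def)
  from satisfies_iso[OF group_iso_if_iso[OF G grp this]]
  show ?thesis
    using P K M unfolding closed_under_subgroups_def by blast
qed

text \<open>
  Let \<open>g\<close> be a limit of groups with \<open>P\<close>.  Each finite part of its multiplication table occurs in a
  group with \<open>P\<close>, hence by compactness a countable group with \<open>P\<close> realizes the entire table, and \<open>g\<close>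
  is isomorphic to a subgroup of it.
\<close>
lemma closed_groups_with:
  assumes ax: "recursively_axiomatizable TYPE(nat) P" and sub: "closed_under_subgroups TYPE(nat) P"
  shows "closed (groups_with P)"
proof -
  obtain T where T: "\<forall>p\<in>T. sentence p"
    "\<And>G :: nat monoid. group G \<Longrightarrow> satisfies G P \<longleftrightarrow> is_model G T"
    using ax unfolding recursively_axiomatizable_def by blast
  have "g \<in> groups_with P" if "g \<in> closure (groups_with P)" for g
  proof -
    have "groups_with P \<subseteq> enumerated_groups" by (auto simp: groups_with_def)
    then have "g \<in> enumerated_groups"
      using that closure_minimal[OF _ closed_enumerated_groups] by blast
    have near: "\<exists>g'. g' \<in> agree r g \<inter> groups_with P" for r
    proof -
      have "g \<in> agree r g" by (simp add: agree_def)
      then show ?thesis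
        using that open_Int_closure_eq_empty[OF open_agree, of r g "groups_with P"] by blast
    qed
    let ?D = "range (\<lambda>(x, y). prod_form x y (fst g (x, y))) \<union> {neq_form x y | x y. x \<noteq> y}"
    have "\<exists>(M :: nat monoid) \<iota>. models M \<iota> (T \<union> ?D)"
    proof (rule models_compactness)
      fix \<Delta>
      assume \<Delta>: "finite \<Delta>" "\<Delta> \<subseteq> T \<union> ?D"
      then have "finite (\<Delta> \<inter> range (\<lambda>(x, y). prod_form x y (fst g (x, y))))"
        "\<Delta> \<inter> range (\<lambda>(x, y). prod_form x y (fst g (x, y))) \<subseteq> range (\<lambda>(x, y). prod_form x y (fst g (x, y)))"
        by auto
      from finite_subset_image[OF this] obtain F where F: "finite F"
        "\<Delta> \<inter> range (\<lambda>(x, y). prod_form x y (fst g (x, y))) = (\<lambda>(x, y). prod_form x y (fst g (x, y))) ` F"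
        by blast
      have "finite (fst ` F \<union> snd ` F)" using F by auto
      then obtain r where r: "\<forall>x \<in> fst ` F \<union> snd ` F. x < r"
        using finite_nat_set_iff_bounded by blast
      obtain g' where g': "g' \<in> agree r g" "g' \<in> groups_with P"
        using near by blast
      then have grp: "group (group_of g')" "is_model (group_of g') T"
        using T(2) by (auto simp: groups_with_def group_group_of)
      have "form_holds (group_of g') id \<phi>" if \<phi>: "\<phi> \<in> \<Delta>" for \<phi>
      proof -
        consider "\<phi> \<in> T" | "\<phi> \<in> range (\<lambda>(x, y). prod_form x y (fst g (x, y)))"
          | x y where "\<phi> = neq_form x y" "x \<noteq> y"
          using \<Delta>(2) \<phi> by blast
        then show ?thesis
        proof cases
          case 1
          then show ?thesis using grp(2) by (auto simp: is_model_def)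
        next
          case 2
          then have "\<phi> \<in> (\<lambda>(x, y). prod_form x y (fst g (x, y))) ` F"
            using F(2) \<phi> by blast
          then obtain x y where xy: "(x, y) \<in> F" "\<phi> = prod_form x y (fst g (x, y))"
            by auto
          then have "x < r" "y < r" using r by force+
          then show ?thesis using g'(1) by (simp add: xy agree_def)
        qed simp
      qed
      then have "models (group_of g') id \<Delta>"
        using grp by (simp add: models_def)
      then show "\<exists>(M :: nat monoid) \<iota>. models M \<iota> \<Delta>" by blast
    qed
    then obtain M :: "nat monoid" and \<iota> where M: "models M \<iota> (T \<union> ?D)" by blast
    then have grp: "group M" and \<iota>: "range \<iota> \<subseteq> carrier M" and "models M \<iota> T"
      by (auto simp: models_def)
    then have "satisfies M P"
      using T is_model_if_sentences by blast
    have "\<iota> x \<otimes>\<^bsub>M\<^esub> \<iota> y = \<iota> (fst g (x, y))" for x y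
    proof -
      have "prod_form x y (fst g (x, y)) \<in> ?D" by force
      then have "form_holds M \<iota> (prod_form x y (fst g (x, y)))"
        using M unfolding models_def by blast
      then show ?thesis by simp
    qed
    moreover have "\<iota> x \<noteq> \<iota> y" if "x \<noteq> y" for x y
    proof -
      have "neq_form x y \<in> ?D" using that by auto
      then have "form_holds M \<iota> (neq_form x y)"
        using M unfolding models_def by blast
      then show ?thesis by simp
    qed
    ultimately have "\<iota> \<in> mon (group_of g) M"
      using \<iota> by (auto simp: mon_def hom_def inj_on_def)
    then have "satisfies (group_of g) P"
      using satisfies_if_embeds[OF sub \<open>satisfies M P\<close> _ grp] group_group_of \<open>g \<in> enumerated_groups\<close>
      by blast
    then show ?thesis using \<open>g \<in> enumerated_groups\<close> by (simp add: groups_with_def)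
  qed
  then show ?thesis by (meson closure_subset_eq subsetI)
qed


section \<open>Finitely presented groups and words\<close>

lemma carrier_free_group: "w \<in> carrier (free_group n) \<longleftrightarrow> w \<in> words_over n \<and> reduced w"
  by (simp add: free_group_def)

lemma (in group) word_eval_push:
  assumes a: "\<And>i. i < n \<Longrightarrow> a i \<in> carrier G" and "x # w \<in> words_over n"
  shows "word_eval G a (push x w) = word_eval G a (x # w)"
proof (cases w)
  case (Cons y v)
  show ?thesis
  proof (cases "y = flip x")
    case True
    obtain i b where x: "x = (i, b)" by (cases x)
    have "i < n" "v \<in> words_over n" using assms(2) Cons by (auto simp: x)
    then have "a i \<in> carrier G" "word_eval G a v \<in> carrier G"
      using a word_eval_closed[OF is_group a] by auto
    then show ?thesis
      using True by (cases b) (simp_all add: Cons x flip_def inv_solve_left' flip: m_assoc)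
  qed (simp add: Cons)
qed simp

lemma (in group) word_eval_foldr_push:
  assumes a: "\<And>i. i < n \<Longrightarrow> a i \<in> carrier G" and "u \<in> words_over n" "w \<in> words_over n"
  shows "word_eval G a (foldr push u w) = word_eval G a u \<otimes> word_eval G a w"
  using assms(2)
proof (induction u)
  case Nil
  show ?case using word_eval_closed[OF is_group a assms(3)] by simp
next
  case (Cons x u)
  obtain i b where x: "x = (i, b)" by (cases x)
  have u: "i < n" "u \<in> words_over n" using Cons.prems by (auto simp: x)
  then have "x # foldr push u w \<in> words_over n"
    using foldr_words_over assms(3) by (simp add: x)
  from word_eval_push[OF a this]
  have "word_eval G a (foldr push (x # u) w) = word_eval G a (x # foldr push u w)" by simp
  also have "\<dots> = word_eval G a (x # u) \<otimes> word_eval G a w"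
    using Cons.IH[OF u(2)] a[OF u(1)] word_eval_closed[OF is_group a assms(3)]
      word_eval_closed[OF is_group a u(2)]
    by (cases b) (simp_all add: x m_assoc)
  finally show ?case .
qed

lemma (in group) word_eval_hom:
  assumes a: "\<And>i. i < n \<Longrightarrow> a i \<in> carrier G"
  shows "word_eval G a \<in> hom (free_group n) G"
proof (rule homI)
  fix u w
  assume u: "u \<in> carrier (free_group n)"
  then show "word_eval G a u \<in> carrier G"
    using word_eval_closed[OF is_group a] by (simp add: carrier_free_group)
  assume w: "w \<in> carrier (free_group n)"
  show "word_eval G a (u \<otimes>\<^bsub>free_group n\<^esub> w) = word_eval G a u \<otimes> word_eval G a w"
    using word_eval_foldr_push[OF a, where u = u and w = w] u w
    by (simp add: carrier_free_group) (simp add: free_group_def)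
qed

lemma hom_free_group_eq_word_eval:
  assumes "group G" "\<psi> \<in> hom (free_group n) G" "w \<in> carrier (free_group n)"
  shows "\<psi> w = word_eval G (\<lambda>i. \<psi> [(i, False)]) w"
proof -
  interpret group_hom "free_group n" G \<psi>
    using assms group_free_group by (simp add: group_hom_def group_hom_axioms_def)
  have "w \<in> words_over n \<Longrightarrow> reduced w \<Longrightarrow> ?thesis"
  proof (induction w)
    case Nil
    show ?case using hom_one by (simp add: free_group_def)
  next
    case (Cons x w)
    obtain i b where x: "x = (i, b)" by (cases x)
    have i: "i < n" and w: "w \<in> carrier (free_group n)"
      using Cons.prems by (auto simp: x carrier_free_group reduced_Cons)
    have gen: "[(i, b)] \<in> carrier (free_group n)" for b
      using i by (simp add: carrier_free_group reduced_def)
    have "[(i, True)] \<otimes>\<^bsub>free_group n\<^esub> [(i, False)] = \<one>\<^bsub>free_group n\<^esub>"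
      by (simp add: free_group_def flip_def)
    from G.inv_equality[OF this gen gen]
    have inv: "\<psi> [(i, True)] = inv\<^bsub>G\<^esub> (\<psi> [(i, False)])"
      using hom_inv[OF gen, of False] by simp
    have "[x] \<otimes>\<^bsub>free_group n\<^esub> w = x # w"
      using Cons.prems by (cases w) (auto simp: free_group_def reduced_Cons)
    then have "\<psi> (x # w) = \<psi> [x] \<otimes>\<^bsub>G\<^esub> \<psi> w"
      using hom_mult[OF gen[of b] w] by (simp add: x)
    also have "\<psi> w = word_eval G (\<lambda>i. \<psi> [(i, False)]) w"
      using Cons w by (simp add: carrier_free_group)
    finally show ?case by (cases b) (simp_all add: x inv)
  qed
  then show ?thesis using assms(3) by (simp add: carrier_free_group)
qed

lemma (in group) normal_closure_normal:
  assumes "R \<subseteq> carrier G"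
  shows "normal_closure G R \<lhd> G"
proof -
  have "carrier G \<lhd> G" using normal_inv_iff subgroup_self by auto
  then have ne: "{N. N \<lhd> G \<and> R \<subseteq> N} \<noteq> {}" using assms by blast
  then have "subgroup (normal_closure G R) G"
    unfolding normal_closure_def by (intro subgroups_Inter) (auto intro: normal_imp_subgroup)
  moreover have "x \<otimes> h \<otimes> inv x \<in> normal_closure G R"
    if "x \<in> carrier G" "h \<in> normal_closure G R" for x h
    using that unfolding normal_closure_def by (auto dest: normal.inv_op_closed2)
  ultimately show ?thesis by (simp add: normal_inv_iff)
qed

lemma finitely_presented_epi:
  assumes "finitely_presented G"
  obtains n R \<pi> where "finite R" "R \<subseteq> carrier (free_group n)" "\<pi> \<in> epi (free_group n) G"
    "\<And>w. w \<in> carrier (free_group n) \<Longrightarrow> \<pi> w = \<one>\<^bsub>G\<^esub> \<longleftrightarrow> w \<in> normal_closure (free_group n) R"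
proof -
  obtain n R where R: "finite R" "R \<subseteq> carrier (free_group n)"
    and iso: "G \<cong> free_group n Mod normal_closure (free_group n) R" and "group G"
    using assms unfolding finitely_presented_def by blast
  let ?F = "free_group n" and ?N = "normal_closure (free_group n) R"
  interpret F: group ?F by (rule group_free_group)
  interpret N: normal ?N ?F using R(2) by (rule F.normal_closure_normal)
  obtain \<theta> where \<theta>: "\<theta> \<in> iso (?F Mod ?N) G"
    using group.iso_sym[OF \<open>group G\<close> iso] by (auto simp: is_iso_def)
  interpret G: group G by fact
  interpret \<theta>: group_hom "?F Mod ?N" G \<theta>
    using \<theta> N.factorgroup_is_group \<open>group G\<close> by (simp add: group_hom_def group_hom_axioms_def iso_def)
  have inj: "inj_on \<theta> (carrier (?F Mod ?N))" and surj: "\<theta> ` carrier (?F Mod ?N) = carrier G"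
    using \<theta> by (auto simp: iso_def bij_betw_def)
  let ?\<pi> = "\<lambda>w. \<theta> (?N #>\<^bsub>?F\<^esub> w)"
  have c: "?N #>\<^bsub>?F\<^esub> w \<in> carrier (?F Mod ?N)" if "w \<in> carrier ?F" for w
    using that by (auto simp: FactGroup_def RCOSETS_def)
  have "?\<pi> \<in> hom ?F G"
    using hom_compose[OF N.r_coset_hom_Mod \<theta>.homh] by (simp add: comp_def)
  moreover have "?\<pi> ` carrier ?F = carrier G"
  proof -
    have "(\<lambda>w. ?N #>\<^bsub>?F\<^esub> w) ` carrier ?F = carrier (?F Mod ?N)"
      by (auto simp: FactGroup_def RCOSETS_def)
    then show ?thesis using surj by (metis image_image)
  qed
  moreover have "?\<pi> w = \<one>\<^bsub>G\<^esub> \<longleftrightarrow> w \<in> ?N" if w: "w \<in> carrier ?F" for w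
  proof -
    have "?\<pi> w = \<one>\<^bsub>G\<^esub> \<longleftrightarrow> ?N #>\<^bsub>?F\<^esub> w = \<one>\<^bsub>?F Mod ?N\<^esub>"
      using inj_on_eq_iff[OF inj c[OF w] \<theta>.G.one_closed] \<theta>.hom_one by simp
    also have "\<dots> \<longleftrightarrow> w \<in> ?N"
      using F.coset_join1[OF _ w N.subgroup_axioms] N.rcos_const[OF F.is_group]
      by (auto simp: FactGroup_def)
    finally show ?thesis .
  qed
  ultimately show thesis using that[of R n ?\<pi>] R by (simp add: epi_def)
qed

lemma (in group) word_eval_image_generate:
  assumes a: "\<And>i. i < n \<Longrightarrow> a i \<in> carrier G"
  shows "word_eval G a ` carrier (free_group n) = generate G (a ` {..<n})"
proof
  interpret h: group_hom "free_group n" G "word_eval G a"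
    using word_eval_hom[OF a] group_free_group is_group by (simp add: group_hom_def group_hom_axioms_def)
  have sub: "a ` {..<n} \<subseteq> carrier G" using a by auto
  have mem: "a i \<in> generate G (a ` {..<n})" if "i < n" for i
    using that by (intro generate.incl) auto
  interpret S: subgroup "generate G (a ` {..<n})" G
    using generate_is_subgroup[OF sub] .
  have "w \<in> words_over n \<Longrightarrow> word_eval G a w \<in> generate G (a ` {..<n})" for w
  proof (induction w)
    case (Cons x w)
    then show ?case using mem by (cases x) auto
  qed auto
  then show "word_eval G a ` carrier (free_group n) \<subseteq> generate G (a ` {..<n})"
    by (auto simp: carrier_free_group)
  have "a i \<in> word_eval G a ` carrier (free_group n)" if "i < n" for i
    using that a by (intro image_eqI[of _ _ "[(i, False)]"]) (auto simp: carrier_free_group reduced_def)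
  then show "generate G (a ` {..<n}) \<subseteq> word_eval G a ` carrier (free_group n)"
    by (intro generate_subgroup_incl h.img_is_subgroup) auto
qed

definition word_kernel :: "('a, 'b) monoid_scheme \<Rightarrow> (nat \<Rightarrow> 'a) \<Rightarrow> nat \<Rightarrow> word set" where
  "word_kernel G a n = {w \<in> words_over n. word_eval G a w = \<one>\<^bsub>G\<^esub>}"

lemma word_kernel_hom:
  assumes "group G" "group H" "h \<in> mon G H" "\<And>i. i < n \<Longrightarrow> a i \<in> carrier G"
  shows "word_kernel H (\<lambda>i. h (a i)) n = word_kernel G a n"
proof -
  interpret group_hom G H h
    using assms by (simp add: group_hom_def group_hom_axioms_def mon_def)
  have "word_eval H (\<lambda>i. h (a i)) w = \<one>\<^bsub>H\<^esub> \<longleftrightarrow> word_eval G a w = \<one>\<^bsub>G\<^esub>" if "w \<in> words_over n" for w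
  proof -
    have "word_eval G a w \<in> carrier G"
      using word_eval_closed[OF assms(1) assms(4) that] .
    moreover have "inj_on h (carrier G)"
      using assms(3) by (simp add: mon_def)
    ultimately have "h (word_eval G a w) = h \<one>\<^bsub>G\<^esub> \<longleftrightarrow> word_eval G a w = \<one>\<^bsub>G\<^esub>"
      by (intro inj_on_eq_iff) auto
    then show ?thesis
      using hom_word_eval[OF that assms(4)] by simp
  qed
  then show ?thesis by (auto simp: word_kernel_def)
qed

text \<open>The tuple satisfies the relators and keeps the marked words apart.\<close>

text \<open>
  The condition on a tuple that expresses the data of strong undecidability: a tuple that satisfies
  it is the same as a homomorphism from the finitely presented group with the relators \<open>R\<close> that is
  injective on the elements given by the words \<open>W\<close>.
\<close>
definition marked_tuple :: "word set \<Rightarrow> word set \<Rightarrow> ('a, 'b) monoid_scheme \<Rightarrow> (nat \<Rightarrow> 'a) \<Rightarrow> bool" where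
  "marked_tuple R W G a \<longleftrightarrow> (\<forall>w\<in>R. word_eval G a w = \<one>\<^bsub>G\<^esub>) \<and> inj_on (word_eval G a) W"

text \<open>
  Von Dyck's theorem: the evaluation homomorphism of the tuple kills the relators, hence their
  normal closure, and therefore factors through the presented group.
\<close>
lemma (in group) epi_of_marked_tuple:
  fixes F :: "('c, 'd) monoid_scheme"
  assumes \<pi>: "\<pi> \<in> epi (free_group n) F" and "group F"
    and ker: "\<And>w. w \<in> carrier (free_group n) \<Longrightarrow> \<pi> w = \<one>\<^bsub>F\<^esub> \<longleftrightarrow> w \<in> normal_closure (free_group n) R"
    and R: "R \<subseteq> carrier (free_group n)" and W: "W \<subseteq> carrier (free_group n)"
    and a: "\<And>i. i < n \<Longrightarrow> a i \<in> carrier G" and marked: "marked_tuple R W G a"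
  shows "\<exists>\<phi>\<in>epi F (G\<lparr>carrier := generate G (a ` {..<n})\<rparr>). inj_on \<phi> (\<pi> ` W)"
proof -
  let ?F = "free_group n" and ?e = "word_eval G a"
  interpret P: group_hom ?F F \<pi>
    using \<pi> \<open>group F\<close> group_free_group by (simp add: group_hom_def group_hom_axioms_def epi_def)
  interpret e: group_hom ?F G ?e
    using word_eval_hom[OF a] group_free_group is_group by (simp add: group_hom_def group_hom_axioms_def)
  have surj: "\<pi> ` carrier ?F = carrier F" using \<pi> by (simp add: epi_def)
  have "R \<subseteq> kernel ?F G ?e"
    using R marked by (auto simp: kernel_def marked_tuple_def)
  then have NK: "normal_closure ?F R \<subseteq> kernel ?F G ?e"
    using e.normal_kernel unfolding normal_closure_def by blast
  have factor: "?e u = ?e v" if u: "u \<in> carrier ?F" and v: "v \<in> carrier ?F" and "\<pi> u = \<pi> v" for u v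
  proof -
    have "\<pi> (u \<otimes>\<^bsub>?F\<^esub> inv\<^bsub>?F\<^esub> v) = \<one>\<^bsub>F\<^esub>"
      using that by simp
    then have "u \<otimes>\<^bsub>?F\<^esub> inv\<^bsub>?F\<^esub> v \<in> kernel ?F G ?e"
      using ker[of "u \<otimes>\<^bsub>?F\<^esub> inv\<^bsub>?F\<^esub> v"] NK u v by auto
    then have "?e u \<otimes> inv (?e v) = \<one>"
      using u v by (simp add: kernel_def)
    then show ?thesis
      using u v by (metis e.hom_closed inv_closed inv_equality inv_inv)
  qed
  define \<phi> where "\<phi> x = ?e (SOME w. w \<in> carrier ?F \<and> \<pi> w = x)" for x
  have \<phi>: "\<phi> (\<pi> w) = ?e w" if w: "w \<in> carrier ?F" for w
  proof -
    have "(SOME v. v \<in> carrier ?F \<and> \<pi> v = \<pi> w) \<in> carrier ?F \<and>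
        \<pi> (SOME v. v \<in> carrier ?F \<and> \<pi> v = \<pi> w) = \<pi> w"
      by (rule someI_ex) (use w in blast)
    then show ?thesis
      unfolding \<phi>_def using factor[OF _ w] by blast
  qed
  have "\<phi> ` carrier F = (\<lambda>w. \<phi> (\<pi> w)) ` carrier ?F"
    unfolding surj[symmetric] by (rule image_image)
  also have "\<dots> = ?e ` carrier ?F"
    by (intro image_cong refl \<phi>)
  also have "\<dots> = generate G (a ` {..<n})"
    using a by (rule word_eval_image_generate)
  finally have img: "\<phi> ` carrier F = generate G (a ` {..<n})" .
  have "\<phi> \<in> epi F (G\<lparr>carrier := generate G (a ` {..<n})\<rparr>)"
  proof -
    have "\<phi> (x \<otimes>\<^bsub>F\<^esub> y) = \<phi> x \<otimes> \<phi> y" if xy: "x \<in> carrier F" "y \<in> carrier F" for x y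
    proof -
      have "x \<in> \<pi> ` carrier ?F" "y \<in> \<pi> ` carrier ?F" using xy surj by simp_all
      then obtain u v where uv: "u \<in> carrier ?F" "v \<in> carrier ?F" "x = \<pi> u" "y = \<pi> v"
        by (elim imageE)
      have uv': "u \<otimes>\<^bsub>?F\<^esub> v \<in> carrier ?F" using uv by simp
      have "x \<otimes>\<^bsub>F\<^esub> y = \<pi> (u \<otimes>\<^bsub>?F\<^esub> v)" using uv by simp
      then have "\<phi> (x \<otimes>\<^bsub>F\<^esub> y) = ?e (u \<otimes>\<^bsub>?F\<^esub> v)" by (simp only: \<phi>[OF uv'])
      then show ?thesis using uv by (simp add: \<phi>)
    qed
    moreover have "\<phi> x \<in> generate G (a ` {..<n})" if "x \<in> carrier F" for x
      using that img by blast
    ultimately show ?thesis using img by (simp add: epi_def hom_def)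
  qed
  moreover have "inj_on \<phi> (\<pi> ` W)"
  proof (rule inj_onI)
    fix x y
    assume "x \<in> \<pi> ` W" "y \<in> \<pi> ` W" "\<phi> x = \<phi> y"
    then obtain u v where uv: "u \<in> W" "v \<in> W" "x = \<pi> u" "y = \<pi> v" by blast
    then have "?e u = ?e v" using \<open>\<phi> x = \<phi> y\<close> \<phi> W by (metis subsetD)
    then have "u = v" using marked uv by (auto simp: marked_tuple_def inj_on_def)
    then show "x = y" using uv by simp
  qed
  ultimately show ?thesis by blast
qed

text \<open>
  Evaluation in the generated subgroup and in the group have the same kernel.
\<close>
lemma (in group) solvable_word_problem_generate:
  assumes a: "\<And>i. i < n \<Longrightarrow> a i \<in> carrier G" and rec: "recursive_set (word_code ` word_kernel G a n)"
  shows "solvable_word_problem (G\<lparr>carrier := generate G (a ` {..<n})\<rparr>)"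
proof -
  let ?S = "generate G (a ` {..<n})" and ?gs = "map a [0..<n]"
  have sub: "a ` {..<n} \<subseteq> carrier G" using a by auto
  have S: "subgroup ?S G" using generate_is_subgroup[OF sub] .
  have incl: "a ` {..<n} \<subseteq> ?S" by (auto intro: generate.incl)
  have grp: "group (G\<lparr>carrier := ?S\<rparr>)" using S subgroup_imp_group by blast
  have "id \<in> mon (G\<lparr>carrier := ?S\<rparr>) G"
    using subgroup.subset[OF S] by (auto simp: mon_def hom_def)
  from word_kernel_hom[OF grp is_group this, of n a]
  have "word_kernel (G\<lparr>carrier := ?S\<rparr>) a n = word_kernel G a n"
    using incl by auto
  moreover have "word_kernel (G\<lparr>carrier := ?S\<rparr>) (\<lambda>i. ?gs ! i) n = word_kernel (G\<lparr>carrier := ?S\<rparr>) a n"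
    unfolding word_kernel_def
    by (intro Collect_cong conj_cong refl arg_cong2[of _ _ _ _ "(=)"] word_eval_cong[of _ n]) auto
  ultimately have "recursive_set (word_code ` word_kernel (G\<lparr>carrier := ?S\<rparr>) (\<lambda>i. ?gs ! i) n)"
    using rec by simp
  moreover have "generate (G\<lparr>carrier := ?S\<rparr>) (a ` {..<n}) = ?S"
    using generate_consistent[OF incl S] by simp
  ultimately show ?thesis
    unfolding solvable_word_problem_def word_kernel_def
    using incl by (intro exI[of _ ?gs]) (simp add: atLeast0LessThan)
qed

text \<open>
  Strong undecidability without reference to presentations.  The words \<open>W\<close> are chosen preimages of
  the elements of the finite set \<open>X\<close> on which the epimorphisms are required to be injective.
\<close>
lemma strongly_undecidable_tuples:
  assumes "strongly_undecidable P"
  obtains n R W where "finite R" "R \<subseteq> words_over n" "finite W" "W \<subseteq> words_over n"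
    "\<exists>(H :: nat monoid) a. group H \<and> satisfies H P \<and> (\<forall>i<n. a i \<in> carrier H) \<and>
       generate H (a ` {..<n}) = carrier H \<and> marked_tuple R W H a"
    "\<And>(H :: nat monoid) a. group H \<Longrightarrow> (\<And>i. i < n \<Longrightarrow> a i \<in> carrier H) \<Longrightarrow>
       satisfies (H\<lparr>carrier := generate H (a ` {..<n})\<rparr>) P \<Longrightarrow> marked_tuple R W H a \<Longrightarrow>
       \<not> recursive_set (word_code ` word_kernel H a n)"
proof -
  obtain G :: "nat monoid" and X where G: "finitely_presented G" and X: "finite X" "X \<subseteq> carrier G"
    and ex: "\<exists>H :: nat monoid. group H \<and> satisfies H P \<and> (\<exists>\<phi>\<in>epi G H. inj_on \<phi> X)"
    and unsolv: "\<forall>H :: nat monoid. group H \<longrightarrow> satisfies H P \<longrightarrow> (\<exists>\<phi>\<in>epi G H. inj_on \<phi> X) \<longrightarrow>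
           \<not> solvable_word_problem H"
    using assms unfolding strongly_undecidable_def by blast
  have "group G" using G by (simp add: finitely_presented_def)
  obtain n R \<pi> where R: "finite R" "R \<subseteq> carrier (free_group n)" and \<pi>: "\<pi> \<in> epi (free_group n) G"
    and ker: "\<And>w. w \<in> carrier (free_group n) \<Longrightarrow> \<pi> w = \<one>\<^bsub>G\<^esub> \<longleftrightarrow> w \<in> normal_closure (free_group n) R"
    by (rule finitely_presented_epi[OF G]) (rule that)
  have "X \<subseteq> \<pi> ` carrier (free_group n)" using \<pi> X by (simp add: epi_def)
  then obtain W where W: "W \<subseteq> carrier (free_group n)" "inj_on \<pi> W" "X = \<pi> ` W"
    unfolding subset_image_inj by blast
  show thesis
  proof (rule that[of R n W])
    show "finite R" "R \<subseteq> words_over n" using R by (auto simp: carrier_free_group)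
    show "finite W" using W(2,3) X(1) finite_imageD by blast
    show "W \<subseteq> words_over n" using W(1) by (auto simp: carrier_free_group)
    show "\<exists>(H :: nat monoid) a. group H \<and> satisfies H P \<and> (\<forall>i<n. a i \<in> carrier H) \<and>
       generate H (a ` {..<n}) = carrier H \<and> marked_tuple R W H a"
    proof -
      obtain H :: "nat monoid" and \<phi> where H: "group H" "satisfies H P" and \<phi>: "\<phi> \<in> epi G H" "inj_on \<phi> X"
        using ex by blast
      interpret H: group H by fact
      let ?a = "\<lambda>i. \<phi> (\<pi> [(i, False)])"
      have hom: "\<phi> \<circ> \<pi> \<in> hom (free_group n) H"
        using \<phi> \<pi> by (intro hom_compose[of \<pi> _ G]) (auto simp: epi_def)
      have eval: "word_eval H ?a w = \<phi> (\<pi> w)" if "w \<in> carrier (free_group n)" for w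
        using hom_free_group_eq_word_eval[OF H(1) hom that] by simp
      have a: "?a i \<in> carrier H" if "i < n" for i
        using hom_in_carrier[OF hom, of "[(i, False)]"] that by (simp add: carrier_free_group reduced_def)
      have "(\<phi> \<circ> \<pi>) ` carrier (free_group n) = word_eval H ?a ` carrier (free_group n)"
        by (intro image_cong refl) (simp only: eval comp_apply)
      also have "\<dots> = generate H (?a ` {..<n})"
        by (rule H.word_eval_image_generate[OF a])
      finally have "generate H (?a ` {..<n}) = (\<phi> \<circ> \<pi>) ` carrier (free_group n)" ..
      also have "\<dots> = carrier H"
        using \<phi>(1) \<pi> unfolding image_comp[symmetric] by (simp add: epi_def)
      finally have gen: "generate H (?a ` {..<n}) = carrier H" .
      have "\<phi> (\<pi> w) = \<one>\<^bsub>H\<^esub>" if "w \<in> R" for w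
      proof -
        have "w \<in> normal_closure (free_group n) R" using that by (auto simp: normal_closure_def)
        then have "\<pi> w = \<one>\<^bsub>G\<^esub>" using ker R(2) that by blast
        then show ?thesis
          using hom_one[OF _ \<open>group G\<close> H(1)] \<phi>(1) by (simp add: epi_def)
      qed
      then have "\<forall>w\<in>R. word_eval H ?a w = \<one>\<^bsub>H\<^esub>"
        using subsetD[OF R(2)] by (simp add: eval)
      moreover have "inj_on (word_eval H ?a) W"
      proof -
        have "inj_on (word_eval H ?a) W \<longleftrightarrow> inj_on (\<phi> \<circ> \<pi>) W"
          using subsetD[OF W(1)] by (intro inj_on_cong) (simp add: eval)
        then show ?thesis using comp_inj_on[OF W(2)] \<phi>(2) W(3) by simp
      qed
      ultimately have marked: "marked_tuple R W H ?a"
        unfolding marked_tuple_def by (rule conjI)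
      show ?thesis
        by (rule exI[of _ H], rule exI[of _ ?a]) (use H a gen marked in simp)
    qed
    fix H :: "nat monoid" and a
    assume H: "group H" "\<And>i. i < n \<Longrightarrow> a i \<in> carrier H"
      "satisfies (H\<lparr>carrier := generate H (a ` {..<n})\<rparr>) P" "marked_tuple R W H a"
    interpret H: group H by fact
    have "a ` {..<n} \<subseteq> carrier H" using H(2) by auto
    then have "group (H\<lparr>carrier := generate H (a ` {..<n})\<rparr>)"
      using H.generate_is_subgroup H.subgroup_imp_group by blast
    then have "\<not> solvable_word_problem (H\<lparr>carrier := generate H (a ` {..<n})\<rparr>)"
      using unsolv H(3) H.epi_of_marked_tuple[OF \<pi> \<open>group G\<close> ker R(2) W(1) H(2,4)] W(3) by blast
    moreover have "solvable_word_problem (H\<lparr>carrier := generate H (a ` {..<n})\<rparr>)"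
      if "recursive_set (word_code ` word_kernel H a n)"
      using H(2) that by (rule H.solvable_word_problem_generate)
    ultimately show "\<not> recursive_set (word_code ` word_kernel H a n)" by blast
  qed
qed


section \<open>Enumerable theories\<close>

text \<open>
  An enumerable theory is nonempty, because it is the range of a function on the natural numbers.
  The trivial sentence is added where this could fail.
\<close>
definition triv_form :: grp_form where "triv_form = FEq TOne TOne"

lemma form_holds_triv_form [simp]: "form_holds M s triv_form"
  by (simp add: triv_form_def)

definition eq_form :: "nat \<Rightarrow> nat \<Rightarrow> grp_form" where "eq_form x y = FEq (TVar x) (TVar y)"

lemma form_holds_eq_form [simp]: "form_holds M s (eq_form x y) \<longleftrightarrow> s x = s y"
  by (simp add: eq_form_def)

lemma enumerableI:
  "computable (\<lambda>j. form_code (\<Phi> j)) \<Longrightarrow> \<Gamma> = range \<Phi> \<Longrightarrow> enumerable \<Gamma>"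
  unfolding enumerable_def by (intro exI[of _ "\<lambda>j. form_code (\<Phi> j)"]) (simp add: image_image)

lemma enumerable_Un:
  assumes "enumerable \<Gamma>" "enumerable \<Delta>"
  shows "enumerable (\<Gamma> \<union> \<Delta>)"
proof -
  obtain \<gamma> \<delta> where \<gamma>: "computable \<gamma>" "form_code ` \<Gamma> = range \<gamma>"
    and \<delta>: "computable \<delta>" "form_code ` \<Delta> = range \<delta>"
    using assms unfolding enumerable_def by blast
  let ?f = "\<lambda>j. if odd j then \<gamma> (j div 2) else \<delta> (j div 2)"
  have "computable ?f"
    by (intro computable_if computable_comp[OF \<gamma>(1)] computable_comp[OF \<delta>(1)] computable_intros)
  moreover have "range ?f = range \<gamma> \<union> range \<delta>"
  proof
    show "range \<gamma> \<union> range \<delta> \<subseteq> range ?f"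
    proof
      fix x
      assume "x \<in> range \<gamma> \<union> range \<delta>"
      then consider i where "x = \<gamma> i" | i where "x = \<delta> i" by blast
      then show "x \<in> range ?f"
      proof cases
        case (1 i)
        then have "x = ?f (2 * i + 1)" by simp
        then show ?thesis by (rule range_eqI)
      next
        case (2 i)
        then have "x = ?f (2 * i)" by simp
        then show ?thesis by (rule range_eqI)
      qed
    qed
  qed auto
  ultimately show ?thesis
    unfolding enumerable_def image_Un \<gamma>(2) \<delta>(2) by metis
qed

lemma enumerable_finite:
  assumes "finite \<Gamma>" "\<Gamma> \<noteq> {}"
  shows "enumerable \<Gamma>"
proof -
  obtain \<phi>s where \<phi>s: "set \<phi>s = \<Gamma>" using assms(1) finite_list by blast
  then have "\<phi>s \<noteq> []" using assms(2) by auto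
  let ?\<Phi> = "\<lambda>j. if j < length \<phi>s then \<phi>s ! j else hd \<phi>s"
  have "(\<lambda>j. form_code (?\<Phi> j)) =
      (\<lambda>j. if j < length (map form_code \<phi>s) then map form_code \<phi>s ! j else form_code (hd \<phi>s))"
    by auto
  then have "computable (\<lambda>j. form_code (?\<Phi> j))"
    using computable_finite_table by metis
  moreover have "\<Gamma> = range ?\<Phi>"
  proof
    show "\<Gamma> \<subseteq> range ?\<Phi>"
    proof
      fix \<phi>
      assume "\<phi> \<in> \<Gamma>"
      then obtain j where "j < length \<phi>s" "\<phi> = \<phi>s ! j"
        using \<phi>s by (auto simp: in_set_conv_nth)
      then have "\<phi> = ?\<Phi> j" by simp
      then show "\<phi> \<in> range ?\<Phi>" by (rule range_eqI)
    qed
    show "range ?\<Phi> \<subseteq> \<Gamma>"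
      using \<phi>s \<open>\<phi>s \<noteq> []\<close> by auto
  qed
  ultimately show ?thesis by (rule enumerableI)
qed

lemma enumerable_recursive:
  assumes "recursive_set (form_code ` T)"
  shows "enumerable (insert triv_form T)"
proof -
  let ?f = "\<lambda>x. if x \<in> form_code ` T then x else form_code triv_form"
  have "computable ?f"
    by (intro computable_if decidable_if_recursive_set[OF assms] computable_id computable_const)
  moreover have "form_code ` insert triv_form T = range ?f"
  proof -
    have "form_code triv_form \<in> range ?f"
      by (rule range_eqI[of _ _ "form_code triv_form"]) simp
    moreover have "form_code \<phi> \<in> range ?f" if "\<phi> \<in> T" for \<phi>
      using that by (intro range_eqI[of _ _ "form_code \<phi>"]) simp
    ultimately show ?thesis by auto
  qed
  ultimately show ?thesis unfolding enumerable_def by blast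
qed

text \<open>
  In a model of this theory the variables from \<open>n\<close> on have distinct values; in particular the model
  is infinite.
\<close>
lemma enumerable_distinct:
  "enumerable (insert triv_form {neq_form (n + x) (n + y) | x y. x \<noteq> y})"
proof (rule enumerableI)
  let ?\<Phi> = "\<lambda>j. if fst (prod_decode j) = snd (prod_decode j) then triv_form
    else neq_form (n + fst (prod_decode j)) (n + snd (prod_decode j))"
  have "computable (\<lambda>j. if fst (prod_decode j) = snd (prod_decode j) then form_code triv_form
    else form_code (neq_form (n + fst (prod_decode j)) (n + snd (prod_decode j))))"
    unfolding neq_form_def form_code.simps term_code.simps by (intro computable_intros)
  then show "computable (\<lambda>j. form_code (?\<Phi> j))" by (simp only: if_distrib[of form_code])
  show "insert triv_form {neq_form (n + x) (n + y) | x y. x \<noteq> y} = range ?\<Phi>"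
  proof
    have "triv_form = ?\<Phi> (prod_encode (0, 0))" by simp
    then have "triv_form \<in> range ?\<Phi>" by (rule range_eqI)
    moreover have "neq_form (n + x) (n + y) \<in> range ?\<Phi>" if "x \<noteq> y" for x y
      by (rule range_eqI[of _ _ "prod_encode (x, y)"]) (simp add: that)
    ultimately show "insert triv_form {neq_form (n + x) (n + y) | x y. x \<noteq> y} \<subseteq> range ?\<Phi>" by auto
  qed auto
qed

section \<open>Finite groups\<close>

text \<open>
  The variables from \<open>n\<close> on name the elements of \<open>H\<close>, and the first \<open>n\<close> variables the tuple.  Every
  model of the finite multiplication table of \<open>H\<close>, including the inequalities, contains a copy of \<open>H\<close>,
  so the table determines which words are trivial.
\<close>
lemma recursive_word_kernel_if_finite:
  fixes H :: "nat monoid"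
  assumes "group H" and fin: "finite (carrier H)" and a: "\<And>i. i < n \<Longrightarrow> a i \<in> carrier H"
  shows "recursive_set (word_code ` word_kernel H a n)"
proof -
  interpret H: group H by fact
  let ?\<Gamma> = "(\<lambda>(x, y). prod_form (n + x) (n + y) (n + x \<otimes>\<^bsub>H\<^esub> y)) ` (carrier H \<times> carrier H)
    \<union> (\<lambda>(x, y). neq_form (n + x) (n + y)) ` {(x, y) \<in> carrier H \<times> carrier H. x \<noteq> y}
    \<union> (\<lambda>i. eq_form i (n + a i)) ` {..<n}"
  let ?\<iota> = "\<lambda>i. if i < n then a i else if i - n \<in> carrier H then i - n else \<one>\<^bsub>H\<^esub>"
  have "finite ?\<Gamma>"
    using fin by (intro finite_UnI finite_imageI finite_cartesian_product
        finite_subset[of "{(x, y) \<in> carrier H \<times> carrier H. x \<noteq> y}" "carrier H \<times> carrier H"]) auto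
  moreover have "?\<Gamma> \<noteq> {}" using H.one_closed by blast
  ultimately have "enumerable ?\<Gamma>" by (rule enumerable_finite)
  moreover have "models H ?\<iota> ?\<Gamma>"
    using a H.is_group by (auto simp: models_def)
  moreover have "word_kernel M \<iota> n = word_kernel H a n"
    if M: "models M \<iota> ?\<Gamma>" for M :: "nat monoid" and \<iota>
  proof -
    note M' = M[unfolded models_def]
    have grp: "group M" using M' by (rule conjunct1)
    have \<iota>: "range \<iota> \<subseteq> carrier M" using M'[THEN conjunct2] by (rule conjunct1)
    note forms = M'[THEN conjunct2, THEN conjunct2, THEN bspec]
    have "form_holds M \<iota> (prod_form (n + x) (n + y) (n + x \<otimes>\<^bsub>H\<^esub> y))"
      if "x \<in> carrier H" "y \<in> carrier H" for x y
      by (rule forms, intro UnI1 image_eqI[of _ _ "(x, y)"]) (use that in auto)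
    moreover have "form_holds M \<iota> (neq_form (n + x) (n + y))"
      if "x \<in> carrier H" "y \<in> carrier H" "x \<noteq> y" for x y
      by (rule forms, intro UnI1 UnI2 image_eqI[of _ _ "(x, y)"]) (use that in auto)
    ultimately have "(\<lambda>x. \<iota> (n + x)) \<in> mon H M"
      using \<iota> by (auto simp: mon_def hom_def inj_on_def)
    from word_kernel_hom[OF H.is_group grp this a]
    have "word_kernel M (\<lambda>i. \<iota> (n + a i)) n = word_kernel H a n" .
    moreover have "\<iota> i = \<iota> (n + a i)" if "i < n" for i
    proof -
      have "form_holds M \<iota> (eq_form i (n + a i))"
        by (rule forms, rule UnI2) (use that in auto)
      then show ?thesis by simp
    qed
    then have "word_eval M \<iota> w = word_eval M (\<lambda>i. \<iota> (n + a i)) w" if "w \<in> words_over n" for w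
      using word_eval_cong[OF that, of \<iota> "\<lambda>i. \<iota> (n + a i)"] by blast
    then have "word_kernel M \<iota> n = word_kernel M (\<lambda>i. \<iota> (n + a i)) n"
      unfolding word_kernel_def by (intro Collect_cong conj_cong refl) simp
    ultimately show ?thesis by simp
  qed
  ultimately show ?thesis
    unfolding word_kernel_def[of _ _ n] by (intro recursive_set_if_determined) 
qed

section \<open>Enumerating countable groups\<close>

lemma enumerate_group:
  fixes M :: "'a monoid"
  assumes "group M" "bij_betw h (carrier M) (UNIV :: nat set)"
  obtains g where "g \<in> enumerated_groups" "h \<in> iso M (group_of g)"
proof -
  let ?N = "image_group h M"
  have inj: "inj_on h (carrier M)" and surj: "h ` carrier M = UNIV"
    using assms(2) by (auto simp: bij_betw_def)
  have N: "carrier ?N = UNIV" using surj by (simp add: image_group_def)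
  let ?g = "(\<lambda>(x, y). x \<otimes>\<^bsub>?N\<^esub> y, \<lambda>x. inv\<^bsub>?N\<^esub> x, \<one>\<^bsub>?N\<^esub>)"
  have g: "group_of ?g = ?N"
    using N by (simp add: group_of_def image_group_def)
  have iso: "group_iso M ?N h (inv_into (carrier M) h)"
    using assms(1) inj by (rule group_iso_image_group)
  have grp: "group ?N" using iso by (simp add: group_iso_def)
  have "?g \<in> enumerated_groups"
    using grp N group.r_inv[OF grp] group.l_inv[OF grp] by (simp add: enumerated_groups_def g)
  moreover have "h \<in> iso M ?N"
    using assms(2) N group_iso.f_mult[OF iso] by (simp add: iso_def hom_def)
  ultimately show thesis using that[of ?g] g by simp
qed

text \<open>
  Both complements of the prescribed finite part are countably infinite.
\<close>
lemma extend_finite_bijection: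
  fixes A :: "nat set" and \<kappa> :: "nat \<Rightarrow> nat"
  assumes "inj \<kappa>" "range \<kappa> \<subseteq> A"
  obtains h where "bij_betw h A (UNIV :: nat set)" "\<And>j. j < r \<Longrightarrow> h (\<kappa> j) = j"
proof -
  let ?B = "A - \<kappa> ` {..<r}"
  have "infinite A"
    using assms finite_subset range_inj_infinite by blast
  then have B: "bij_betw (to_nat_on ?B) ?B UNIV"
    by (intro to_nat_on_infinite) auto
  let ?h = "\<lambda>x. if x \<in> \<kappa> ` {..<r} then inv_into UNIV \<kappa> x else r + to_nat_on ?B x"
  have "bij_betw ?h (\<kappa> ` {..<r}) {..<r}"
    using assms(1) by (intro bij_betwI[of _ _ _ \<kappa>]) auto
  moreover have "bij_betw ?h ?B {r..}"
  proof -
    have "bij_betw (\<lambda>j. r + j) UNIV {r..}"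
      by (intro bij_betwI[of _ _ _ "\<lambda>j. j - r"]) auto
    from bij_betw_trans[OF B this]
    have "bij_betw (\<lambda>x. r + to_nat_on ?B x) ?B {r..}" by (simp add: comp_def)
    then show ?thesis by (rule bij_betw_cong[THEN iffD1, rotated]) auto
  qed
  ultimately have "bij_betw ?h (\<kappa> ` {..<r} \<union> ?B) ({..<r} \<union> {r..})"
    by (rule bij_betw_combine) auto
  moreover have "\<kappa> ` {..<r} \<union> ?B = A" "{..<r} \<union> {r..} = (UNIV :: nat set)"
    using assms(2) by auto
  ultimately have "bij_betw ?h A UNIV" by simp
  moreover have "?h (\<kappa> j) = j" if "j < r" for j
    using that assms(1) by simp
  ultimately show thesis by (rule that)
qed

section \<open>Baire category\<close>

text \<open>
  Otherwise the complements of the members of \<open>\<A>\<close> are dense open sets, and their intersection with the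
  dense open sets that witness the comeagerness of \<open>C\<close> is empty.
\<close>
lemma Baire_closed_cover:
  assumes X: "completely_metrizable_space X" and ne: "topspace X \<noteq> {}"
    and C: "comeager_in X C" and "countable \<A>" "C \<subseteq> \<Union>\<A>"
    and cl: "\<And>A. A \<in> \<A> \<Longrightarrow> closedin X A"
  obtains A where "A \<in> \<A>" "X interior_of A \<noteq> {}"
proof -
  obtain \<U> where \<U>: "countable \<U>" "\<And>U. U \<in> \<U> \<Longrightarrow> openin X U \<and> X closure_of U = topspace X"
    "topspace X \<inter> \<Inter>\<U> \<subseteq> C"
    using C unfolding comeager_in_def by blast
  have "\<exists>A\<in>\<A>. X interior_of A \<noteq> {}"
  proof (rule ccontr)
    assume empty: "\<not> (\<exists>A\<in>\<A>. X interior_of A \<noteq> {})"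
    let ?\<V> = "\<U> \<union> (\<lambda>A. topspace X - A) ` \<A>"
    have "X closure_of \<Inter>?\<V> = topspace X"
    proof (rule Baire_category)
      show "countable ?\<V>" using \<U>(1) assms(4) by blast
      fix V
      assume "V \<in> ?\<V>"
      then consider "V \<in> \<U>" | A where "A \<in> \<A>" "V = topspace X - A" by blast
      then show "openin X V \<and> X closure_of V = topspace X"
        using \<U>(2) cl empty by cases (auto simp: closure_of_complement)
    qed (use X in blast)
    then have "\<Inter>?\<V> \<inter> topspace X \<noteq> {}"
      using ne dense_intersects_open[of X "\<Inter>?\<V>"] openin_topspace[of X] by blast
    then obtain x where x: "x \<in> topspace X" "\<And>V. V \<in> ?\<V> \<Longrightarrow> x \<in> V" by blast
    have "x \<in> \<Inter>\<U>" using x(2) by blast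
    then have "x \<in> C" using \<U>(3) x(1) by blast
    then obtain A where "A \<in> \<A>" "x \<in> A" using assms(5) by blast
    then show False using x(2)[of "topspace X - A"] by blast
  qed
  then show thesis using that by blast
qed

lemma comeager_meets_open:
  assumes X: "completely_metrizable_space X" and C: "comeager_in X C"
    and "openin X V" "V \<noteq> {}"
  shows "C \<inter> V \<noteq> {}"
proof -
  obtain \<U> where \<U>: "countable \<U>" "\<And>U. U \<in> \<U> \<Longrightarrow> openin X U \<and> X closure_of U = topspace X"
    "topspace X \<inter> \<Inter>\<U> \<subseteq> C"
    using C unfolding comeager_in_def by blast
  have "X closure_of \<Inter>\<U> = topspace X"
    using X \<U>(1,2) by (intro Baire_category) auto
  then have "\<Inter>\<U> \<inter> V \<noteq> {}"
    using assms(3,4) unfolding dense_intersects_open by blast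
  then show ?thesis
    using \<U>(3) openin_subset[OF assms(3)] by blast
qed

section \<open>No comeager isomorphism class\<close>

text \<open>
  The first \<open>n\<close> variables name the tuple \<open>a\<close>, and the variable \<open>n + x\<close> names the element \<open>x\<close> of \<open>g\<close>.
  The theory consists of the axioms of \<open>P\<close>, the statement that all elements \<open>x\<close> are distinct, and the
  finite part of the multiplication table.  Its models are infinite groups with \<open>P\<close>, so each of them
  can be enumerated in such a way that finitely many prescribed elements get their correct
  numbers.  The result lies in the neighbourhood \<open>agree r g\<close>, where the set of relations of \<open>a\<close> is
  known.  Hence the theory determines this set.
\<close>
lemma recursive_word_kernel_if_generic:
  fixes a :: "nat \<Rightarrow> nat"
  assumes ax: "recursively_axiomatizable TYPE(nat) P" and g: "g \<in> groups_with P"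
    and generic: "\<And>g'. g' \<in> agree r g \<Longrightarrow> g' \<in> groups_with P \<Longrightarrow> word_kernel (group_of g') a n = N"
  shows "recursive_set (word_code ` N)"
proof -
  obtain T where T: "recursive_set (form_code ` T)" "\<forall>p\<in>T. sentence p"
    "\<And>G :: nat monoid. group G \<Longrightarrow> satisfies G P \<longleftrightarrow> is_model G T"
    using ax unfolding recursively_axiomatizable_def by blast
  have g_enum: "g \<in> enumerated_groups" and g_P: "satisfies (group_of g) P"
    using g by (auto simp: groups_with_def)
  let ?table = "(\<lambda>(x, y). prod_form (n + x) (n + y) (n + fst g (x, y))) ` ({..<r} \<times> {..<r})
    \<union> (\<lambda>i. eq_form i (n + a i)) ` {..<n}"
  let ?\<Gamma> = "insert triv_form T \<union> insert triv_form {neq_form (n + x) (n + y) | x y. x \<noteq> y}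
    \<union> insert triv_form ?table"
  let ?\<iota> = "\<lambda>i. if i < n then a i else i - n"
  have table: "enumerable (insert triv_form ?table)"
    by (intro enumerable_finite finite.insertI finite_UnI finite_imageI) auto
  have "enumerable ?\<Gamma>"
    by (intro enumerable_Un table enumerable_distinct enumerable_recursive[OF T(1)])
  moreover have "models (group_of g) ?\<iota> ?\<Gamma>"
  proof -
    have "is_model (group_of g) T"
      using T(3) g_P group_group_of[OF g_enum] by blast
    then have "form_holds (group_of g) ?\<iota> \<phi>" if "\<phi> \<in> T" for \<phi>
      using that by (simp add: is_model_def)
    moreover have "form_holds (group_of g) ?\<iota> \<phi>"
      if "\<phi> \<in> insert triv_form {neq_form (n + x) (n + y) | x y. x \<noteq> y} \<union> insert triv_form ?table" for \<phi>
      using that by auto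
    ultimately show ?thesis
      using group_group_of[OF g_enum] unfolding models_def by auto
  qed
  moreover have "word_kernel M \<iota> n = N" if M: "models M \<iota> ?\<Gamma>" for M :: "nat monoid" and \<iota>
  proof -
    note M' = M[unfolded models_def]
    have grp: "group M" using M' by (rule conjunct1)
    have \<iota>: "range \<iota> \<subseteq> carrier M" using M'[THEN conjunct2] by (rule conjunct1)
    note forms = M'[THEN conjunct2, THEN conjunct2, THEN bspec]
    have "models M \<iota> T"
      using grp \<iota> forms by (simp add: models_def)
    then have M_P: "satisfies M P"
      using T(3)[OF grp] is_model_if_sentences[OF T(2)] by blast
    have "form_holds M \<iota> (neq_form (n + x) (n + y))" if "x \<noteq> y" for x y
      by (rule forms) (use that in blast)
    then have "inj (\<lambda>x. \<iota> (n + x))"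
      by (auto simp: inj_on_def)
    moreover have "range (\<lambda>x. \<iota> (n + x)) \<subseteq> carrier M" using \<iota> by auto
    \<comment> \<open>the numbers that have to be correct: those that occur in the finite part of the table or in the tuple\<close>
    moreover have "finite (insert r (fst g ` ({..<r} \<times> {..<r}) \<union> a ` {..<n}))" by auto
    then obtain k where k: "\<forall>x \<in> insert r (fst g ` ({..<r} \<times> {..<r}) \<union> a ` {..<n}). x < k"
      using finite_nat_set_iff_bounded by blast
    ultimately obtain h where h: "bij_betw h (carrier M) (UNIV :: nat set)"
      "\<And>j. j < k \<Longrightarrow> h (\<iota> (n + j)) = j"
      using extend_finite_bijection[of "\<lambda>x. \<iota> (n + x)" "carrier M" k] by blast
    obtain g' where g': "g' \<in> enumerated_groups" "h \<in> iso M (group_of g')"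
      using enumerate_group[OF grp h(1)] by blast
    have grp': "group (group_of g')" using g'(1) by (rule group_group_of)
    have hom: "h \<in> hom M (group_of g')" using g'(2) by (simp add: iso_def)
    have \<iota>_in: "\<iota> i \<in> carrier M" for i using \<iota> by blast
    have "satisfies (group_of g') P"
      using satisfies_iso[OF group_iso_if_iso[OF grp grp' g'(2)]] M_P by blast
    then have "g' \<in> groups_with P" using g'(1) by (simp add: groups_with_def)
    moreover have "g' \<in> agree r g"
      unfolding agree_def
    proof (intro CollectI allI impI)
      fix x y
      assume xy: "x < r" "y < r"
      have "form_holds M \<iota> (prod_form (n + x) (n + y) (n + fst g (x, y)))"
        by (rule forms, intro UnI2 insertI2 UnI1 image_eqI[of _ _ "(x, y)"]) (use xy in auto)
      then have "h (\<iota> (n + x)) \<otimes>\<^bsub>group_of g'\<^esub> h (\<iota> (n + y)) = h (\<iota> (n + fst g (x, y)))"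
        using hom_mult[OF hom \<iota>_in \<iota>_in, of "n + x" "n + y"] by simp
      moreover have "x < k" "y < k" "fst g (x, y) < k"
        using k xy by (auto intro: less_trans)
      ultimately show "fst g' (x, y) = fst g (x, y)" by (simp add: h(2))
    qed
    ultimately have "word_kernel (group_of g') a n = N" using generic by blast
    moreover have "h \<in> mon M (group_of g')"
      using g'(2) by (auto simp: mon_def iso_def bij_betw_def)
    then have "word_kernel (group_of g') (\<lambda>i. h (\<iota> i)) n = word_kernel M \<iota> n"
      using word_kernel_hom[OF grp grp'] \<iota> by blast
    moreover have "h (\<iota> i) = a i" if "i < n" for i
    proof -
      have "form_holds M \<iota> (eq_form i (n + a i))"
        by (rule forms, intro UnI2 insertI2 UnI2) (use that in blast)
      then have "h (\<iota> i) = h (\<iota> (n + a i))" by simp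
      then show ?thesis using h(2) k that by simp
    qed
    then have "word_eval (group_of g') (\<lambda>i. h (\<iota> i)) w = word_eval (group_of g') a w"
      if "w \<in> words_over n" for w
      using word_eval_cong[OF that, of "\<lambda>i. h (\<iota> i)" a] by blast
    then have "word_kernel (group_of g') (\<lambda>i. h (\<iota> i)) n = word_kernel (group_of g') a n"
      unfolding word_kernel_def by (intro Collect_cong conj_cong refl) simp
    ultimately show ?thesis by simp
  qed
  ultimately show ?thesis
    unfolding word_kernel_def by (intro recursive_set_if_determined)
qed

lemma topspace_enum_space: "topspace (enum_space P) = groups_with P"
  by (simp add: enum_space_def groups_with_def)

lemma enum_space_eq: "enum_space P = subtopology euclidean (groups_with P)"
  by (simp add: enum_space_def groups_with_def)

theorem theorem1p1p6:
  fixes P :: group_property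
  assumes "infinite (UNIV :: 'u set)"
    and "strongly_undecidable P"
    and "recursively_axiomatizable TYPE('u) P"
    and "boone_higman P"
    and "closed_under_subgroups TYPE('u) P"
  shows "\<not> (\<exists>C. comeager_in (enum_space P) C \<and> (\<forall>g\<in>C. \<forall>h\<in>C. group_of g \<cong> group_of h))"
proof (intro notI, elim exE conjE)
  fix C
  assume C: "comeager_in (enum_space P) C"
    and iso: "\<forall>g\<in>C. \<forall>h\<in>C. group_of g \<cong> group_of h"
  have ax: "recursively_axiomatizable TYPE(nat) P"
    using assms(1,3) by (rule recursively_axiomatizable_nat)
  have sub: "closed_under_subgroups TYPE(nat) P"
    using assms(1,5) by (rule closed_under_subgroups_nat)
  obtain R n W where RW: "finite R" "R \<subseteq> words_over n" "finite W" "W \<subseteq> words_over n"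
    and ex: "\<exists>(H :: nat monoid) a. group H \<and> satisfies H P \<and> (\<forall>i<n. a i \<in> carrier H) \<and>
       generate H (a ` {..<n}) = carrier H \<and> marked_tuple R W H a"
    and undec: "\<And>(H :: nat monoid) a. group H \<Longrightarrow> (\<And>i. i < n \<Longrightarrow> a i \<in> carrier H) \<Longrightarrow>
       satisfies (H\<lparr>carrier := generate H (a ` {..<n})\<rparr>) P \<Longrightarrow> marked_tuple R W H a \<Longrightarrow>
       \<not> recursive_set (word_code ` word_kernel H a n)"
  proof (rule strongly_undecidable_tuples[OF assms(2)], goal_cases)
    case 1
    from 1(2-) show ?case by (rule 1(1))
  qed
  obtain H :: "nat monoid" and a where H: "group H" "satisfies H P" "\<And>i. i < n \<Longrightarrow> a i \<in> carrier H"
      "generate H (a ` {..<n}) = carrier H" "marked_tuple R W H a"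
    using ex by blast
  have "\<not> recursive_set (word_code ` word_kernel H a n)"
  proof (rule undec)
    show "satisfies (H\<lparr>carrier := generate H (a ` {..<n})\<rparr>) P"
      using H(2) unfolding H(4) by simp
  qed (rule H; assumption?)+
  moreover have "recursive_set (word_code ` word_kernel H a n)" if "finite (carrier H)"
    using H(1) that H(3) by (rule recursive_word_kernel_if_finite)
  ultimately have inf: "infinite (carrier H)" by blast
  \<comment> \<open>a finite group has decidable relations, so \<open>H\<close> has an enumerated copy\<close>
  define h where "h = to_nat_on (carrier H)"
  have h: "bij_betw h (carrier H) (UNIV :: nat set)"
    unfolding h_def using inf by (intro to_nat_on_infinite) simp_all
  obtain g\<^sub>0 where g\<^sub>0: "g\<^sub>0 \<in> enumerated_groups" "h \<in> iso H (group_of g\<^sub>0)"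
    using enumerate_group[OF H(1) h] by blast
  let ?X = "enum_space P"
  let ?b = "\<lambda>i. h (a i)"
  \<comment> \<open>the enumerated groups in which the tuple behaves as in the copy of \<open>H\<close>\<close>
  define V where "V = groups_with P \<inter> {g. \<forall>w\<in>R. word_value ?b w g = snd (snd g)} \<inter>
    {g. \<forall>u\<in>W. \<forall>v\<in>W. u \<noteq> v \<longrightarrow> word_value ?b u g \<noteq> word_value ?b v g}"
  have X: "completely_metrizable_space ?X"
    unfolding enum_space_eq
    using closed_groups_with[OF ax sub]
    by (intro completely_metrizable_space_closedin completely_metrizable_enum_structure) simp
  have V_iff: "g \<in> V \<longleftrightarrow> g \<in> groups_with P \<and> marked_tuple R W (group_of g) ?b" for g
  proof (cases "g \<in> groups_with P")
    case True
    then have "g \<in> enumerated_groups" by (simp add: groups_with_def)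
    have "inj_on (word_eval (group_of g) ?b) W \<longleftrightarrow>
        (\<forall>u\<in>W. \<forall>v\<in>W. u \<noteq> v \<longrightarrow> word_value ?b u g \<noteq> word_value ?b v g)"
      unfolding inj_on_def word_value_eq[OF \<open>g \<in> enumerated_groups\<close>] by metis
    then show ?thesis
      using True by (simp add: V_def marked_tuple_def word_value_eq[OF \<open>g \<in> enumerated_groups\<close>])
  qed (simp add: V_def)
  have "g\<^sub>0 \<in> V"
  proof -
    have grp: "group (group_of g\<^sub>0)" using g\<^sub>0(1) by (rule group_group_of)
    interpret iso: group_iso H "group_of g\<^sub>0" h "inv_into (carrier H) h"
      using H(1) grp g\<^sub>0(2) by (rule group_iso_if_iso)
    have eval: "word_eval (group_of g\<^sub>0) ?b w = h (word_eval H a w)" if "w \<in> words_over n" for w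
      using iso.f.hom_word_eval[OF that, of a] H(3) by simp
    have closed: "word_eval H a w \<in> carrier H" if "w \<in> words_over n" for w
      using word_eval_closed[OF H(1) H(3) that] .
    have "marked_tuple R W (group_of g\<^sub>0) ?b"
      unfolding marked_tuple_def
    proof
      show "\<forall>w\<in>R. word_eval (group_of g\<^sub>0) ?b w = \<one>\<^bsub>group_of g\<^sub>0\<^esub>"
        using H(5) RW(2) eval iso.f.hom_one by (auto simp: marked_tuple_def)
      have "inj_on (word_eval H a) W" using H(5) by (simp add: marked_tuple_def)
      moreover have "inj_on h (word_eval H a ` W)"
        using h closed RW(4) by (auto simp: bij_betw_def intro: inj_on_subset)
      ultimately have "inj_on (h \<circ> word_eval H a) W" by (rule comp_inj_on)
      moreover have "inj_on (word_eval (group_of g\<^sub>0) ?b) W \<longleftrightarrow> inj_on (h \<circ> word_eval H a) W"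
        using RW(4) eval by (intro inj_on_cong) auto
      ultimately show "inj_on (word_eval (group_of g\<^sub>0) ?b) W" by simp
    qed
    moreover have "satisfies (group_of g\<^sub>0) P"
      using iso.satisfies_imp H(2) by blast
    ultimately show ?thesis
      unfolding V_iff using g\<^sub>0(1) by (simp add: groups_with_def)
  qed
  moreover have "openin ?X V"
  proof -
    have "open {g. \<forall>w\<in>R. word_value ?b w g = snd (snd g)}"
    proof -
      have "{g. \<forall>w\<in>R. word_value ?b w g = snd (snd g)} = (\<Inter>w\<in>R. {g. word_value ?b w g = snd (snd g)})"
        by auto
      then show ?thesis
        using RW(1) by (auto intro!: open_INT open_eq_locally_constant locally_constant_word_value
            locally_constant_one)
    qed
    moreover have "open {g. \<forall>u\<in>W. \<forall>v\<in>W. u \<noteq> v \<longrightarrow> word_value ?b u g \<noteq> word_value ?b v g}"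
    proof -
      have "{g. \<forall>u\<in>W. \<forall>v\<in>W. u \<noteq> v \<longrightarrow> word_value ?b u g \<noteq> word_value ?b v g} =
          (\<Inter>u\<in>W. \<Inter>v\<in>W - {u}. - {g. word_value ?b u g = word_value ?b v g})"
        by auto
      then show ?thesis
        using RW(3) by (auto intro!: open_INT open_Compl closed_eq_locally_constant
            locally_constant_word_value)
    qed
    ultimately show ?thesis
      unfolding V_def enum_space_eq Int_assoc by (intro openin_open_Int open_Int)
  qed
  ultimately have "C \<inter> V \<noteq> {}"
    using comeager_meets_open[OF X C] by blast
  then obtain k where k: "k \<in> C" "k \<in> V" by blast
  have k': "k \<in> groups_with P" "marked_tuple R W (group_of k) ?b"
    using k(2) unfolding V_iff by (rule conjunct1, rule conjunct2)
  then have k_enum: "k \<in> enumerated_groups" by (simp add: groups_with_def)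
  define N where "N = word_kernel (group_of k) ?b n"
  \<comment> \<open>the tuple \<open>c\<close> has the same relations as the tuple \<open>?b\<close> in \<open>k\<close>\<close>
  define A where "A c = groups_with P \<inter> {g. word_kernel (group_of g) (\<lambda>i. c ! i) n = N}" for c :: "nat list"
  have closed_A: "closedin ?X (A c)" for c
  proof -
    let ?E = "\<lambda>w. {g. word_value (\<lambda>i. c ! i) w g = snd (snd g)}"
    let ?B = "(\<Inter>w\<in>words_over n \<inter> N. ?E w) \<inter> (\<Inter>w\<in>words_over n - N. - ?E w)"
    have N_sub: "N \<subseteq> words_over n" by (auto simp: N_def word_kernel_def)
    have "word_kernel (group_of g) (\<lambda>i. c ! i) n = N \<longleftrightarrow> g \<in> ?B" if "g \<in> groups_with P" for g
    proof -
      have g: "g \<in> enumerated_groups" using that by (simp add: groups_with_def)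
      have "word_kernel (group_of g) (\<lambda>i. c ! i) n = N \<longleftrightarrow> (\<forall>w\<in>words_over n. g \<in> ?E w \<longleftrightarrow> w \<in> N)"
        unfolding word_kernel_def word_value_eq[OF g] group_of_simps mem_Collect_eq using N_sub by blast
      also have "\<dots> \<longleftrightarrow> g \<in> ?B" by blast
      finally show ?thesis .
    qed
    then have "A c = groups_with P \<inter> ?B" unfolding A_def by blast
    moreover have "closed ?B"
      by (intro closed_Int closed_INT ballI closed_Compl closed_eq_locally_constant
          open_eq_locally_constant locally_constant_word_value locally_constant_one)
    ultimately show ?thesis
      unfolding enum_space_eq by (simp only: closedin_closed_Int)
  qed
  have cover: "C \<subseteq> \<Union>(range A)"
  proof
    fix g
    assume "g \<in> C"
    then have g: "g \<in> groups_with P"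
      using C by (auto simp: comeager_in_def topspace_enum_space)
    then have g': "g \<in> enumerated_groups" by (simp add: groups_with_def)
    obtain f where "f \<in> iso (group_of k) (group_of g)"
      using iso k(1) \<open>g \<in> C\<close> by (auto simp: is_iso_def)
    then have "f \<in> mon (group_of k) (group_of g)"
      by (auto simp: mon_def iso_def bij_betw_def)
    from word_kernel_hom[OF group_group_of[OF k_enum] group_group_of[OF g'] this, of n ?b]
    have "word_kernel (group_of g) (\<lambda>i. f (?b i)) n = N" by (simp add: N_def)
    moreover have "word_kernel (group_of g) (\<lambda>i. map (\<lambda>i. f (?b i)) [0..<n] ! i) n =
        word_kernel (group_of g) (\<lambda>i. f (?b i)) n"
      unfolding word_kernel_def
      by (intro Collect_cong conj_cong refl arg_cong2[of _ _ _ _ "(=)"] word_eval_cong[of _ n]) auto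
    ultimately have "g \<in> A (map (\<lambda>i. f (?b i)) [0..<n])"
      using g by (simp add: A_def)
    then show "g \<in> \<Union>(range A)" by blast
  qed
  obtain B where B: "B \<in> range A" "?X interior_of B \<noteq> {}"
  proof (rule Baire_closed_cover[OF X _ C _ cover])
    show "topspace ?X \<noteq> {}" using k'(1) by (auto simp: topspace_enum_space)
    show "countable (range A)" by simp
    show "closedin ?X B" if "B \<in> range A" for B using that closed_A by auto
  qed (rule that)
  then obtain c where c: "?X interior_of A c \<noteq> {}" by blast
  then obtain U g where U: "open U" "groups_with P \<inter> U \<subseteq> A c" and g: "g \<in> groups_with P" "g \<in> U"
  proof -
    obtain U where U: "open U" "?X interior_of A c = groups_with P \<inter> U"
      using openin_interior_of[of ?X "A c"] unfolding enum_space_eq openin_open by blast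
    show thesis
      using that[of U] U c interior_of_subset[of ?X "A c"] by blast
  qed
  obtain r where r: "agree r g \<inter> enumerated_groups \<subseteq> U"
    using open_contains_agree[OF U(1) g(2)] g(1) by (auto simp: groups_with_def)
  have "recursive_set (word_code ` N)"
  proof (rule recursive_word_kernel_if_generic[OF ax g(1)])
    fix g'
    assume "g' \<in> agree r g" "g' \<in> groups_with P"
    then have "g' \<in> A c" using r U(2) by (auto simp: groups_with_def)
    then show "word_kernel (group_of g') (\<lambda>i. c ! i) n = N" by (simp add: A_def)
  qed
  moreover have "satisfies ((group_of k)\<lparr>carrier := generate (group_of k) (?b ` {..<n})\<rparr>) P"
  proof -
    interpret group "group_of k" using k_enum by (rule group_group_of)
    have "subgroup (generate (group_of k) (?b ` {..<n})) (group_of k)"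
      by (intro generate_is_subgroup) simp
    then show ?thesis
      using sub is_group k'(1) unfolding closed_under_subgroups_def groups_with_def by blast
  qed
  then have "\<not> recursive_set (word_code ` word_kernel (group_of k) ?b n)"
    by (intro undec group_group_of k'(2) k_enum) simp
  ultimately show False by (simp add: N_def)
qed


end
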